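(* Let $(C,0)\subset(\mathbb{C}^2,0)$ be a germ of a reduced plane curve given by $f(x,y)=0$, $f\in\mathcal{O}_{\mathbb{C}^2,0}$, and let $(S,0)\subset(\mathbb{C}^3,0)$ be its stabilization, i.e. the surface germ given by $f(x,y)-z^2=0$. Let $\pi:(\mathcal{X},\mathcal{D})\to(\mathbb{C}^2,0)$ be an embedded resolution of $(C,0)$ with exceptional divisor $\mathcal{D}=\pi^{-1}(0)=\bigcup_{i=1}^r E_i$ such that the strict transform of $C$ intersects $\mathcal{D}$ only at points of components $E_i$ with even multiplicity $m_i=v_i(f)$. Put $\sigma_i=1$ if $m_i$ is even and $\sigma_i=2$ if $m_i$ is odd. Then the Poincaré series $P_{S,0}(t)$ of the arc filtration on $\mathcal{O}_{S,0}$ is equal to the reduction $\overline{Q}(t)$ of the series $$Q(t_1,\ldots,t_r)=\left(1+t_1^{\sigma_1m_1/2}\cdots t_r^{\sigma_rm_r/2}\right)\cdot P_\pi(t_1^{\sigma_1},\ldots,t_r^{\sigma_r}),$$ where $P_\pi(t_1,\ldots,t_r)$ is the Poincaré series of the divisorial filtration on $\mathcal{O}_{\mathbb{C}^2,0}$ defined by $\pi$.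
   Context: Arc filtration. For a germ $(V,0)$ of a complex analytic variety, $\mathcal{O}_{V,0}$ is the ring of germs of holomorphic functions on $(V,0)$. An arc on $(V,0)$ is a germ of a complex analytic mapping $\phi:(\mathbb{C},0)\to(V,0)$. For $g\in\mathcal{O}_{V,0}$, $v_\phi(g)\in\mathbb{Z}_{\ge0}\cup\{+\infty\}$ is the order of vanishing at the origin of $g\circ\phi$ ($+\infty$ if $g\circ\phi\equiv0$), and $v(g)=\min_\phi v_\phi(g)$ over all arcs $\phi$ on $(V,0)$. The arc filtration is given by the ideals $F_i=\{g\in\mathcal{O}_{V,0}: v(g)\ge i\}$, $i\ge 0$, and its Poincaré series is $P_{V,0}(t)=\sum_{i\ge0}\dim_{\mathbb{C}}(F_i/F_{i+1})\,t^i$. Resolution. An embedded resolution $\pi$ of $(C,0)$ is a proper modification of $(\mathbb{C}^2,0)$ by a smooth surface (a composition of point blow-ups over the origin), an isomorphism outside the origin, such that the total transform of $C$ is a normal crossing divisor; the components $E_i$ of $\mathcal{D}$ are each isomorphic to $\mathbb{CP}^1$. For $0\neq g\in\mathcal{O}_{\mathbb{C}^2,0}$, $v_i(g)$ is the multiplicity of $g\circ\pi$ along $E_i$ (and $v_i(0)=+\infty$). Divisorial filtration. For $\underline v=(v_1,\ldots,v_r)\in\mathbb{Z}^r$ let $J(\underline v)=\{g\in\mathcal{O}_{\mathbb{C}^2,0}: v_i(g)\ge v_i,\ i=1,\ldots,r\}$. With $\underline t^{\underline v}=t_1^{v_1}\cdots t_r^{v_r}$ and $\underline 1=(1,\ldots,1)$,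 its Poincaré series is the power series $$P_\pi(t_1,\ldots,t_r)=\frac{\left(\sum_{\underline v\in\mathbb{Z}^r}\dim\left(J(\underline v)/J(\underline v+\underline 1)\right)\underline t^{\underline v}\right)\cdot\prod_{i=1}^r(t_i-1)}{t_1\cdots t_r-1},$$ where the sum over $\mathbb{Z}^r$ is a formal Laurent series (infinite in all directions for $r\ge2$). Reduction. For a power series $P(t_1,\ldots,t_r)$, the reduction $\overline{P}(t)$ is the one-variable series obtained by substituting each monomial $t_1^{k_1}\cdots t_r^{k_r}$ by $t^{\min_i k_i}$ (coefficients unchanged). *)

theory Defs
  imports
    "HOL-Complex_Analysis.Complex_Analysis"
    "HOL-Library.Function_Algebras"
    "HOL-Library.Extended_Nat"
begin

section \<open>Germs of holomorphic functions\<close>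

text \<open>
  A germ at the origin is handled through its representatives: total functions of which only the
  values near \<open>0\<close> matter.  Every notion below depends only on the germ.
\<close>

definition holo_germ :: "(complex ^ 'n \<Rightarrow> complex) \<Rightarrow> bool" where
  "holo_germ g \<longleftrightarrow>
     (\<forall>\<^sub>F x in nhds 0. \<exists>D. (g has_derivative D) (at x) \<and> (\<forall>c v. D (c *s v) = c * D v))"

text \<open>
  The ring of germs of holomorphic functions on \<open>(V,0)\<close>: functions that near \<open>0\<close> coincide on \<open>V\<close>
  with a holomorphic function of the ambient space.  For \<open>V = UNIV\<close> this is \<open>holo_germ\<close>.
\<close>

definition germ_ring :: "(complex ^ 'n) set \<Rightarrow> (complex ^ 'n \<Rightarrow> complex) set" where
  "germ_ring V = {g. \<exists>G. holo_germ G \<and> (\<forall>\<^sub>F x in nhds 0. x \<in> V \<longrightarrow> g x = G x)}"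

definition reduced_germ :: "(complex ^ 'n \<Rightarrow> complex) \<Rightarrow> bool" where
  "reduced_germ f \<longleftrightarrow> holo_germ f \<and> f 0 = 0 \<and>
     (\<forall>g h. holo_germ g \<and> holo_germ h \<and> (\<forall>\<^sub>F x in nhds 0. f x = (h x)\<^sup>2 * g x) \<longrightarrow> h 0 \<noteq> 0)"

definition local_coordinates :: "(complex ^ 'n \<Rightarrow> complex ^ 'n) \<Rightarrow> bool" where
  "local_coordinates \<psi> \<longleftrightarrow> \<psi> 0 = 0 \<and> (\<forall>i. holo_germ (\<lambda>x. \<psi> x $ i)) \<and>
     (\<exists>\<theta>. \<theta> 0 = 0 \<and> (\<forall>i. holo_germ (\<lambda>x. \<theta> x $ i)) \<and>
        (\<forall>\<^sub>F x in nhds 0. \<theta> (\<psi> x) = x \<and> \<psi> (\<theta> x) = x))"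

section \<open>Dimension of a quotient space\<close>

definition fun_scale :: "complex \<Rightarrow> ('a \<Rightarrow> complex) \<Rightarrow> 'a \<Rightarrow> complex" where
  "fun_scale c g = (\<lambda>x. c * g x)"

global_interpretation fun_space: vector_space fun_scale
  by unfold_locales (auto simp: fun_scale_def fun_eq_iff algebra_simps)

text \<open>
  The residue classes of \<open>B\<close> form a basis of \<open>V / W\<close> (without repetitions).
\<close>

definition basis_mod :: "('a \<Rightarrow> complex) set \<Rightarrow> ('a \<Rightarrow> complex) set \<Rightarrow> ('a \<Rightarrow> complex) set \<Rightarrow> bool" where
  "basis_mod V W B \<longleftrightarrow> B \<subseteq> V \<and> V \<subseteq> fun_space.span (W \<union> B) \<and>
     (\<forall>b\<in>B. b \<notin> fun_space.span (W \<union> (B - {b})))"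

text \<open>
  \<open>dim (V / W)\<close> for subspaces \<open>W \<subseteq> V\<close>.  In all uses below \<open>W\<close> contains all representatives of the
  zero germ, so that this is the dimension of the quotient of the spaces of germs.
\<close>

definition quot_dim :: "('a \<Rightarrow> complex) set \<Rightarrow> ('a \<Rightarrow> complex) set \<Rightarrow> nat" where
  "quot_dim V W = card (SOME B. basis_mod V W B)"

section \<open>Arc filtration\<close>

definition arc_on :: "(complex ^ 'n) set \<Rightarrow> (complex \<Rightarrow> complex ^ 'n) \<Rightarrow> bool" where
  "arc_on V \<phi> \<longleftrightarrow> (\<forall>i. (\<lambda>\<tau>. \<phi> \<tau> $ i) analytic_on {0}) \<and> \<phi> 0 = 0 \<and> (\<forall>\<^sub>F \<tau> in nhds 0. \<phi> \<tau> \<in> V)"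

definition order_at_0 :: "(complex \<Rightarrow> complex) \<Rightarrow> enat" where
  "order_at_0 h = (if \<forall>\<^sub>F \<tau> in nhds 0. h \<tau> = 0 then \<infinity> else enat (nat (zorder h 0)))"

definition arc_val :: "(complex ^ 'n) set \<Rightarrow> (complex ^ 'n \<Rightarrow> complex) \<Rightarrow> enat" where
  "arc_val V g = (INF \<phi>\<in>{\<phi>. arc_on V \<phi>}. order_at_0 (g \<circ> \<phi>))"

definition arc_filtration :: "(complex ^ 'n) set \<Rightarrow> nat \<Rightarrow> (complex ^ 'n \<Rightarrow> complex) set" where
  "arc_filtration V k = {g \<in> germ_ring V. enat k \<le> arc_val V g}"

definition arc_Poincare :: "(complex ^ 'n) set \<Rightarrow> int fps" where
  "arc_Poincare V =
     Abs_fps (\<lambda>k. int (quot_dim (arc_filtration V k) (arc_filtration V (Suc k))))"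

definition stabilization :: "(complex ^ 2 \<Rightarrow> complex) \<Rightarrow> (complex ^ 3) set" where
  "stabilization f = {x. f (vector [x $ 1, x $ 2]) - (x $ 3)\<^sup>2 = 0}"

section \<open>Compositions of point blow-ups over the origin of the plane\<close>

text \<open>
  \<open>Affine c\<close> is the point \<open>[1 : c]\<close> of \<open>CP\<^sup>1\<close> and \<open>Infinite\<close> is \<open>[0 : 1]\<close>.
\<close>

datatype cp1 = Affine complex | Infinite

text \<open>
  The blow-up of the origin of \<open>\<complex>\<^sup>2\<close>, written in the standard coordinates \<open>(u,w)\<close> centred at the
  point of the exceptional curve that corresponds to a given direction:
  \<open>(x,y) = (u, u (c + w))\<close> at \<open>[1 : c]\<close>, where the exceptional curve is \<open>u = 0\<close>, and
  \<open>(x,y) = (u w, w)\<close> at \<open>[0 : 1]\<close>, where it is \<open>w = 0\<close>.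
\<close>

primrec blowup_chart :: "cp1 \<Rightarrow> complex ^ 2 \<Rightarrow> complex ^ 2" where
  "blowup_chart (Affine c) x = vector [x $ 1, x $ 1 * (c + x $ 2)]"
| "blowup_chart Infinite x = vector [x $ 1 * x $ 2, x $ 2]"

text \<open>
  A point infinitely near to the origin is a list of directions: \<open>[]\<close> is the origin itself, and
  \<open>p @ [d]\<close> is the point in direction \<open>d\<close> of the exceptional curve of the blow-up of \<open>p\<close>.  Each
  such point \<open>q\<close> carries the coordinates obtained by iterating \<open>blowup_chart\<close>; in them, the map
  down to \<open>\<complex>\<^sup>2\<close> is \<open>chart q\<close>.  Relative to the coordinates at \<open>p\<close>, the map from those at \<open>p @ s\<close>
  is \<open>chart s\<close>; it is injective outside the preimage of \<open>0\<close>.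
\<close>

type_synonym near_point = "cp1 list"

primrec chart :: "near_point \<Rightarrow> complex ^ 2 \<Rightarrow> complex ^ 2" where
  "chart [] = id"
| "chart (d # q) = blowup_chart d \<circ> chart q"

text \<open>
  A composition of \<open>r = CARD('r)\<close> point blow-ups over the origin is given by its centres
  \<open>node i\<close>: finitely many infinitely near points, such that with any centre the point of which it
  lies on the exceptional curve has also been blown up.  At least the origin is blown up.  Up to
  isomorphism over \<open>\<complex>\<^sup>2\<close> (blow-ups at distinct points of one surface commute) every nontrivial
  composition of point blow-ups over the origin is of this form.
\<close>

definition blowup_centres :: "('r::finite \<Rightarrow> near_point) \<Rightarrow> bool" where
  "blowup_centres node \<longleftrightarrow> inj node \<and> [] \<in> range node \<and>
     (\<forall>p d. p @ [d] \<in> range node \<longrightarrow> p \<in> range node)"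

text \<open>
  The points of the exceptional divisor \<open>D = \<pi>\<^sup>-\<^sup>1(0)\<close> of the resulting surface: those on the
  exceptional curve of some centre that are not blown up themselves.  The map \<open>\<pi>\<close> near such a
  point \<open>q\<close> is \<open>chart q\<close> near \<open>0\<close>.
\<close>

definition exc_divisor :: "('r::finite \<Rightarrow> near_point) \<Rightarrow> near_point set" where
  "exc_divisor node = {p @ [d] | p d. p \<in> range node \<and> p @ [d] \<notin> range node}"

text \<open>
  In the coordinates at \<open>p @ s\<close>, the strict transform of a set \<open>A\<close> given in the coordinates at
  \<open>p\<close>: the closure of the preimage of \<open>A - {0}\<close>.
\<close>

definition strict_transform :: "near_point \<Rightarrow> (complex ^ 2) set \<Rightarrow> (complex ^ 2) set" where
  "strict_transform s A = closure (chart s -` (A - {0}))"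

text \<open>
  The component \<open>E\<^sub>i\<close> of \<open>D\<close>: the strict transform of the exceptional curve of the blow-up of
  \<open>node i\<close>.  At the point \<open>node i @ [d]\<close> that curve is \<open>blowup_chart d -` {0}\<close>.
\<close>

definition exc_component :: "('r::finite \<Rightarrow> near_point) \<Rightarrow> 'r \<Rightarrow> near_point set" where
  "exc_component node i =
     {q \<in> exc_divisor node. \<exists>d s. q = node i @ d # s \<and>
        0 \<in> strict_transform s (blowup_chart d -` {0})}"

text \<open>The points at which \<open>D\<close> meets the strict transform of the curve \<open>f = 0\<close>.\<close>

definition strict_curve_points ::
    "('r::finite \<Rightarrow> near_point) \<Rightarrow> (complex ^ 2 \<Rightarrow> complex) \<Rightarrow> near_point set" where
  "strict_curve_points node f = {q \<in> exc_divisor node. 0 \<in> strict_transform q {x. f x = 0}}"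

text \<open>
  The multiplicity of \<open>g \<circ> \<pi>\<close> along \<open>E\<^sub>i\<close>.  It may be computed near any point of the curve, on the
  surface where that curve first appears; here this is done at the point \<open>[1 : 0]\<close>, near which
  the curve is \<open>u = 0\<close>.  The value for the zero germ is \<open>\<infinity>\<close>.
\<close>

definition div_val :: "('r::finite \<Rightarrow> near_point) \<Rightarrow> 'r \<Rightarrow> (complex ^ 2 \<Rightarrow> complex) \<Rightarrow> enat" where
  "div_val node i g =
     Sup {enat k | k. \<exists>h. holo_germ h \<and>
       (\<forall>\<^sub>F x in nhds 0. g (chart (node i @ [Affine 0]) x) = (x $ 1) ^ k * h x)}"

definition normal_crossing_germ :: "(complex ^ 2 \<Rightarrow> complex) \<Rightarrow> bool" where
  "normal_crossing_germ h \<longleftrightarrow>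
     (\<exists>\<psi> a b e. local_coordinates \<psi> \<and> holo_germ e \<and> e 0 \<noteq> 0 \<and>
        (\<forall>\<^sub>F x in nhds 0. h (\<psi> x) = (x $ 1) ^ a * (x $ 2) ^ b * e x))"

definition embedded_resolution ::
    "('r::finite \<Rightarrow> near_point) \<Rightarrow> (complex ^ 2 \<Rightarrow> complex) \<Rightarrow> bool" where
  "embedded_resolution node f \<longleftrightarrow> blowup_centres node \<and>
     (\<forall>q\<in>exc_divisor node. normal_crossing_germ (f \<circ> chart q))"

section \<open>Divisorial filtration\<close>

text \<open>
  As \<open>v\<^sub>i(g) \<ge> 0\<close>, truncating a negative bound at \<open>0\<close> does not change the condition.
\<close>

definition div_ideal ::
    "('r::finite \<Rightarrow> near_point) \<Rightarrow> ('r \<Rightarrow> int) \<Rightarrow> (complex ^ 2 \<Rightarrow> complex) set" where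
  "div_ideal node v = {g. holo_germ g \<and> (\<forall>i. enat (nat (v i)) \<le> div_val node i g)}"

text \<open>
  A formal series (possibly infinite in all directions) in \<open>t\<^sub>i\<close>, \<open>i :: 'r\<close>, is given by its
  coefficients.  It is a power series if it involves nonnegative exponents only.
\<close>

type_synonym 'r series = "('r \<Rightarrow> int) \<Rightarrow> int"

definition power_series :: "'r series \<Rightarrow> bool" where
  "power_series P \<longleftrightarrow> (\<forall>v. (\<exists>i. v i < 0) \<longrightarrow> P v = 0)"

definition div_Laurent :: "('r::finite \<Rightarrow> near_point) \<Rightarrow> 'r series" where
  "div_Laurent node v = int (quot_dim (div_ideal node v) (div_ideal node (\<lambda>i. v i + 1)))"

text \<open>Multiplication by \<open>\<Prod>\<^sub>i (t\<^sub>i - 1) = (\<Sum>K. (-1)\<^bsup>r - |K|\<^esup> \<Prod>\<^bsub>i \<in> K\<^esub> t\<^sub>i)\<close>.\<close>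

definition times_prod :: "'r::finite series \<Rightarrow> 'r series" where
  "times_prod L v =
     (\<Sum>K\<in>UNIV. (-1) ^ card (- K) * L (\<lambda>i. v i - (if i \<in> K then 1 else 0)))"

text \<open>
  The quotient by \<open>t\<^sub>1 \<cdots> t\<^sub>r - 1\<close> is taken in the ring of power series, in which this element is
  invertible.
\<close>

definition div_Poincare :: "('r::finite \<Rightarrow> near_point) \<Rightarrow> 'r series" where
  "div_Poincare node = (THE P. power_series P \<and>
     (\<forall>v. P (\<lambda>i. v i - 1) - P v = times_prod (div_Laurent node) v))"

text \<open>\<open>P(t\<^sub>1\<^bsup>s\<^sub>1\<^esup>, \<dots>, t\<^sub>r\<^bsup>s\<^sub>r\<^esup>)\<close> for positive \<open>s\<^sub>i\<close>\<close>

definition subst_powers :: "('r \<Rightarrow> nat) \<Rightarrow> 'r series \<Rightarrow> 'r series" where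
  "subst_powers s P w =
     (if \<forall>i. int (s i) dvd w i then P (\<lambda>i. w i div int (s i)) else 0)"

text \<open>\<open>(1 + t\<^sub>1\<^bsup>a\<^sub>1\<^esup> \<cdots> t\<^sub>r\<^bsup>a\<^sub>r\<^esup>) P\<close>\<close>

definition times_one_plus_monom :: "('r \<Rightarrow> nat) \<Rightarrow> 'r series \<Rightarrow> 'r series" where
  "times_one_plus_monom a P w = P w + P (\<lambda>i. w i - int (a i))"

text \<open>
  The reduction makes sense if only finitely many monomials are sent to each power of \<open>t\<close>.
\<close>

definition reduction_support :: "'r::finite series \<Rightarrow> nat \<Rightarrow> ('r \<Rightarrow> int) set" where
  "reduction_support P k = {w. P w \<noteq> 0 \<and> Min (range w) = int k}"

definition reducible_series :: "'r::finite series \<Rightarrow> bool" where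
  "reducible_series P \<longleftrightarrow> (\<forall>k. finite (reduction_support P k))"

definition reduction :: "'r::finite series \<Rightarrow> int fps" where
  "reduction P = Abs_fps (\<lambda>k. \<Sum>w\<in>reduction_support P k. P w)"

section \<open>The series attached to a resolution of a curve\<close>

definition curve_mult :: "('r::finite \<Rightarrow> near_point) \<Rightarrow> (complex ^ 2 \<Rightarrow> complex) \<Rightarrow> 'r \<Rightarrow> nat" where
  "curve_mult node f i = the_enat (div_val node i f)"

definition sigma :: "('r::finite \<Rightarrow> near_point) \<Rightarrow> (complex ^ 2 \<Rightarrow> complex) \<Rightarrow> 'r \<Rightarrow> nat" where
  "sigma node f i = (if even (curve_mult node f i) then 1 else 2)"

definition Q_series :: "('r::finite \<Rightarrow> near_point) \<Rightarrow> (complex ^ 2 \<Rightarrow> complex) \<Rightarrow> 'r series" where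
  "Q_series node f =
     times_one_plus_monom (\<lambda>i. sigma node f i * curve_mult node f i div 2)
       (subst_powers (sigma node f) (div_Poincare node))"

end

theory Submission
  imports Defs
begin

text \<open>Every element of \<open>\<O>\<^bsub>S,0\<^esub>\<close> is \<open>a + z b\<close> with \<open>a, b\<close> holomorphic in \<open>(x,y)\<close>, and an arc on \<open>S\<close> is an arc
  \<open>\<alpha>\<close> in the plane with a square root \<open>\<zeta>\<close> of \<open>f \<circ> \<alpha>\<close>.  The arcs \<open>(\<alpha>,\<zeta>)\<close> and \<open>(\<alpha>,-\<zeta>)\<close> occur
  together, so \<open>a + z b\<close> vanishes to order \<open>k\<close> along all arcs if and only if \<open>a \<circ> \<alpha>\<close> and
  \<open>\<zeta> (b \<circ> \<alpha>)\<close> separately do.  The claim behind the theorem is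

    \<open>v(a + z b) = min\<^sub>i min(\<sigma>\<^sub>i v\<^sub>i(a), \<sigma>\<^sub>i m\<^sub>i / 2 + \<sigma>\<^sub>i v\<^sub>i(b))\<close>.

  The bound \<open>\<le>\<close> comes from an arc that meets \<open>E\<^sub>i\<close> at a generic point with local intersection number \<open>\<sigma>\<^sub>i\<close>:
  there \<open>f\<close> has the even order \<open>\<sigma>\<^sub>i m\<^sub>i\<close>, so the arc lifts to \<open>S\<close> (\<open>generic_arc\<close>,
  \<open>vanishing_on_double_cover_bounds\<close>).  For \<open>\<ge>\<close>, a nonconstant arc lifts to a point \<open>q\<close> of the
  exceptional divisor (\<open>arc_lift\<close>).  If \<open>q\<close> is not on the strict transform of the curve, then near \<open>q\<close>
  the germ \<open>f\<close> is a monomial in the equations of the components through \<open>q\<close> times a unit.  As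
  \<open>f \<circ> \<alpha>\<close> is a square, either one of these components \<open>E\<^sub>i\<close> is met at least \<open>\<sigma>\<^sub>i\<close> times, or \<open>q\<close> is
  the intersection of two components of odd multiplicity, each met exactly once, and the mean of
  their two bounds suffices.  If \<open>q\<close> is on the strict transform, then it lies on a component of even
  multiplicity, for which \<open>\<sigma>\<^sub>i = 1\<close> (\<open>arc_controls_order\<close>, \<open>controls_order_bound\<close>).

  Hence \<open>F\<^sub>k\<close> is the sum of an ideal \<open>J(\<lceil>k/\<sigma>\<rceil>)\<close> for \<open>a\<close> and an ideal \<open>J(\<lceil>(k - \<sigma>m/2)/\<sigma>\<rceil>)\<close> for \<open>b\<close>, and
  dimensions add (\<open>quot_dim_arc_filtration\<close>).  On the other side, with \<open>d(v) = dim \<O>/J(v)\<close>, the Poincare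
  series has the coefficients \<open>P(v) = - \<Sum>\<^sub>K (-1)\<^bsup>|K|\<^esup> d(v + 1\<^sub>K)\<close> (\<open>div_Poincare_eq\<close>).  By Moebius inversion
  the sum of \<open>P(v)\<close> over \<open>v \<ge> a\<close> with \<open>v \<not>\<ge> b\<close> is \<open>d(b) - d(a)\<close> (\<open>sum_div_Poincare\<close>), and the reduction
  collects exactly such sums, one for each summand of the factor \<open>1 + t\<^bsup>\<sigma>m/2\<^esup>\<close> of \<open>Q\<close>.  These sums are
  finite because the divisorial valuations are comparable (\<open>exc_val_comparison\<close>): if one of them
  is large on a germ, then all are.

  The valuations are controlled by blowing up step by step.  A germ of multiplicity \<open>m\<close> pulls back to
  the \<open>m\<close>-th power of the exceptional equation times a germ whose restriction to the exceptional curve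
  is the leading form, a polynomial of degree at most \<open>m\<close> (\<open>blowup_affine\<close>).  This gives at once the
  local form of a germ at every infinitely near point (\<open>residual_germ_exists\<close>) and the comparison of
  valuations.  The facts on two complex variables that this requires are derived from Cauchy integrals
  with parameters.
\<close>

(* The symbol is kept for the components of vectors. *)
no_notation fps_nth (infixl "$" 75)

section \<open>Holomorphic functions of several variables\<close>

definition cdiff_at :: "(complex ^ 'n \<Rightarrow> complex) \<Rightarrow> complex ^ 'n \<Rightarrow> bool" where
  "cdiff_at g x \<longleftrightarrow> (\<exists>D. (g has_derivative D) (at x) \<and> (\<forall>c v. D (c *s v) = c * D v))"

lemma holo_germ_iff_cdiff: "holo_germ g \<longleftrightarrow> (\<forall>\<^sub>F x in nhds 0. cdiff_at g x)"
  by (simp add: holo_germ_def cdiff_at_def)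

lemma cdiff_at_const [simp]: "cdiff_at (\<lambda>x. c) x"
  unfolding cdiff_at_def by (rule exI[of _ "\<lambda>v. 0"]) auto

lemma cdiff_at_nth [simp]: "cdiff_at (\<lambda>x. x $ i) x"
  unfolding cdiff_at_def
  by (rule exI[of _ "\<lambda>v. v $ i"]) (auto intro!: bounded_linear_imp_has_derivative bounded_linear_vec_nth)

lemma cdiff_at_add:
  assumes "cdiff_at g x" "cdiff_at h x" shows "cdiff_at (\<lambda>x. g x + h x) x"
proof -
  obtain D E where "(g has_derivative D) (at x)" "\<forall>c v. D (c *s v) = c * D v"
      "(h has_derivative E) (at x)" "\<forall>c v. E (c *s v) = c * E v"
    using assms by (auto simp: cdiff_at_def)
  then show ?thesis unfolding cdiff_at_def
    by (intro exI[of _ "\<lambda>v. D v + E v"]) (auto intro!: derivative_eq_intros simp: algebra_simps)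
qed

lemma cdiff_at_mult:
  assumes "cdiff_at g x" "cdiff_at h x" shows "cdiff_at (\<lambda>x. g x * h x) x"
proof -
  obtain D E where "(g has_derivative D) (at x)" "\<forall>c v. D (c *s v) = c * D v"
      "(h has_derivative E) (at x)" "\<forall>c v. E (c *s v) = c * E v"
    using assms by (auto simp: cdiff_at_def)
  then show ?thesis unfolding cdiff_at_def
    by (intro exI[of _ "\<lambda>v. g x * E v + D v * h x"]) (auto intro!: derivative_eq_intros simp: algebra_simps)
qed

lemma cdiff_at_compose_outer:
  assumes "cdiff_at g x" "h field_differentiable at (g x)" shows "cdiff_at (\<lambda>x. h (g x)) x"
proof -
  obtain D d where *: "(g has_derivative D) (at x)" "\<forall>c v. D (c *s v) = c * D v"
      "(h has_derivative (*) d) (at (g x))"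
    using assms by (auto simp: cdiff_at_def field_differentiable_def has_field_derivative_def)
  then show ?thesis unfolding cdiff_at_def
    by (intro exI[of _ "\<lambda>v. d * D v"]) (auto dest: has_derivative_compose[OF *(1)])
qed

lemma cdiff_at_compose:
  fixes G :: "complex ^ 'n \<Rightarrow> complex" and \<Phi> :: "complex ^ 'm \<Rightarrow> complex ^ 'n"
  assumes "\<And>i. cdiff_at (\<lambda>x. \<Phi> x $ i) x" "cdiff_at G (\<Phi> x)" shows "cdiff_at (\<lambda>x. G (\<Phi> x)) x"
proof -
  obtain D where D: "\<And>i. ((\<lambda>x. \<Phi> x $ i) has_derivative D i) (at x)" "\<And>i c v. D i (c *s v) = c * D i v"
    using assms(1) unfolding cdiff_at_def by metis
  obtain E where E: "(G has_derivative E) (at (\<Phi> x))" "\<And>c v. E (c *s v) = c * E v"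
    using assms(2) unfolding cdiff_at_def by metis
  have "(\<Phi> has_derivative (\<lambda>v. \<chi> i. D i v)) (at x)"
  proof (subst has_derivative_componentwise_within, intro ballI)
    fix b :: "complex ^ 'n" assume "b \<in> Basis"
    then obtain i u where b: "b = axis i u" by (auto simp: Basis_vec_def)
    show "((\<lambda>x. \<Phi> x \<bullet> b) has_derivative (\<lambda>v. (\<chi> i. D i v) \<bullet> b)) (at x)"
      unfolding b inner_axis using D(1)[of i] by (auto intro!: derivative_eq_intros)
  qed
  from has_derivative_compose[OF this E(1)]
  have "((\<lambda>x. G (\<Phi> x)) has_derivative (\<lambda>v. E (\<chi> i. D i v))) (at x)" .
  moreover have "E (\<chi> i. D i (c *s v)) = c * E (\<chi> i. D i v)" for c v
    by (simp add: D(2) flip: E(2)) (simp add: vector_scalar_mult_def)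
  ultimately show ?thesis unfolding cdiff_at_def by blast
qed

lemma cdiff_at_compose_arc:
  fixes G :: "complex ^ 'n \<Rightarrow> complex" and \<phi> :: "complex \<Rightarrow> complex ^ 'n"
  assumes "\<And>i. (\<lambda>t. \<phi> t $ i) field_differentiable at t" "cdiff_at G (\<phi> t)"
  shows "(\<lambda>t. G (\<phi> t)) field_differentiable at t"
proof -
  obtain d where D: "\<And>i. ((\<lambda>x. \<phi> x $ i) has_derivative (*) (d i)) (at t)"
    using assms(1) unfolding field_differentiable_def has_field_derivative_def by metis
  obtain E where E: "(G has_derivative E) (at (\<phi> t))" "\<And>c v. E (c *s v) = c * E v"
    using assms(2) unfolding cdiff_at_def by metis
  have "(\<phi> has_derivative (\<lambda>v. \<chi> i. d i * v)) (at t)"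
  proof (subst has_derivative_componentwise_within, intro ballI)
    fix b :: "complex ^ 'n" assume "b \<in> Basis"
    then obtain i u where b: "b = axis i u" by (auto simp: Basis_vec_def)
    show "((\<lambda>x. \<phi> x \<bullet> b) has_derivative (\<lambda>v. (\<chi> i. d i * v) \<bullet> b)) (at t)"
      unfolding b inner_axis using D(1)[of i] by (auto intro!: derivative_eq_intros)
  qed
  from has_derivative_compose[OF this E(1)]
  have "((\<lambda>x. G (\<phi> x)) has_derivative (\<lambda>v. E (\<chi> i. d i * v))) (at t)" .
  moreover have "E (\<chi> i. d i * v) = E (\<chi> i. d i) * v" for v
    by (subst mult.commute, subst E(2)[symmetric]) (simp add: vector_scalar_mult_def mult.commute)
  ultimately show ?thesis unfolding field_differentiable_def has_field_derivative_def
    by (metis (no_types, lifting) ext)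
qed

lemma cdiff_at_imp_isCont: "cdiff_at g x \<Longrightarrow> isCont g x"
  by (auto simp: cdiff_at_def dest: has_derivative_continuous)

text \<open>Cauchy's formula writes the derivative as an integral of \<open>K\<close> itself over a circle, and integrals depend continuously on parameters.\<close>

lemma continuous_on_deriv_param:
  fixes K :: "complex \<Rightarrow> 't::topological_space \<Rightarrow> complex"
  assumes cont: "continuous_on (ball a r \<times> T) (\<lambda>(z,t). K z t)"
    and holo: "\<And>t. t \<in> T \<Longrightarrow> (\<lambda>z. K z t) holomorphic_on ball a r"
    and s: "0 < s" "s < r"
  shows "continuous_on (ball a s \<times> T) (\<lambda>(z,t). deriv (\<lambda>z. K z t) z)"
proof -
  have sub: "cball a s \<subseteq> ball a r" using s by auto
  define k where "k = (\<lambda>(p :: complex \<times> 't) x. K (circlepath a s x) (snd p) / (circlepath a s x - fst p)\<^sup>2 *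
      (2 * pi * \<i> * s * exp (2 * of_real pi * \<i> * x)))"
  have eq: "deriv (\<lambda>z. K z t) z = integral (cbox 0 1) (k (z,t)) / (2 * of_real pi * \<i>)"
    if "z \<in> ball a s" "t \<in> T" for z t
  proof -
    have h: "(\<lambda>z. K z t) holomorphic_on ball a r" by (rule holo[OF that(2)])
    have c: "continuous_on (cball a s) (\<lambda>z. K z t)"
      using holomorphic_on_imp_continuous_on[OF h] sub by (rule continuous_on_subset)
    have "(\<lambda>z. K z t) holomorphic_on ball a s" using h by (rule holomorphic_on_subset) (use s in auto)
    from Cauchy_derivative_integral_circlepath(2)[OF c this that(1)]
    have "deriv (\<lambda>z. K z t) z = contour_integral (circlepath a s) (\<lambda>u. K u t / (u - z)\<^sup>2) / (2 * of_real pi * \<i>)"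
      by (simp add: DERIV_imp_deriv)
    also have "contour_integral (circlepath a s) (\<lambda>u. K u t / (u - z)\<^sup>2) = integral (cbox 0 1) (k (z,t))"
      unfolding contour_integral_integral k_def
      by (auto intro!: integral_cong simp: vector_derivative_circlepath)
    finally show ?thesis .
  qed
  have "continuous_on (ball a s \<times> T) (\<lambda>p. integral (cbox 0 1) (k p) / (2 * of_real pi * \<i>))"
  proof (intro continuous_intros integral_continuous_on_param)
    have 1: "continuous_on ((ball a s \<times> T) \<times> cbox 0 (1::real)) (\<lambda>q. K (circlepath a s (snd q)) (snd (fst q)))"
      by (rule continuous_on_compose2[OF cont, where f = "\<lambda>q. (circlepath a s (snd q), snd (fst q))", unfolded split_beta fst_conv snd_conv])
         (use s sub in \<open>auto intro!: continuous_intros simp: circlepath dist_norm norm_mult\<close>)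
    have 2: "circlepath a s x \<noteq> z" if "z \<in> ball a s" for x z
      using that s by (auto simp: circlepath dist_norm norm_mult)
    show "continuous_on ((ball a s \<times> T) \<times> cbox 0 1) (\<lambda>(x, y). k x y)"
      unfolding k_def split_beta
      by (intro continuous_intros 1)
         (use 2 in \<open>auto simp: circlepath intro!: continuous_intros\<close>)
  qed auto
  then show ?thesis
    by (rule continuous_on_eq) (auto simp: eq)
qed

text \<open>Joint continuity of \<open>K\<close> suffices for differentiating under the integral sign, because it passes to the derivative.\<close>

lemma holomorphic_on_integral_param:
  fixes K :: "complex \<Rightarrow> 't::euclidean_space \<Rightarrow> complex"
  assumes cont: "continuous_on (ball a r \<times> cbox \<alpha> \<beta>) (\<lambda>(z,t). K z t)"
    and holo: "\<And>t. t \<in> cbox \<alpha> \<beta> \<Longrightarrow> (\<lambda>z. K z t) holomorphic_on ball a r"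
    and s: "0 < s" "s < r"
  shows "(\<lambda>z. integral (cbox \<alpha> \<beta>) (K z)) holomorphic_on ball a s"
proof (rule leibniz_rule_holomorphic)
  fix x t assume x: "x \<in> ball a s" and t: "t \<in> cbox \<alpha> \<beta>"
  then have x': "x \<in> ball a r" using s by auto
  show "((\<lambda>x. K x t) has_field_derivative deriv (\<lambda>z. K z t) x) (at x within ball a s)"
    using holomorphic_derivI[OF holo[OF t] _ x'] by (auto intro: has_field_derivative_at_within)
next
  fix x assume x: "x \<in> ball a s"
  have "continuous_on (cbox \<alpha> \<beta>) (K x)"
    by (rule continuous_on_compose2[OF cont, where f = "\<lambda>t. (x,t)", unfolded split_beta fst_conv snd_conv])
       (use x s in \<open>auto intro!: continuous_intros\<close>)
  then show "K x integrable_on cbox \<alpha> \<beta>" by (rule integrable_continuous)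
next
  show "continuous_on (ball a s \<times> cbox \<alpha> \<beta>) (\<lambda>(x, t). deriv (\<lambda>z. K z t) x)"
    by (rule continuous_on_deriv_param[OF cont holo s])
qed auto

text \<open>Osgood's lemma: the partial derivatives are continuous by \<open>continuous_on_deriv_param\<close>, so the function is totally differentiable.\<close>

lemma separately_holomorphic_imp_holo_germ:
  fixes g :: "complex \<Rightarrow> complex \<Rightarrow> complex"
  assumes r: "0 < r"
    and cont: "continuous_on (ball 0 r \<times> ball 0 r) (\<lambda>(u,w). g u w)"
    and h1: "\<And>w. w \<in> ball 0 r \<Longrightarrow> (\<lambda>u. g u w) holomorphic_on ball 0 r"
    and h2: "\<And>u. u \<in> ball 0 r \<Longrightarrow> (\<lambda>w. g u w) holomorphic_on ball 0 r"
  shows "holo_germ (\<lambda>x :: complex ^ 2. g (x $ 1) (x $ 2))"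
proof -
  define s where "s = r/2"
  have s: "0 < s" "s < r" using r by (auto simp: s_def)
  have c: "continuous_on (ball 0 s \<times> ball 0 r) (\<lambda>(w,u). deriv (\<lambda>w. g u w) w)"
    using h2 by (intro continuous_on_deriv_param[OF continuous_on_swap_args[OF cont] _ s]) auto
  have c2: "continuous_on (ball 0 s \<times> ball 0 s) (\<lambda>(u,w). blinfun_mult_right (deriv (\<lambda>w. g u w) w))"
    unfolding split_beta
    by (intro bounded_linear.continuous_on[OF bounded_linear_blinfun_mult_right]
        continuous_on_compose2[OF c, where f = "\<lambda>(z,t). (t,z)", unfolded split_beta fst_conv snd_conv])
       (use s in \<open>auto intro!: continuous_intros simp: split_beta\<close>)
  have main: "cdiff_at (\<lambda>x :: complex ^ 2. g (x $ 1) (x $ 2)) x"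
    if "x $ 1 \<in> ball 0 s" "x $ 2 \<in> ball 0 s" for x :: "complex ^ 2"
  proof -
    define u w where "u = x $ 1" and "w = x $ 2"
    have uw: "u \<in> ball 0 s" "w \<in> ball 0 s" "u \<in> ball 0 r" "w \<in> ball 0 r"
      using that s by (auto simp: u_def w_def)
    define d where "d = deriv (\<lambda>u. g u w) u"
    define e where "e = deriv (\<lambda>w. g u w) w"
    have "((\<lambda>(x, y). g x y) has_derivative
        (\<lambda>(tx,ty). d * tx + blinfun_mult_right e ty)) (at (u,w) within ball 0 s \<times> ball 0 s)"
      unfolding e_def
    proof (rule has_derivative_partialsI)
      show "((\<lambda>x. g x w) has_derivative (*) d) (at u within ball 0 s)"
        unfolding d_def using holomorphic_derivI[OF h1 _ uw(3), OF uw(4)]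
        by (auto simp: has_field_derivative_def intro: has_derivative_at_withinI)
    next
      fix x y :: complex assume "x \<in> ball 0 s" "y \<in> ball 0 s"
      then have "x \<in> ball 0 r" "y \<in> ball 0 r" using s by auto
      from holomorphic_derivI[OF h2 _ this(2), OF this(1)]
      show "((\<lambda>y. g x y) has_derivative (blinfun_mult_right (deriv (\<lambda>w. g x w) y))) (at y within ball 0 s)"
        by (auto simp: has_field_derivative_def intro: has_derivative_at_withinI)
    next
      show "continuous (at (u, w) within ball 0 s \<times> ball 0 s)
          (\<lambda>(u, w). blinfun_mult_right (deriv (g u) w))"
        using c2 uw by (auto simp: continuous_on_eq_continuous_within)
    qed (use uw in auto)
    moreover have "at (u,w) within (ball 0 s \<times> ball 0 s) = at (u,w)"
      by (rule at_within_open) (use uw in \<open>auto intro!: open_Times\<close>)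
    ultimately have "((\<lambda>(x, y). g x y) has_derivative (\<lambda>(tx,ty). d * tx + e * ty)) (at (u,w))"
      by simp
    moreover have "((\<lambda>x :: complex ^ 2. (x $ 1, x $ 2)) has_derivative (\<lambda>v. (v $ 1, v $ 2))) (at x)"
      by (auto intro!: bounded_linear_imp_has_derivative bounded_linear_vec_nth bounded_linear_Pair)
    ultimately have "((\<lambda>x. g (x $ 1) (x $ 2)) has_derivative (\<lambda>v. d * v $ 1 + e * v $ 2)) (at x)"
      using has_derivative_compose[of "\<lambda>x :: complex ^ 2. (x $ 1, x $ 2)" _ x UNIV "\<lambda>(x, y). g x y"]
      by (fastforce simp: u_def w_def)
    then show ?thesis unfolding cdiff_at_def
      by (intro exI[of _ "\<lambda>v. d * v $ 1 + e * v $ 2"]) (auto simp: algebra_simps)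
  qed
  have "\<forall>\<^sub>F x in nhds (0 :: complex ^ 2). x \<in> ball 0 s"
    using s by (intro eventually_nhds_in_open) auto
  then show ?thesis unfolding holo_germ_iff_cdiff
  proof (rule eventually_mono)
    fix x :: "complex ^ 2" assume "x \<in> ball 0 s"
    then show "cdiff_at (\<lambda>x. g (x $ 1) (x $ 2)) x"
      using Finite_Cartesian_Product.norm_nth_le[of x] main[of x] s by (auto simp: dist_norm intro: le_less_trans)
  qed
qed

lemma holo_germ_ball:
  assumes "holo_germ g" obtains r where "0 < r" "\<And>x. x \<in> ball 0 r \<Longrightarrow> cdiff_at g x"
  using assms unfolding holo_germ_iff_cdiff eventually_nhds_metric
  by (auto simp: dist_commute)

lemma holo_germ_isCont: "holo_germ g \<Longrightarrow> isCont g 0"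
  unfolding holo_germ_iff_cdiff by (meson cdiff_at_imp_isCont eventually_nhds_x_imp_x)

named_theorems holo_germ_intros

lemma holo_germ_const [holo_germ_intros]: "holo_germ (\<lambda>x. c)"
  by (simp add: holo_germ_iff_cdiff)

lemma holo_germ_nth [holo_germ_intros]: "holo_germ (\<lambda>x. x $ i)"
  by (simp add: holo_germ_iff_cdiff)

lemma holo_germ_add [holo_germ_intros]:
  "holo_germ g \<Longrightarrow> holo_germ h \<Longrightarrow> holo_germ (\<lambda>x. g x + h x)"
  unfolding holo_germ_iff_cdiff by (erule (1) eventually_elim2) (rule cdiff_at_add)

lemma holo_germ_mult [holo_germ_intros]:
  "holo_germ g \<Longrightarrow> holo_germ h \<Longrightarrow> holo_germ (\<lambda>x. g x * h x)"
  unfolding holo_germ_iff_cdiff by (erule (1) eventually_elim2) (rule cdiff_at_mult)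

lemma holo_germ_minus [holo_germ_intros]: "holo_germ g \<Longrightarrow> holo_germ (\<lambda>x. - g x)"
  using holo_germ_mult[OF holo_germ_const[of "-1"]] by simp

lemma holo_germ_diff [holo_germ_intros]:
  "holo_germ g \<Longrightarrow> holo_germ h \<Longrightarrow> holo_germ (\<lambda>x. g x - h x)"
  using holo_germ_add[of g "\<lambda>x. - h x"] by (simp add: holo_germ_minus)

lemma holo_germ_power [holo_germ_intros]: "holo_germ g \<Longrightarrow> holo_germ (\<lambda>x. g x ^ n)"
  by (induction n) (auto intro: holo_germ_intros)

lemma holo_germ_sum [holo_germ_intros]:
  "(\<And>i. i \<in> I \<Longrightarrow> holo_germ (g i)) \<Longrightarrow> holo_germ (\<lambda>x. \<Sum>i\<in>I. g i x)"
  by (induction I rule: infinite_finite_induct) (auto intro: holo_germ_intros)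

lemma cdiff_at_divide:
  assumes "cdiff_at g x" "cdiff_at h x" "h x \<noteq> 0" shows "cdiff_at (\<lambda>x. g x / h x) x"
proof -
  have "inverse field_differentiable at (h x)"
    using assms(3) by (intro derivative_intros) auto
  from cdiff_at_mult[OF assms(1) cdiff_at_compose_outer[OF assms(2) this]]
  show ?thesis by (simp add: field_simps)
qed

lemma holo_germ_components_tendsto:
  fixes \<Phi> :: "complex ^ 'm \<Rightarrow> complex ^ 'n"
  assumes "\<And>i. holo_germ (\<lambda>x. \<Phi> x $ i)" "\<Phi> 0 = 0"
  shows "(\<Phi> \<longlongrightarrow> 0) (nhds 0)"
proof (rule vec_tendstoI)
  fix i
  show "((\<lambda>x. \<Phi> x $ i) \<longlongrightarrow> 0 $ i) (nhds 0)"
    using holo_germ_isCont[OF assms(1)[of i]] tendsto_at_iff_tendsto_nhds[of "\<lambda>x. \<Phi> x $ i" 0]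
    by (simp add: isCont_def assms(2))
qed

lemma holo_germ_compose:
  fixes G :: "complex ^ 'n \<Rightarrow> complex" and \<Phi> :: "complex ^ 'm \<Rightarrow> complex ^ 'n"
  assumes "\<And>i. holo_germ (\<lambda>x. \<Phi> x $ i)" "\<Phi> 0 = 0" "holo_germ G"
  shows "holo_germ (\<lambda>x. G (\<Phi> x))"
proof -
  have "\<forall>\<^sub>F x in nhds 0. cdiff_at G (\<Phi> x)"
    using holo_germ_components_tendsto[OF assms(1,2)] assms(3)
    unfolding holo_germ_iff_cdiff by (rule eventually_compose_filterlim[rotated])
  moreover have "\<forall>\<^sub>F x in nhds 0. \<forall>i. cdiff_at (\<lambda>x. \<Phi> x $ i) x"
    using assms(1) by (simp add: holo_germ_iff_cdiff eventually_all_finite)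
  ultimately show ?thesis unfolding holo_germ_iff_cdiff
    by eventually_elim (auto intro: cdiff_at_compose)
qed

lemma vector_2_eq: "vector [a, b] = (\<chi> i :: 2. if i = 1 then a else b)"
  by (simp add: vec_eq_iff forall_2)

lemma vector_3_eq: "vector [a, b, c] = (\<chi> i :: 3. if i = 1 then a else if i = 2 then b else c)"
  by (simp add: vec_eq_iff forall_3)

lemma vector_2_collapse [simp]: "vector [x $ 1, x $ 2] = (x :: 'a::zero ^ 2)"
  by (simp add: vec_eq_iff forall_2)

lemma vector_2_zero [simp]: "vector [0, 0] = (0 :: 'a::zero ^ 2)"
  by (simp add: vec_eq_iff forall_2)

lemma continuous_on_vector_2 [continuous_intros]:
  "continuous_on S a \<Longrightarrow> continuous_on S b \<Longrightarrow> continuous_on S (\<lambda>x. vector [a x, b x] :: complex ^ 2)"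
  unfolding vector_2_eq
proof (rule continuous_on_vec_lambda)
  show "continuous_on S (\<lambda>x. if i = 1 then a x else b x)"
    if "continuous_on S a" "continuous_on S b" for i :: 2 using that by (cases "i = 1") auto
qed

lemma continuous_on_vector_3 [continuous_intros]:
  "continuous_on S a \<Longrightarrow> continuous_on S b \<Longrightarrow> continuous_on S c \<Longrightarrow>
    continuous_on S (\<lambda>x. vector [a x, b x, c x] :: complex ^ 3)"
  unfolding vector_3_eq
proof (rule continuous_on_vec_lambda)
  show "continuous_on S (\<lambda>x. if i = 1 then a x else if i = 2 then b x else c x)"
    if "continuous_on S a" "continuous_on S b" "continuous_on S c" for i :: 3
    using that by (cases "i = 1"; cases "i = 2") auto
qed

lemma norm_vector_2_le: "norm (vector [a, b] :: complex ^ 2) \<le> norm a + norm b"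
  using L2_set_le_sum[of UNIV "\<lambda>i. norm ((vector [a, b] :: complex ^ 2) $ i)"]
  by (simp add: norm_vec_def sum_2)

lemma norm_vector_3_le: "norm (vector [a, b, c] :: complex ^ 3) \<le> norm a + norm b + norm c"
  using L2_set_le_sum[of UNIV "\<lambda>i. norm ((vector [a, b, c] :: complex ^ 3) $ i)"]
  by (simp add: norm_vec_def sum_3)

lemma cdiff_on_imp_continuous_on:
  "(\<And>x. x \<in> S \<Longrightarrow> cdiff_at g x) \<Longrightarrow> continuous_on S g"
  by (simp add: cdiff_at_imp_isCont continuous_at_imp_continuous_on)

text \<open>The source of all holomorphic functions of two variables that are not given by a formula: the quotients and the coefficients below are such integrals.\<close>

lemma holo_germ_contour_integral:
  fixes K :: "complex ^ 2 \<Rightarrow> complex \<Rightarrow> complex"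
  assumes r: "0 < r" "0 < \<rho>"
    and cont: "continuous_on (ball 0 r \<times> sphere 0 \<rho>) (\<lambda>(x,\<zeta>). K x \<zeta>)"
    and diff: "\<And>x \<zeta>. x \<in> ball 0 r \<Longrightarrow> \<zeta> \<in> sphere 0 \<rho> \<Longrightarrow> cdiff_at (\<lambda>x. K x \<zeta>) x"
  shows "holo_germ (\<lambda>x. contour_integral (circlepath 0 \<rho>) (K x))"
proof -
  define s where "s = r/2"
  define k where "k = (\<lambda>(u::complex) w (t::real). K (vector [u,w]) (circlepath 0 \<rho> t) *
      (2 * pi * \<i> * \<rho> * exp (2 * of_real pi * \<i> * t)))"
  have small: "vector [u,w] \<in> ball (0 :: complex ^ 2) r" if "u \<in> ball 0 s" "w \<in> ball 0 s" for u w
    using that norm_vector_2_le[of u w] by (auto simp: s_def)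
  have circ: "circlepath 0 \<rho> t \<in> sphere 0 \<rho>" for t using r by (simp add: circlepath norm_mult)
  have eq: "contour_integral (circlepath 0 \<rho>) (K x) = integral (cbox 0 1) (k (x $ 1) (x $ 2))" for x
    unfolding contour_integral_integral k_def
    by (auto intro!: integral_cong simp: vector_derivative_circlepath)
  have ck: "continuous_on S (\<lambda>q. k (a q) (b q) (c q))"
    if abc: "continuous_on S a" "continuous_on S b" "continuous_on S c"
      "\<And>q. q \<in> S \<Longrightarrow> a q \<in> ball 0 s \<and> b q \<in> ball 0 s" for S :: "'b::topological_space set" and a b c
  proof -
    have circ_cont: "continuous_on S (\<lambda>q. circlepath 0 \<rho> (c q))"
      unfolding circlepath by (intro continuous_intros abc)
    have "continuous_on S (\<lambda>q. (\<lambda>(x,\<zeta>). K x \<zeta>) (vector [a q, b q], circlepath 0 \<rho> (c q)))"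
    proof (rule continuous_on_compose2[OF cont])
      show "continuous_on S (\<lambda>q. (vector [a q, b q] :: complex ^ 2, circlepath 0 \<rho> (c q)))"
        by (intro continuous_on_Pair continuous_on_vector_2 circ_cont abc)
      show "(\<lambda>q. (vector [a q, b q] :: complex ^ 2, circlepath 0 \<rho> (c q))) ` S \<subseteq> ball 0 r \<times> sphere 0 \<rho>"
        using small abc(4) circ by blast
    qed
    moreover have "continuous_on S (\<lambda>q. 2 * pi * \<i> * \<rho> * exp (2 * of_real pi * \<i> * c q))"
      by (intro continuous_intros abc)
    ultimately show ?thesis unfolding k_def by (auto intro: continuous_on_mult)
  qed
  have arc1: "(\<lambda>u. K (vector [u,w]) \<zeta>) field_differentiable at u"
    and arc2: "(\<lambda>w. K (vector [u,w]) \<zeta>) field_differentiable at w"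
    if "u \<in> ball 0 s" "w \<in> ball 0 s" "\<zeta> \<in> sphere 0 \<rho>" for u w \<zeta>
  proof -
    note d = diff[OF small[OF that(1,2)] that(3)]
    have "(\<lambda>t. (vector [t, w] :: complex ^ 2) $ i) field_differentiable at u"
      "(\<lambda>t. (vector [u, t] :: complex ^ 2) $ i) field_differentiable at w" for i :: 2
      using exhaust_2[of i] by (auto intro: derivative_intros)
    then show "(\<lambda>u. K (vector [u,w]) \<zeta>) field_differentiable at u"
        "(\<lambda>w. K (vector [u,w]) \<zeta>) field_differentiable at w"
      using cdiff_at_compose_arc[where G = "\<lambda>x. K x \<zeta>" and \<phi> = "\<lambda>t. vector [t, w]", OF _ d]
        cdiff_at_compose_arc[where G = "\<lambda>x. K x \<zeta>" and \<phi> = "\<lambda>t. vector [u, t]", OF _ d] by blast+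
  qed
  have hk1: "(\<lambda>u. k u w t) holomorphic_on ball 0 s" if "w \<in> ball 0 s" for w t
    unfolding holomorphic_on_def
  proof
    fix u :: complex assume "u \<in> ball 0 s"
    from field_differentiable_mult[OF arc1[OF this that circ] field_differentiable_const]
    show "(\<lambda>u. k u w t) field_differentiable at u within ball 0 s"
      unfolding k_def by (rule field_differentiable_at_within)
  qed
  have hk2: "(\<lambda>w. k u w t) holomorphic_on ball 0 s" if "u \<in> ball 0 s" for u t
    unfolding holomorphic_on_def
  proof
    fix w :: complex assume "w \<in> ball 0 s"
    from field_differentiable_mult[OF arc2[OF that this circ] field_differentiable_const]
    show "(\<lambda>w. k u w t) field_differentiable at w within ball 0 s"
      unfolding k_def by (rule field_differentiable_at_within)
  qed
  have s: "0 < s/2" "s/2 < s" using r by (auto simp: s_def)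
  have sub: "ball 0 (s/2) \<subseteq> ball (0::complex) s" using s by auto
  have c0: "continuous_on ((ball 0 (s/2) \<times> ball 0 (s/2)) \<times> cbox 0 (1::real)) (\<lambda>q. k (fst (fst q)) (snd (fst q)) (snd q))"
  proof (rule ck)
    show "fst (fst q) \<in> ball 0 s \<and> snd (fst q) \<in> ball 0 s"
      if "q \<in> (ball 0 (s/2) \<times> ball 0 (s/2)) \<times> cbox 0 (1::real)" for q :: "(complex \<times> complex) \<times> real"
      using that sub by auto
  qed (intro continuous_intros)+
  have c1: "continuous_on (ball 0 s \<times> cbox 0 (1::real)) (\<lambda>q. k (fst q) w (snd q))" if "w \<in> ball 0 s" for w
    by (rule ck) (use that in \<open>auto intro!: continuous_intros\<close>)
  have c2: "continuous_on (ball 0 s \<times> cbox 0 (1::real)) (\<lambda>q. k u (fst q) (snd q))" if "u \<in> ball 0 s" for u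
    by (rule ck) (use that in \<open>auto intro!: continuous_intros\<close>)
  have "holo_germ (\<lambda>x :: complex ^ 2. integral (cbox 0 1) (k (x $ 1) (x $ 2)))"
  proof (rule separately_holomorphic_imp_holo_germ[OF s(1)])
    show "continuous_on (ball 0 (s/2) \<times> ball 0 (s/2)) (\<lambda>(u, w). integral (cbox 0 1) (k u w))"
      using integral_continuous_on_param[where f = "\<lambda>p. k (fst p) (snd p)", unfolded split_beta, OF c0]
      by (simp add: split_beta)
    show "(\<lambda>u. integral (cbox 0 1) (k u w)) holomorphic_on ball 0 (s/2)" if "w \<in> ball 0 (s/2)" for w
    proof -
      have w: "w \<in> ball 0 s" using that sub by auto
      show ?thesis
        using holomorphic_on_integral_param[where K = "\<lambda>u. k u w", unfolded split_beta, OF c1[OF w] hk1[OF w] s]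
        by simp
    qed
    show "(\<lambda>w. integral (cbox 0 1) (k u w)) holomorphic_on ball 0 (s/2)" if "u \<in> ball 0 (s/2)" for u
    proof -
      have u: "u \<in> ball 0 s" using that sub by auto
      show ?thesis
        using holomorphic_on_integral_param[where K = "k u", unfolded split_beta, OF c2[OF u] hk2[OF u] s]
        by simp
    qed
  qed
  then show ?thesis by (simp add: eq)
qed

section \<open>Division in the ring of germs\<close>

definition swap2 :: "'a::zero ^ 2 \<Rightarrow> 'a ^ 2" where "swap2 x = vector [x $ 2, x $ 1]"

lemma swap2_simps [simp]: "swap2 x $ 1 = x $ 2" "swap2 x $ 2 = x $ 1" "swap2 (swap2 x) = x" "swap2 0 = 0"
  "swap2 (vector [a, b]) = vector [b, a]"
  by (simp_all add: swap2_def vec_eq_iff forall_2)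

lemma holo_germ_vector_2:
  assumes "holo_germ a" "holo_germ b" shows "holo_germ (\<lambda>x. (vector [a x, b x] :: complex ^ 2) $ i)"
  using exhaust_2[of i] assms by auto

lemma holo_germ_compose_vector_2:
  fixes G :: "complex ^ 2 \<Rightarrow> complex"
  assumes "holo_germ G" "holo_germ a" "holo_germ b" "a 0 = 0" "b 0 = 0"
  shows "holo_germ (\<lambda>x. G (vector [a x, b x]))"
  by (rule holo_germ_compose[where G = G]) (simp_all add: assms holo_germ_vector_2)

lemma holo_germ_compose_swap: "holo_germ (G :: complex ^ 2 \<Rightarrow> complex) \<Longrightarrow> holo_germ (\<lambda>x. G (swap2 x))"
  using holo_germ_compose_vector_2[of G "\<lambda>x. x $ 2" "\<lambda>x. x $ 1"] by (simp add: swap2_def holo_germ_nth)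

lemma swap2_filterlim: "filterlim swap2 (nhds 0) (nhds (0 :: complex ^ 2))"
  using holo_germ_components_tendsto[of "swap2 :: complex ^ 2 \<Rightarrow> _"]
    holo_germ_vector_2[of "\<lambda>x :: complex ^ 2. x $ 2" "\<lambda>x. x $ 1"] by (simp add: swap2_def holo_germ_nth)

text \<open>The quotient \<open>(G(u,w) - G(0,w)) / u\<close> is the Cauchy integral of \<open>G(\<zeta>,w) / (\<zeta> (\<zeta> - u))\<close>, which is
  holomorphic also where \<open>u = 0\<close>.\<close>

lemma holo_germ_divide_u:
  fixes G :: "complex ^ 2 \<Rightarrow> complex"
  assumes "holo_germ G"
  obtains H where "holo_germ H" "\<forall>\<^sub>F x in nhds 0. G x = G (vector [0, x $ 2]) + x $ 1 * H x"
proof -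
  obtain r where r: "0 < r" and G: "\<And>x. x \<in> ball 0 r \<Longrightarrow> cdiff_at G x"
    using holo_germ_ball[OF assms] by blast
  define \<rho> where "\<rho> = r/2"
  have \<rho>: "0 < \<rho>" using r by (simp add: \<rho>_def)
  define K where "K = (\<lambda>(x :: complex ^ 2) \<zeta>. G (vector [\<zeta>, x $ 2]) / (\<zeta> * (\<zeta> - x $ 1)))"
  have coord: "norm (x $ i) < \<rho>" if "x \<in> ball 0 \<rho>" for x :: "complex ^ 2" and i
    using that Finite_Cartesian_Product.norm_nth_le[of x i] by auto
  have small: "vector [\<zeta>, x $ 2] \<in> ball (0 :: complex ^ 2) r" if "x \<in> ball 0 \<rho>" "norm \<zeta> \<le> \<rho>" for x :: "complex ^ 2" and \<zeta>
    using norm_vector_2_le[of \<zeta> "x $ 2"] coord[OF that(1), of 2] that(2) by (simp add: \<rho>_def)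
  have contG: "continuous_on (ball 0 r) G" by (intro cdiff_on_imp_continuous_on G)
  have nz: "\<zeta> * (\<zeta> - x $ 1) \<noteq> 0" if "x \<in> ball 0 \<rho>" "\<zeta> \<in> sphere 0 \<rho>" for x :: "complex ^ 2" and \<zeta>
    using coord[OF that(1), of 1] that(2) \<rho> by auto
  have K: "holo_germ (\<lambda>x. contour_integral (circlepath 0 \<rho>) (K x))"
  proof (rule holo_germ_contour_integral[OF \<rho> \<rho>])
    have "continuous_on (ball 0 \<rho> \<times> sphere 0 \<rho>) (\<lambda>q :: (complex ^ 2) \<times> complex. G (vector [snd q, fst q $ 2]))"
      by (rule continuous_on_compose2[OF contG])
         (use small in \<open>auto intro!: continuous_intros\<close>)
    then show "continuous_on (ball 0 \<rho> \<times> sphere 0 \<rho>) (\<lambda>(x, \<zeta>). K x \<zeta>)"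
      unfolding K_def split_beta using nz by (intro continuous_intros) auto
    fix x :: "complex ^ 2" and \<zeta> :: complex assume x: "x \<in> ball 0 \<rho>" "\<zeta> \<in> sphere 0 \<rho>"
    have "cdiff_at (\<lambda>x. (vector [\<zeta>, x $ 2] :: complex ^ 2) $ i) x" for i
      using exhaust_2[of i] by auto
    then have "cdiff_at (\<lambda>x :: complex ^ 2. G (vector [\<zeta>, x $ 2])) x"
      by (rule cdiff_at_compose[where G = G, OF _ G]) (use small[of x \<zeta>] x in simp_all)
    moreover have "cdiff_at (\<lambda>x :: complex ^ 2. \<zeta> * (\<zeta> - x $ 1)) x"
      using cdiff_at_mult[OF cdiff_at_const[of \<zeta>] cdiff_at_add[OF cdiff_at_const[of \<zeta>]
        cdiff_at_mult[OF cdiff_at_const[of "-1"] cdiff_at_nth[of 1 x]]]] by simp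
    ultimately show "cdiff_at (\<lambda>x. K x \<zeta>) x"
      unfolding K_def using nz[OF x] by (intro cdiff_at_divide) auto
  qed
  define H where "H = (\<lambda>x. contour_integral (circlepath 0 \<rho>) (K x) * (1 / (2 * of_real pi * \<i>)))"
  have "G x = G (vector [0, x $ 2]) + x $ 1 * H x" if x: "x \<in> ball 0 \<rho>" for x
  proof (cases "x $ 1 = 0")
    case True
    then have "vector [0, x $ 2] = x" by (metis vector_2_collapse)
    then show ?thesis using True by simp
  next
    case False
    define g where "g = (\<lambda>\<zeta>. G (vector [\<zeta>, x $ 2]))"
    have g: "g holomorphic_on cball 0 \<rho>"
      unfolding holomorphic_on_def g_def
    proof (rule ballI, rule field_differentiable_at_within, rule cdiff_at_compose_arc[where G = G])
      fix \<zeta> :: complex assume "\<zeta> \<in> cball 0 \<rho>"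
      then show "cdiff_at G (vector [\<zeta>, x $ 2])" using small[OF x, of \<zeta>] G by auto
      show "(\<lambda>t. (vector [t, x $ 2] :: complex ^ 2) $ i) field_differentiable at \<zeta>" for i
        using exhaust_2[of i] by (auto intro: derivative_intros)
    qed
    note C = Cauchy_integral_circlepath_simple[OF g]
    have "((\<lambda>\<zeta>. (g \<zeta> / (\<zeta> - x $ 1) - g \<zeta> / (\<zeta> - 0)) / x $ 1) has_contour_integral
        (2 * of_real pi * \<i> * g (x $ 1) - 2 * of_real pi * \<i> * g 0) / x $ 1) (circlepath 0 \<rho>)"
      by (intro has_contour_integral_div has_contour_integral_diff C) (use coord[OF x, of 1] \<rho> in auto)
    then have "(K x has_contour_integral
        (2 * of_real pi * \<i> * g (x $ 1) - 2 * of_real pi * \<i> * g 0) / x $ 1) (circlepath 0 \<rho>)"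
    proof (rule has_contour_integral_eq)
      fix \<zeta> assume "\<zeta> \<in> path_image (circlepath 0 \<rho>)"
      then have "\<zeta> \<in> sphere 0 \<rho>" using \<rho> by simp
      from nz[OF x this] False show "(g \<zeta> / (\<zeta> - x $ 1) - g \<zeta> / (\<zeta> - 0)) / x $ 1 = K x \<zeta>"
        by (simp add: K_def g_def divide_simps) (simp add: algebra_simps)
    qed
    then have "contour_integral (circlepath 0 \<rho>) (K x) =
        (2 * of_real pi * \<i> * g (x $ 1) - 2 * of_real pi * \<i> * g 0) / x $ 1"
      by (rule contour_integral_unique)
    then show ?thesis using False unfolding H_def by (simp add: g_def field_simps)
  qed
  then have "\<forall>\<^sub>F x in nhds 0. G x = G (vector [0, x $ 2]) + x $ 1 * H x"
    using \<rho> unfolding eventually_nhds_metric by (intro exI[of _ \<rho>]) (auto simp: dist_commute)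
  moreover have "holo_germ H" unfolding H_def by (intro holo_germ_intros K)
  ultimately show ?thesis using that by blast
qed

lemma holo_germ_divide_w:
  fixes G :: "complex ^ 2 \<Rightarrow> complex"
  assumes "holo_germ G"
  obtains H where "holo_germ H" "\<forall>\<^sub>F x in nhds 0. G x = G (vector [x $ 1, 0]) + x $ 2 * H x"
proof -
  obtain H where H: "holo_germ H"
      "\<forall>\<^sub>F x in nhds 0. G (swap2 x) = G (swap2 (vector [0, x $ 2])) + x $ 1 * H x"
    by (rule holo_germ_divide_u[OF holo_germ_compose_swap[OF assms]])
  from eventually_compose_filterlim[OF H(2) swap2_filterlim]
  have "\<forall>\<^sub>F x in nhds 0. G x = G (vector [x $ 1, 0]) + x $ 2 * H (swap2 x)" by simp
  with holo_germ_compose_swap[OF H(1)] show ?thesis using that by blast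
qed

text \<open>The maximal ideal of the ring of germs is generated by the coordinates.\<close>

lemma holo_germ_vanishing_decomposition:
  fixes h :: "complex ^ 2 \<Rightarrow> complex"
  assumes "holo_germ h" "h 0 = 0"
  obtains A B where "holo_germ A" "holo_germ B" "\<forall>\<^sub>F x in nhds 0. h x = x $ 1 * A x + x $ 2 * B x"
proof -
  obtain B where B: "holo_germ B" "\<forall>\<^sub>F x in nhds 0. h x = h (vector [x $ 1, 0]) + x $ 2 * B x"
    using holo_germ_divide_w[OF assms(1)] by blast
  have "holo_germ (\<lambda>x :: complex ^ 2. h (vector [x $ 1, 0]))"
    by (rule holo_germ_compose_vector_2[where G = h]) (simp_all add: assms holo_germ_intros)
  then obtain A where A: "holo_germ A"
      "\<forall>\<^sub>F x :: complex ^ 2 in nhds 0. h (vector [x $ 1, 0]) = h (vector [(vector [0, x $ 2] :: complex ^ 2) $ 1, 0]) + x $ 1 * A x"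
    using holo_germ_divide_u by blast
  have "\<forall>\<^sub>F x in nhds 0. h x = x $ 1 * A x + x $ 2 * B x"
    using A(2) B(2) by eventually_elim (simp add: assms(2))
  with A(1) B(1) show ?thesis using that by blast
qed

text \<open>Weierstrass division by \<open>z\<^sup>2 - f\<close>, made explicit: \<open>a\<close> and \<open>b\<close> are the Cauchy integrals over \<open>\<zeta>\<close> of
  \<open>G \<zeta> / (\<zeta>\<^sup>2 - f)\<close> and of \<open>G / (\<zeta>\<^sup>2 - f)\<close>.\<close>

lemma double_cover_decomposition:
  fixes G :: "complex ^ 3 \<Rightarrow> complex" and f :: "complex ^ 2 \<Rightarrow> complex"
  assumes "holo_germ G" "holo_germ f" "f 0 = 0"
  obtains a b :: "complex ^ 2 \<Rightarrow> complex" where "holo_germ a" "holo_germ b"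
    "\<forall>\<^sub>F x in nhds 0. x \<in> stabilization f \<longrightarrow> G x = a (vector [x $ 1, x $ 2]) + x $ 3 * b (vector [x $ 1, x $ 2])"
proof -
  obtain r1 where r1: "0 < r1" and G: "\<And>x. x \<in> ball 0 r1 \<Longrightarrow> cdiff_at G x"
    using holo_germ_ball[OF assms(1)] by blast
  obtain r2 where r2: "0 < r2" and f: "\<And>x. x \<in> ball 0 r2 \<Longrightarrow> cdiff_at f x"
    using holo_germ_ball[OF assms(2)] by blast
  define \<rho> where "\<rho> = r1/4"
  have \<rho>: "0 < \<rho>" using r1 by (simp add: \<rho>_def)
  obtain r3 where r3: "0 < r3" "\<And>x. dist x 0 < r3 \<Longrightarrow> dist (f x) (f 0) < \<rho>\<^sup>2"
    using holo_germ_isCont[OF assms(2)] \<rho> unfolding continuous_at_eps_delta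
    by (meson zero_less_power)
  define s where "s = min \<rho> (min r2 r3)"
  have s: "0 < s" "s \<le> \<rho>" "s \<le> r2" "s \<le> r3" using \<rho> r2 r3 by (auto simp: s_def)
  have coord: "norm (x $ i) < s" if "x \<in> ball 0 s" for x :: "complex ^ 'n" and i
    using that Finite_Cartesian_Product.norm_nth_le[of x i] by auto
  have small: "vector [x $ 1, x $ 2, \<zeta>] \<in> ball (0 :: complex ^ 3) r1" if "x \<in> ball 0 s" "norm \<zeta> \<le> \<rho>"
      for x :: "complex ^ 2" and \<zeta>
    using norm_vector_3_le[of "x $ 1" "x $ 2" \<zeta>] coord[OF that(1), of 1] coord[OF that(1), of 2] that(2) s r1
    by (simp add: \<rho>_def)
  have contG: "continuous_on (ball 0 r1) G" by (intro cdiff_on_imp_continuous_on G)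
  have contf: "continuous_on (ball 0 s) f" by (intro cdiff_on_imp_continuous_on f) (use s in auto)
  have nz: "\<zeta>\<^sup>2 - f x \<noteq> 0" if "x \<in> ball 0 s" "\<zeta> \<in> sphere 0 \<rho>" for x :: "complex ^ 2" and \<zeta>
  proof -
    have "norm (f x) < \<rho>\<^sup>2" using r3(2)[of x] that s assms(3) by simp
    moreover have "norm (\<zeta>\<^sup>2) = \<rho>\<^sup>2" using that by (simp add: norm_power)
    ultimately show ?thesis by auto
  qed
  \<comment> \<open>On \<open>z\<^sup>2 = f\<close> one has \<open>1 / (\<zeta> - z) = (\<zeta> + z) / (\<zeta>\<^sup>2 - f)\<close>, so that Cauchy's formula for
    \<open>G\<close> splits into the terms of the numerator.\<close>
  define K where "K = (\<lambda>n (x :: complex ^ 2) \<zeta>. G (vector [x $ 1, x $ 2, \<zeta>]) * \<zeta> ^ n / (\<zeta>\<^sup>2 - f x))"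
  have contGv: "continuous_on (ball 0 s \<times> sphere 0 \<rho>) (\<lambda>q :: (complex ^ 2) \<times> complex. G (vector [fst q $ 1, fst q $ 2, snd q]))"
    by (rule continuous_on_compose2[OF contG]) (use small in \<open>auto intro!: continuous_intros\<close>)
  have contfv: "continuous_on (ball 0 s \<times> sphere 0 \<rho>) (\<lambda>q :: (complex ^ 2) \<times> complex. f (fst q))"
    by (rule continuous_on_compose2[OF contf]) (auto intro!: continuous_intros)
  have contK: "continuous_on (ball 0 s \<times> sphere 0 \<rho>) (\<lambda>(x, \<zeta>). K n x \<zeta>)" for n
    unfolding K_def split_beta using nz contGv contfv by (intro continuous_intros) auto
  have K: "holo_germ (\<lambda>x. contour_integral (circlepath 0 \<rho>) (K n x))" for n
  proof (rule holo_germ_contour_integral[OF s(1) \<rho> contK])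
    fix x :: "complex ^ 2" and \<zeta> :: complex assume x: "x \<in> ball 0 s" "\<zeta> \<in> sphere 0 \<rho>"
    have "cdiff_at (\<lambda>x :: complex ^ 2. (vector [x $ 1, x $ 2, \<zeta>] :: complex ^ 3) $ i) x" for i
      using exhaust_3[of i] by auto
    then have 1: "cdiff_at (\<lambda>x :: complex ^ 2. G (vector [x $ 1, x $ 2, \<zeta>])) x"
      by (rule cdiff_at_compose[where G = G, OF _ G]) (use small[of x \<zeta>] x in simp_all)
    have "cdiff_at f x" using f x s by auto
    then have "cdiff_at (\<lambda>x. \<zeta>\<^sup>2 - f x) x"
      using cdiff_at_add[OF cdiff_at_const[of "\<zeta>\<^sup>2"] cdiff_at_mult[OF cdiff_at_const[of "-1"]]] by simp
    then show "cdiff_at (\<lambda>x. K n x \<zeta>) x"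
      unfolding K_def using nz[OF x] 1 by (intro cdiff_at_divide cdiff_at_mult) auto
  qed
  define a where "a = (\<lambda>x. contour_integral (circlepath 0 \<rho>) (K 1 x) * (1 / (2 * of_real pi * \<i>)))"
  define b where "b = (\<lambda>x. contour_integral (circlepath 0 \<rho>) (K 0 x) * (1 / (2 * of_real pi * \<i>)))"
  have "G x = a (vector [x $ 1, x $ 2]) + x $ 3 * b (vector [x $ 1, x $ 2])"
    if x: "x \<in> ball 0 (s/2)" and S: "x \<in> stabilization f" for x
  proof -
    define p :: "complex ^ 2" where "p = vector [x $ 1, x $ 2]"
    define z where "z = x $ 3"
    have z: "norm z < \<rho>" using coord[of x 3] x s by (auto simp: z_def)
    have p: "p \<in> ball 0 s"
      using norm_vector_2_le[of "x $ 1" "x $ 2"] Finite_Cartesian_Product.norm_nth_le[of x 1]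
        Finite_Cartesian_Product.norm_nth_le[of x 2] x by (auto simp: p_def)
    have xp: "x = vector [p $ 1, p $ 2, z]" by (simp add: p_def z_def vec_eq_iff forall_3)
    have fz: "f p = z\<^sup>2" using S by (simp add: stabilization_def p_def z_def)
    define g where "g = (\<lambda>\<zeta>. G (vector [p $ 1, p $ 2, \<zeta>]))"
    have g: "g holomorphic_on cball 0 \<rho>"
      unfolding holomorphic_on_def g_def
    proof (rule ballI, rule field_differentiable_at_within, rule cdiff_at_compose_arc[where G = G])
      fix \<zeta> :: complex assume "\<zeta> \<in> cball 0 \<rho>"
      then show "cdiff_at G (vector [p $ 1, p $ 2, \<zeta>])" using small[OF p, of \<zeta>] G by auto
      show "(\<lambda>t. (vector [p $ 1, p $ 2, t] :: complex ^ 3) $ i) field_differentiable at \<zeta>" for i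
        using exhaust_3[of i] by (auto intro: derivative_intros)
    qed
    have int: "K n p contour_integrable_on circlepath 0 \<rho>" for n
    proof (rule contour_integrable_continuous_circlepath)
      have "continuous_on (sphere 0 \<rho>) (\<lambda>\<zeta>. (\<lambda>(x, \<zeta>). K n x \<zeta>) (p, \<zeta>))"
        by (rule continuous_on_compose2[OF contK]) (use p in \<open>auto intro!: continuous_intros\<close>)
      then show "continuous_on (path_image (circlepath 0 \<rho>)) (K n p)" using \<rho> by simp
    qed
    have "((\<lambda>\<zeta>. K 1 p \<zeta> + z * K 0 p \<zeta>) has_contour_integral
        contour_integral (circlepath 0 \<rho>) (K 1 p) + z * contour_integral (circlepath 0 \<rho>) (K 0 p)) (circlepath 0 \<rho>)"
      by (intro has_contour_integral_add has_contour_integral_lmul has_contour_integral_integral int)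
    moreover have "((\<lambda>\<zeta>. K 1 p \<zeta> + z * K 0 p \<zeta>) has_contour_integral (2 * of_real pi * \<i> * g z)) (circlepath 0 \<rho>)"
    proof (rule has_contour_integral_eq)
      show "((\<lambda>\<zeta>. g \<zeta> / (\<zeta> - z)) has_contour_integral (2 * of_real pi * \<i> * g z)) (circlepath 0 \<rho>)"
        by (rule Cauchy_integral_circlepath_simple[OF g]) (use z in simp)
      fix \<zeta> assume "\<zeta> \<in> path_image (circlepath 0 \<rho>)"
      then have "\<zeta> \<in> sphere 0 \<rho>" using \<rho> by simp
      from nz[OF p this] have "(\<zeta> - z) * (\<zeta> + z) \<noteq> 0" by (simp add: fz power2_eq_square algebra_simps)
      then have "g \<zeta> / (\<zeta> - z) = g \<zeta> * (\<zeta> + z) / ((\<zeta> - z) * (\<zeta> + z))" by auto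
      also have "(\<zeta> - z) * (\<zeta> + z) = \<zeta>\<^sup>2 - f p" by (simp add: fz power2_eq_square algebra_simps)
      finally show "g \<zeta> / (\<zeta> - z) = K 1 p \<zeta> + z * K 0 p \<zeta>"
        by (simp add: K_def g_def ring_distribs add_divide_distrib mult.commute)
    qed
    ultimately have "2 * of_real pi * \<i> * g z =
        contour_integral (circlepath 0 \<rho>) (K 1 p) + z * contour_integral (circlepath 0 \<rho>) (K 0 p)"
      using has_contour_integral_unique by blast
    then have "g z = a p + z * b p"
      unfolding a_def b_def by (simp add: field_simps)
    moreover have "g z = G x" unfolding g_def using xp by simp
    ultimately show ?thesis unfolding p_def z_def by simp
  qed
  then have "\<forall>\<^sub>F x in nhds 0. x \<in> stabilization f \<longrightarrow> G x = a (vector [x $ 1, x $ 2]) + x $ 3 * b (vector [x $ 1, x $ 2])"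
    using s unfolding eventually_nhds_metric by (intro exI[of _ "s/2"]) (auto simp: dist_commute)
  moreover have "holo_germ a" "holo_germ b" unfolding a_def b_def
    by (rule holo_germ_mult[OF K holo_germ_const])+
  ultimately show ?thesis using that by blast
qed

section \<open>Orders of vanishing on slices\<close>

text \<open>Comparison of orders with functions that are only continuous at \<open>0\<close>, so that it applies to slices of
  germs without expanding them.\<close>

lemma power_order_le:
  fixes e q :: "complex \<Rightarrow> complex"
  assumes ev: "\<forall>\<^sub>F t in at 0. t ^ k * e t = t ^ n * q t"
    and "isCont e 0" "isCont q 0" "q 0 \<noteq> 0"
  shows "k \<le> n"
proof (rule ccontr)
  assume "\<not> k \<le> n"
  then obtain d where k: "k = n + Suc d" by (metis add_Suc_right less_imp_Suc_add not_le)
  have "\<forall>\<^sub>F t in at 0. q t = t ^ Suc d * e t"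
    using ev eventually_neq_at_within[of 0 0 UNIV]
  proof eventually_elim
    case (elim t)
    then have "t ^ n * (t ^ Suc d * e t) = t ^ n * q t" by (simp add: k power_add mult_ac)
    with elim show ?case by simp
  qed
  moreover have "((\<lambda>t. t ^ Suc d * e t) \<longlongrightarrow> 0 ^ Suc d * e 0) (at 0)"
    using assms(2) by (intro tendsto_intros) (simp add: isCont_def)
  ultimately have "(q \<longlongrightarrow> 0) (at 0)" by (simp add: tendsto_cong)
  with assms(3) have "q 0 = 0" unfolding isCont_def by (metis LIM_unique)
  with assms(4) show False by simp
qed

lemma filterlim_vector_2:
  assumes "(a \<longlongrightarrow> 0) F" "(b \<longlongrightarrow> 0) F"
  shows "filterlim (\<lambda>t. vector [a t, b t] :: complex ^ 2) (nhds 0) F"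
proof (rule vec_tendstoI)
  show "((\<lambda>t. (vector [a t, b t] :: complex ^ 2) $ i) \<longlongrightarrow> 0 $ i) F" for i
    using exhaust_2[of i] assms by auto
qed

lemma tendsto_ident_nhds: "((\<lambda>t. t) \<longlongrightarrow> a) (nhds a)"
  by (simp add: filterlim_ident)

lemma eventually_slice_0w:
  "\<forall>\<^sub>F x in nhds (0 :: complex ^ 2). P x \<Longrightarrow> \<forall>\<^sub>F w in nhds 0. P (vector [0, w])"
  by (erule eventually_compose_filterlim) (intro filterlim_vector_2 tendsto_const tendsto_ident_nhds)

lemma eventually_slice_u0:
  "\<forall>\<^sub>F x in nhds (0 :: complex ^ 2). P x \<Longrightarrow> \<forall>\<^sub>F u in nhds 0. P (vector [u, 0])"
  by (erule eventually_compose_filterlim) (intro filterlim_vector_2 tendsto_const tendsto_ident_nhds)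

lemma isCont_vector_slice:
  fixes h :: "complex ^ 2 \<Rightarrow> complex"
  assumes "isCont h (vector [a, b])"
  shows "isCont (\<lambda>u. h (vector [u, b])) a" "isCont (\<lambda>w. h (vector [a, w])) b"
proof -
  have "isCont (\<lambda>u. vector [u, b] :: complex ^ 2) a" "isCont (\<lambda>w. vector [a, w] :: complex ^ 2) b"
    using continuous_on_vector_2[of UNIV "\<lambda>u. u" "\<lambda>u. b"] continuous_on_vector_2[of UNIV "\<lambda>u. a" "\<lambda>u. u"]
    by (auto simp: continuous_on_eq_continuous_at)
  then show "isCont (\<lambda>u. h (vector [u, b])) a" "isCont (\<lambda>w. h (vector [a, w])) b"
    using isCont_o2[of a "\<lambda>u. vector [u, b]" h] isCont_o2[of b "\<lambda>w. vector [a, w]" h] assms by blast+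
qed

lemma holo_germ_eventually_isCont: "holo_germ h \<Longrightarrow> \<forall>\<^sub>F x in nhds 0. isCont h x"
  unfolding holo_germ_iff_cdiff by (erule eventually_mono) (rule cdiff_at_imp_isCont)

text \<open>The power of \<open>u\<close> that divides a germ is the power for which the quotient does not vanish on \<open>u = 0\<close>.\<close>

lemma u_power_le:
  fixes h h' :: "complex ^ 2 \<Rightarrow> complex"
  assumes "holo_germ h" "holo_germ h'"
    and ev: "\<forall>\<^sub>F x in nhds 0. x $ 1 ^ k * h x = x $ 1 ^ n * h' x"
    and nz: "\<exists>\<^sub>F w in nhds 0. h' (vector [0, w]) \<noteq> 0"
  shows "k \<le> n"
proof -
  have "\<forall>\<^sub>F y in nhds 0. (\<forall>\<^sub>F x in nhds y. x $ 1 ^ k * h x = x $ 1 ^ n * h' x) \<and> isCont h y \<and> isCont h' y"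
    using ev holo_germ_eventually_isCont[OF assms(1)] holo_germ_eventually_isCont[OF assms(2)]
    by (simp add: eventually_eventually eventually_conj_iff)
  from eventually_slice_0w[OF this] obtain w where
    w: "h' (vector [0, w]) \<noteq> 0" "isCont h (vector [0, w])" "isCont h' (vector [0, w])"
      "\<forall>\<^sub>F x in nhds (vector [0, w]). x $ 1 ^ k * h x = x $ 1 ^ n * h' x"
    using frequently_ex[OF frequently_eventually_conj[OF nz]] by blast
  have "filterlim (\<lambda>u. vector [u, w] :: complex ^ 2) (nhds (vector [0, w])) (at 0)"
  proof (rule vec_tendstoI)
    show "((\<lambda>t. (vector [t, w] :: complex ^ 2) $ i) \<longlongrightarrow> (vector [0, w] :: complex ^ 2) $ i) (at 0)" for i
      using exhaust_2[of i] by auto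
  qed
  from eventually_compose_filterlim[OF w(4) this]
  have "\<forall>\<^sub>F u in at 0. u ^ k * h (vector [u, w]) = u ^ n * h' (vector [u, w])" by simp
  then show ?thesis
    by (rule power_order_le) (use w isCont_vector_slice in auto)
qed

section \<open>The multiplicity of a germ\<close>

text \<open>Membership in the \<open>m\<close>-th power of the maximal ideal, with the coefficients of the monomials of degree \<open>m\<close> kept.\<close>

definition mpow_form :: "nat \<Rightarrow> (complex ^ 2 \<Rightarrow> complex) \<Rightarrow> (nat \<Rightarrow> complex ^ 2 \<Rightarrow> complex) \<Rightarrow> bool" where
  "mpow_form m h c \<longleftrightarrow> (\<forall>j. holo_germ (c j)) \<and>
     (\<forall>\<^sub>F x in nhds 0. h x = (\<Sum>j\<le>m. x $ 1 ^ j * x $ 2 ^ (m - j) * c j x))"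

definition has_mult :: "(complex ^ 2 \<Rightarrow> complex) \<Rightarrow> nat \<Rightarrow> bool" where
  "has_mult h m \<longleftrightarrow> (\<exists>c. mpow_form m h c \<and> (\<exists>j\<le>m. c j 0 \<noteq> 0))"

text \<open>If no coefficient is a unit, then each of them can be divided by the coordinates once more.\<close>

lemma mpow_form_Suc:
  assumes "mpow_form m h c" "\<And>j. j \<le> m \<Longrightarrow> c j 0 = 0"
  shows "\<exists>c. mpow_form (Suc m) h c"
proof -
  have "\<exists>A B. holo_germ A \<and> holo_germ B \<and>
      (j \<le> m \<longrightarrow> (\<forall>\<^sub>F x in nhds 0. c j x = x $ 1 * A x + x $ 2 * B x))" for j
  proof (cases "j \<le> m")
    case True
    have "holo_germ (c j)" using assms(1) by (simp add: mpow_form_def)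
    from holo_germ_vanishing_decomposition[OF this assms(2)[OF True]] show ?thesis by blast
  qed (use holo_germ_const in blast)
  then have "\<forall>j. \<exists>A B. holo_germ A \<and> holo_germ B \<and>
      (j \<le> m \<longrightarrow> (\<forall>\<^sub>F x in nhds 0. c j x = x $ 1 * A x + x $ 2 * B x))" by blast
  from choice[OF this] obtain A where "\<forall>j. \<exists>B. holo_germ (A j) \<and> holo_germ B \<and>
      (j \<le> m \<longrightarrow> (\<forall>\<^sub>F x in nhds 0. c j x = x $ 1 * A j x + x $ 2 * B x))" ..
  from choice[OF this] obtain B where *: "\<forall>j. holo_germ (A j) \<and> holo_germ (B j) \<and>
      (j \<le> m \<longrightarrow> (\<forall>\<^sub>F x in nhds 0. c j x = x $ 1 * A j x + x $ 2 * B j x))" ..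
  then have A: "holo_germ (A j)" and B: "holo_germ (B j)"
    and AB: "j \<le> m \<Longrightarrow> \<forall>\<^sub>F x in nhds 0. c j x = x $ 1 * A j x + x $ 2 * B j x" for j
    by blast+
  \<comment> \<open>Multiplying by \<open>x $ 1\<close> raises the index \<open>j\<close> by one, multiplying by \<open>x $ 2\<close> keeps it.\<close>
  define d where "d = (\<lambda>j x. (if j = 0 then 0 else A (j - 1) x) + (if j = Suc m then 0 else B j x))"
  have "\<forall>\<^sub>F x in nhds 0. \<forall>j\<le>m. c j x = x $ 1 * A j x + x $ 2 * B j x"
    using AB eventually_ball_finite[of "{..m}" "\<lambda>x j. c j x = x $ 1 * A j x + x $ 2 * B j x" "nhds 0"]
    unfolding Ball_def by auto
  then have "\<forall>\<^sub>F x in nhds 0. h x = (\<Sum>j\<le>Suc m. x $ 1 ^ j * x $ 2 ^ (Suc m - j) * d j x)"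
    using assms(1)[unfolded mpow_form_def, THEN conjunct2]
  proof eventually_elim
    case (elim x)
    have "h x = (\<Sum>j\<le>m. x $ 1 ^ Suc j * x $ 2 ^ (m - j) * A j x) + (\<Sum>j\<le>m. x $ 1 ^ j * x $ 2 ^ (Suc m - j) * B j x)"
      unfolding elim(2) sum.distrib[symmetric]
      by (rule sum.cong) (use elim(1) in \<open>auto simp: algebra_simps Suc_diff_le\<close>)
    also have "(\<Sum>j\<le>m. x $ 1 ^ Suc j * x $ 2 ^ (m - j) * A j x) =
        (\<Sum>j\<le>Suc m. x $ 1 ^ j * x $ 2 ^ (Suc m - j) * (if j = 0 then 0 else A (j - 1) x))"
      by (simp add: sum.atMost_Suc_shift del: sum.atMost_Suc)
    also have "(\<Sum>j\<le>m. x $ 1 ^ j * x $ 2 ^ (Suc m - j) * B j x) =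
        (\<Sum>j\<le>Suc m. x $ 1 ^ j * x $ 2 ^ (Suc m - j) * (if j = Suc m then 0 else B j x))"
      by (simp add: sum.atMost_Suc)
    finally show ?case unfolding d_def by (simp add: sum.distrib ring_distribs del: sum.atMost_Suc)
  qed
  moreover have "holo_germ (d j)" for j
    unfolding d_def by (cases "j = 0"; cases "j = Suc m") (auto intro!: holo_germ_intros A B simp del: One_nat_def)
  ultimately show ?thesis unfolding mpow_form_def by blast
qed

text \<open>Krull's intersection theorem for germs: on each line through \<open>0\<close> such a germ vanishes to infinite order, hence identically.\<close>

lemma mpow_all_imp_zero:
  assumes "holo_germ h" and all: "\<And>m. \<exists>c. mpow_form m h c"
  shows "\<forall>\<^sub>F x in nhds 0. h x = 0"
proof -
  obtain r where r: "0 < r" and h: "\<And>x. x \<in> ball 0 r \<Longrightarrow> cdiff_at h x"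
    using holo_germ_ball[OF assms(1)] by blast
  have "h a = 0" if a: "a \<in> ball 0 r" for a
  proof (rule ccontr)
    assume nz: "h a \<noteq> 0"
    \<comment> \<open>The disc of radius \<open>\<rho>\<close> contains \<open>1\<close>, the parameter of the point \<open>a\<close> on the line.\<close>
    define \<rho> where "\<rho> = (if a = 0 then 2 else r / norm a)"
    have \<rho>: "1 < \<rho>" using a by (auto simp: \<rho>_def)
    define \<phi> where "\<phi> = (\<lambda>t. t *s a)"
    have in_ball: "\<phi> t \<in> ball 0 r" if "t \<in> ball 0 \<rho>" for t :: complex
    proof -
      have "norm (\<phi> t) = norm t * norm a"
        by (simp add: \<phi>_def norm_vec_def norm_mult L2_set_right_distrib)
      also have "\<dots> < r" using that a r by (auto simp: \<rho>_def field_simps split: if_splits)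
      finally show ?thesis by simp
    qed
    have hol: "(\<lambda>t. h (\<phi> t)) holomorphic_on ball 0 \<rho>"
      unfolding holomorphic_on_def
    proof (rule ballI, rule field_differentiable_at_within, rule cdiff_at_compose_arc[where G = h])
      fix t :: complex assume "t \<in> ball 0 \<rho>"
      then show "cdiff_at h (\<phi> t)" by (intro h in_ball)
      show "(\<lambda>t. \<phi> t $ i) field_differentiable at t" for i
        by (auto simp: \<phi>_def intro!: derivative_intros)
    qed
    have "\<exists>w\<in>ball 0 \<rho>. h (\<phi> w) \<noteq> 0" using nz \<rho> by (intro bexI[of _ 1]) (auto simp: \<phi>_def)
    from zorder_exist_zero[OF hol open_ball connected_ball _ this, of 0] \<rho>
    obtain g s n where g: "0 < s" "g holomorphic_on cball 0 s"
        "\<And>w. w \<in> cball 0 s \<Longrightarrow> h (\<phi> w) = g w * w ^ n \<and> g w \<noteq> 0"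
      by auto
    obtain c where c: "mpow_form (Suc n) h c" using all by blast
    define e where "e = (\<lambda>t. \<Sum>j\<le>Suc n. a $ 1 ^ j * a $ 2 ^ (Suc n - j) * c j (\<phi> t))"
    have \<phi>0: "filterlim \<phi> (nhds 0) (nhds 0)"
    proof (rule vec_tendstoI)
      show "((\<lambda>t. \<phi> t $ i) \<longlongrightarrow> 0 $ i) (nhds 0)" for i
        using tendsto_mult[OF tendsto_ident_nhds[of 0] tendsto_const[of "a $ i"]] by (simp add: \<phi>_def)
    qed
    have "\<forall>\<^sub>F t in nhds 0. h (\<phi> t) = (\<Sum>j\<le>Suc n. \<phi> t $ 1 ^ j * \<phi> t $ 2 ^ (Suc n - j) * c j (\<phi> t))"
      using eventually_compose_filterlim[OF c[unfolded mpow_form_def, THEN conjunct2] \<phi>0] .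
    moreover have "\<forall>\<^sub>F t in nhds 0. t \<in> ball 0 s" using g(1) by (intro eventually_nhds_in_open) auto
    ultimately have "\<forall>\<^sub>F t in nhds 0. t ^ Suc n * e t = t ^ n * g t"
    proof eventually_elim
      case (elim t)
      have "t ^ Suc n * e t = h (\<phi> t)"
        unfolding elim(1) e_def sum_distrib_left
      proof (rule sum.cong)
        fix j assume "j \<in> {..Suc n}"
        then have "t ^ Suc n = t ^ j * t ^ (Suc n - j)" by (simp flip: power_add)
        then show "t ^ Suc n * (a $ 1 ^ j * a $ 2 ^ (Suc n - j) * c j (\<phi> t)) =
            \<phi> t $ 1 ^ j * \<phi> t $ 2 ^ (Suc n - j) * c j (\<phi> t)"
          by (simp only: \<phi>_def vector_smult_component power_mult_distrib mult_ac)
      qed simp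
      also have "\<dots> = t ^ n * g t" using g(3)[of t] elim(2) by simp
      finally show ?case .
    qed
    then have "\<forall>\<^sub>F t in at 0. t ^ Suc n * e t = t ^ n * g t"
      by (auto simp: eventually_at_filter elim: eventually_mono)
    moreover have "isCont e 0"
    proof -
      have "isCont (\<lambda>t. c j (\<phi> t)) 0" for j
      proof -
        have z: "\<phi> 0 = 0" by (simp add: \<phi>_def)
        then have 1: "isCont \<phi> 0" using \<phi>0 tendsto_at_iff_tendsto_nhds[of \<phi> 0] by (simp add: isCont_def)
        have "isCont (c j) 0" using c holo_germ_isCont unfolding mpow_form_def by blast
        then have "isCont (c j) (\<phi> 0)" by (simp add: z)
        from isCont_o2[OF 1 this] show ?thesis .
      qed
      then show ?thesis unfolding e_def by (intro continuous_intros)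
    qed
    moreover have "isCont g 0"
      using continuous_on_interior[OF holomorphic_on_imp_continuous_on[OF g(2)], of 0] g(1) by simp
    moreover have "g 0 \<noteq> 0" using g by simp
    ultimately have "Suc n \<le> n" by (rule power_order_le)
    then show False by simp
  qed
  then show ?thesis using r unfolding eventually_nhds_metric by (intro exI[of _ r]) (auto simp: dist_commute)
qed

lemma has_mult_exists:
  assumes h: "holo_germ h" and nz: "\<exists>\<^sub>F x in nhds 0. h x \<noteq> 0"
  obtains m where "has_mult h m"
proof -
  have "\<exists>m. has_mult h m"
  proof (rule ccontr)
    assume no: "\<nexists>m. has_mult h m"
    have "\<exists>c. mpow_form m h c" for m
    proof (induction m)
      case 0
      have "mpow_form 0 h (\<lambda>j. h)" using h by (simp add: mpow_form_def)
      then show ?case by blast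
    next
      case (Suc m)
      then obtain c where c: "mpow_form m h c" by blast
      with no have "c j 0 = 0" if "j \<le> m" for j using that unfolding has_mult_def by blast
      from mpow_form_Suc[OF c this] show ?case by blast
    qed
    from mpow_all_imp_zero[OF h this] nz show False by (simp add: frequently_def)
  qed
  then show ?thesis using that by blast
qed

lemma mpow_form_swap:
  assumes "mpow_form m h c" shows "mpow_form m (\<lambda>x. h (swap2 x)) (\<lambda>j x. c (m - j) (swap2 x))"
proof -
  have "\<forall>\<^sub>F x in nhds 0. h (swap2 x) = (\<Sum>j\<le>m. swap2 x $ 1 ^ j * swap2 x $ 2 ^ (m - j) * c j (swap2 x))"
    using eventually_compose_filterlim[OF assms[unfolded mpow_form_def, THEN conjunct2] swap2_filterlim] .
  then have "\<forall>\<^sub>F x in nhds 0. h (swap2 x) = (\<Sum>j\<le>m. x $ 1 ^ j * x $ 2 ^ (m - j) * c (m - j) (swap2 x))"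
  proof eventually_elim
    case (elim x)
    show ?case unfolding elim
      by (rule sum.reindex_bij_witness[of _ "\<lambda>j. m - j" "\<lambda>j. m - j"]) (auto simp: mult_ac)
  qed
  then show ?thesis using assms by (auto simp: mpow_form_def intro: holo_germ_compose_swap)
qed

lemma has_mult_swap:
  assumes "has_mult h m" shows "has_mult (\<lambda>x. h (swap2 x)) m"
proof -
  obtain c j where "mpow_form m h c" "j \<le> m" "c j 0 \<noteq> 0" using assms by (auto simp: has_mult_def)
  then show ?thesis unfolding has_mult_def
    by (intro exI[of _ "\<lambda>j x. c (m - j) (swap2 x)"] conjI mpow_form_swap exI[of _ "m - j"]) auto
qed

text \<open>The order of \<open>h(0,w)\<close> in \<open>w\<close>.  The identity is required for all \<open>w\<close>, as the slices in question are
  polynomials.\<close>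

definition slice_order :: "(complex ^ 2 \<Rightarrow> complex) \<Rightarrow> nat \<Rightarrow> bool" where
  "slice_order h n \<longleftrightarrow> (\<exists>q. (\<forall>w. h (vector [0, w]) = w ^ n * q w) \<and> isCont q 0 \<and> q 0 \<noteq> 0)"

lemma has_mult_le_slice_order:
  assumes "has_mult h k" "slice_order h n" shows "k \<le> n"
proof -
  obtain c where c: "mpow_form k h c" using assms by (auto simp: has_mult_def)
  obtain q where q: "\<And>w. h (vector [0, w]) = w ^ n * q w" "isCont q 0" "q 0 \<noteq> 0"
    using assms by (auto simp: slice_order_def)
  have "\<forall>\<^sub>F w in nhds 0. h (vector [0, w]) = (\<Sum>j\<le>k. 0 ^ j * w ^ (k - j) * c j (vector [0, w]))"
    using eventually_slice_0w[OF c[unfolded mpow_form_def, THEN conjunct2]] by simp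
  then have "\<forall>\<^sub>F w in nhds 0. w ^ k * c 0 (vector [0, w]) = w ^ n * q w"
  proof eventually_elim
    case (elim w)
    have "(\<Sum>j\<le>k. 0 ^ j * w ^ (k - j) * c j (vector [0, w])) = (\<Sum>j\<in>{0}. 0 ^ j * w ^ (k - j) * c j (vector [0, w]))"
      by (rule sum.mono_neutral_right) auto
    with elim q(1) show ?case by simp
  qed
  then have "\<forall>\<^sub>F w in at 0. w ^ k * c 0 (vector [0, w]) = w ^ n * q w"
    by (auto simp: eventually_at_filter elim: eventually_mono)
  moreover have "isCont (\<lambda>w. c 0 (vector [0, w])) 0"
  proof (rule isCont_vector_slice)
    have "isCont (c 0) 0" using c holo_germ_isCont unfolding mpow_form_def by blast
    then show "isCont (c 0) (vector [0, 0])" by simp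
  qed
  ultimately show ?thesis using q(2,3) by (rule power_order_le)
qed

lemma slice_order_imp_nonzero:
  assumes "slice_order h n" shows "\<exists>\<^sub>F w in nhds 0. h (vector [0, w]) \<noteq> 0"
proof (rule ccontr)
  assume "\<not> ?thesis"
  then have ev: "\<forall>\<^sub>F w in nhds 0. h (vector [0, w]) = 0" by (simp add: frequently_def)
  obtain q where q: "\<And>w. h (vector [0, w]) = w ^ n * q w" "isCont q 0" "q 0 \<noteq> 0"
    using assms by (auto simp: slice_order_def)
  have "\<forall>\<^sub>F w in at 0. w ^ Suc n * 0 = w ^ n * q w"
    using ev by (auto simp: eventually_at_filter q(1) elim: eventually_mono)
  from power_order_le[OF this _ q(2,3)] show False by simp
qed

lemma nonzero_slice_imp_nonzero:
  assumes "(\<exists>\<^sub>F w in nhds 0. h (vector [0, w]) \<noteq> 0) \<or> (\<exists>\<^sub>F u in nhds 0. h (vector [u, 0]) \<noteq> 0)"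
  shows "\<exists>\<^sub>F x in nhds (0 :: complex ^ 2). h x \<noteq> (0 :: complex)"
  using assms eventually_slice_0w[of "\<lambda>x. h x = 0"] eventually_slice_u0[of "\<lambda>x. h x = 0"]
  unfolding frequently_def by auto

section \<open>Pulling a germ back to an infinitely near point\<close>

lemma blowup_chart_zero [simp]: "blowup_chart d 0 = 0"
  by (cases d) (auto simp: vec_eq_iff forall_2)

lemma holo_germ_blowup_chart: "holo_germ (\<lambda>x. blowup_chart d x $ i)"
  by (cases d) (auto intro!: holo_germ_vector_2 holo_germ_intros)

lemma chart_zero [simp]: "chart q 0 = 0"
  by (induction q) auto

lemma chart_append: "chart (p @ q) x = chart p (chart q x)"
  by (induction p) auto

lemma holo_germ_chart: "holo_germ (\<lambda>x. chart q x $ i)"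
proof (induction q arbitrary: i)
  case Nil
  then show ?case by (simp add: holo_germ_nth)
next
  case (Cons d q)
  have "holo_germ (\<lambda>x. blowup_chart d (chart q x) $ i)"
    by (rule holo_germ_compose[where G = "\<lambda>x. blowup_chart d x $ i", OF Cons _ holo_germ_blowup_chart]) simp
  then show ?case by simp
qed

lemma filterlim_blowup_chart: "filterlim (blowup_chart d) (nhds 0) (nhds 0)"
  by (rule holo_germ_components_tendsto[OF holo_germ_blowup_chart blowup_chart_zero])

lemma filterlim_chart: "filterlim (chart q) (nhds 0) (nhds 0)"
  by (rule holo_germ_components_tendsto[OF holo_germ_chart chart_zero])

lemma holo_germ_compose_blowup: "holo_germ h \<Longrightarrow> holo_germ (\<lambda>x. h (blowup_chart d x))"
  by (rule holo_germ_compose[where G = h, OF holo_germ_blowup_chart blowup_chart_zero])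

lemma holo_germ_compose_chart: "holo_germ h \<Longrightarrow> holo_germ (\<lambda>x. h (chart q x))"
  by (rule holo_germ_compose[where G = h, OF holo_germ_chart chart_zero])

lemma mpow_form_blowup:
  fixes c :: complex
  assumes e: "mpow_form m h e"
  defines "h' \<equiv> (\<lambda>x :: complex ^ 2. \<Sum>j\<le>m. (c + x $ 2) ^ (m - j) * e j (blowup_chart (Affine c) x))"
  shows "holo_germ h'" "\<forall>\<^sub>F x in nhds 0. h (blowup_chart (Affine c) x) = x $ 1 ^ m * h' x"
proof -
  have he: "holo_germ (e j)" for j using e by (simp add: mpow_form_def)
  show "holo_germ h'"
    unfolding h'_def
    by (intro holo_germ_sum holo_germ_mult holo_germ_power holo_germ_add holo_germ_const holo_germ_nth
        holo_germ_compose_blowup he)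
  show "\<forall>\<^sub>F x in nhds 0. h (blowup_chart (Affine c) x) = x $ 1 ^ m * h' x"
    using eventually_compose_filterlim[OF e[unfolded mpow_form_def, THEN conjunct2] filterlim_blowup_chart[of "Affine c"]]
  proof eventually_elim
    case (elim x)
    show ?case unfolding elim h'_def sum_distrib_left
    proof (rule sum.cong)
      fix j assume "j \<in> {..m}"
      then have "x $ 1 ^ m = x $ 1 ^ j * x $ 1 ^ (m - j)" by (simp flip: power_add)
      then show "blowup_chart (Affine c) x $ 1 ^ j * blowup_chart (Affine c) x $ 2 ^ (m - j) * e j (blowup_chart (Affine c) x) =
          x $ 1 ^ m * ((c + x $ 2) ^ (m - j) * e j (blowup_chart (Affine c) x))"
        by (simp add: power_mult_distrib mult_ac)
    qed simp
  qed
qed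

text \<open>The restriction of \<open>h'\<close> to the exceptional curve is the leading form of \<open>h\<close>, a nonzero polynomial of
  degree at most \<open>m\<close>.  It therefore vanishes at the point of direction \<open>c\<close> to some order \<open>n \<le> m\<close>, which bounds
  the multiplicity of the strict transform there.\<close>

lemma blowup_affine:
  assumes "has_mult h m"
  obtains h' n q where "holo_germ h'" "n \<le> m" "isCont q 0" "q 0 \<noteq> 0"
    "\<forall>\<^sub>F x in nhds 0. h (blowup_chart (Affine c) x) = x $ 1 ^ m * h' x"
    "\<And>w. h' (vector [0, w]) = w ^ n * q w"
proof -
  obtain e j where e: "mpow_form m h e" and j: "j \<le> m" "e j 0 \<noteq> 0" using assms by (auto simp: has_mult_def)
  define h' where "h' = (\<lambda>x :: complex ^ 2. \<Sum>j\<le>m. (c + x $ 2) ^ (m - j) * e j (blowup_chart (Affine c) x))"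
  have h': "holo_germ h'" and ev: "\<forall>\<^sub>F x in nhds 0. h (blowup_chart (Affine c) x) = x $ 1 ^ m * h' x"
    unfolding h'_def by (rule mpow_form_blowup[OF e])+
  define Q where "Q = (\<Sum>j\<le>m. monom (e j 0) (m - j))"
  have coeff: "coeff Q (m - j) = e j 0"
  proof -
    have "coeff Q (m - j) = (\<Sum>i\<in>{..m}. if i = j then e i 0 else 0)"
      unfolding Q_def coeff_sum coeff_monom by (rule sum.cong) (use j in auto)
    then show ?thesis using j by simp
  qed
  have deg: "degree Q \<le> m"
    unfolding Q_def by (rule degree_sum_le) (auto intro: order_trans[OF degree_monom_le])
  \<comment> \<open>The leading form on the line \<open>(1, c + w)\<close>.\<close>
  define P where "P = Q \<circ>\<^sub>p [:c, 1:]"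
  have P: "P \<noteq> 0" "degree P \<le> m"
    using coeff j(2) deg by (auto simp: P_def pcompose_eq_0_iff degree_pcompose)
  obtain R where R: "P = [:0, 1:] ^ order 0 P * R" "poly R 0 \<noteq> 0"
    using order_decomp[OF P(1), of 0] by (auto simp: poly_eq_0_iff_dvd)
  have "h' (vector [0, w]) = w ^ order 0 P * poly R w" for w
  proof -
    have "blowup_chart (Affine c) (vector [0, w]) = 0" by (simp add: vec_eq_iff forall_2)
    then have "h' (vector [0, w]) = (\<Sum>j\<le>m. (c + w) ^ (m - j) * e j 0)" by (simp add: h'_def)
    also have "\<dots> = poly P w" by (simp add: P_def Q_def poly_pcompose poly_sum poly_monom mult.commute)
    also have "\<dots> = w ^ order 0 P * poly R w" by (subst R(1)) (simp add: poly_power)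
    finally show ?thesis .
  qed
  moreover have "order 0 P \<le> m" using order_degree[OF P(1), of 0] P(2) by simp
  ultimately show ?thesis using that[of h' "order 0 P" "poly R", OF h' _ _ R(2) ev] by simp
qed

lemma blowup_chart_Infinite_swap:
  "blowup_chart Infinite x = swap2 (blowup_chart (Affine 0) (swap2 x))"
  by (simp add: vec_eq_iff forall_2)

lemma blowup_infinite:
  assumes "has_mult h m"
  obtains h' n q where "holo_germ h'" "n \<le> m" "isCont q 0" "q 0 \<noteq> 0"
    "\<forall>\<^sub>F x in nhds 0. h (blowup_chart Infinite x) = x $ 2 ^ m * h' x"
    "\<And>u. h' (vector [u, 0]) = u ^ n * q u"
proof -
  obtain h' n q where *: "holo_germ h'" "n \<le> m" "isCont q 0" "q 0 \<noteq> 0"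
    "\<forall>\<^sub>F x in nhds 0. h (swap2 (blowup_chart (Affine 0) x)) = x $ 1 ^ m * h' x"
    "\<And>w. h' (vector [0, w]) = w ^ n * q w"
    by (rule blowup_affine[OF has_mult_swap[OF assms], of 0]) blast
  have "\<forall>\<^sub>F x in nhds 0. h (blowup_chart Infinite x) = x $ 2 ^ m * h' (swap2 x)"
    using eventually_compose_filterlim[OF *(5) swap2_filterlim]
    unfolding blowup_chart_Infinite_swap by simp
  then show ?thesis
    using that[of "\<lambda>x. h' (swap2 x)" n q] *(1-4,6) holo_germ_compose_swap by simp
qed

text \<open>The coordinate axis \<open>u = 0\<close> at an infinitely near point \<open>q\<close> is either the germ of an exceptional
  component, namely of the strict transform of the exceptional curve of the blow-up of a point \<open>p\<close>, or it is
  not exceptional; likewise the axis \<open>w = 0\<close>.  The two functions return \<open>Some p\<close> or \<open>None\<close>.  The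
  last blow-up decides, so the recursion is over the reversed list of directions: a blow-up in
  direction \<open>Affine c\<close> creates the new axis \<open>u = 0\<close>, keeps the axis \<open>w = 0\<close> only if \<open>c = 0\<close>, and moves
  off the old axis \<open>u = 0\<close>; the direction \<open>Infinite\<close> exchanges the roles.\<close>

primrec u_axis_rev :: "cp1 list \<Rightarrow> near_point option" where
  "u_axis_rev [] = None"
| "u_axis_rev (d # r) = (case d of Affine c \<Rightarrow> Some (rev r) | Infinite \<Rightarrow> u_axis_rev r)"

primrec w_axis_rev :: "cp1 list \<Rightarrow> near_point option" where
  "w_axis_rev [] = None"
| "w_axis_rev (d # r) = (case d of Affine c \<Rightarrow> if c = 0 then w_axis_rev r else None | Infinite \<Rightarrow> Some (rev r))"

definition u_axis :: "near_point \<Rightarrow> near_point option" where "u_axis q = u_axis_rev (rev q)"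
definition w_axis :: "near_point \<Rightarrow> near_point option" where "w_axis q = w_axis_rev (rev q)"

lemma axis_simps [simp]:
  "u_axis [] = None" "w_axis [] = None"
  "u_axis (p @ [Affine c]) = Some p" "w_axis (p @ [Affine c]) = (if c = 0 then w_axis p else None)"
  "u_axis (p @ [Infinite]) = u_axis p" "w_axis (p @ [Infinite]) = Some p"
  by (simp_all add: u_axis_def w_axis_def)

definition axis_exponent :: "(near_point \<Rightarrow> nat) \<Rightarrow> near_point option \<Rightarrow> nat" where
  "axis_exponent n a = (case a of None \<Rightarrow> 0 | Some p \<Rightarrow> n p)"

lemma axis_exponent_simps [simp]: "axis_exponent n None = 0" "axis_exponent n (Some p) = n p"
  by (simp_all add: axis_exponent_def)

text \<open>The valuation \<open>div_val\<close> for an arbitrary infinitely near point in place of a centre of the resolution.\<close>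

definition exc_val :: "near_point \<Rightarrow> (complex ^ 2 \<Rightarrow> complex) \<Rightarrow> enat" where
  "exc_val p g = Sup {enat k | k. \<exists>h. holo_germ h \<and>
       (\<forall>\<^sub>F x in nhds 0. g (chart (p @ [Affine 0]) x) = (x $ 1) ^ k * h x)}"

lemma div_val_eq_exc_val: "div_val node i g = exc_val (node i) g"
  by (simp add: div_val_def exc_val_def)

text \<open>The supremum in the definition is attained, unless it is infinite: the admissible exponents are closed downwards.\<close>

lemma le_exc_val_iff:
  assumes "holo_germ g"
  shows "enat k \<le> exc_val p g \<longleftrightarrow>
    (\<exists>h. holo_germ h \<and> (\<forall>\<^sub>F x in nhds 0. g (chart (p @ [Affine 0]) x) = (x $ 1) ^ k * h x))"
    (is "_ \<longleftrightarrow> ?D k")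
proof
  assume le: "enat k \<le> exc_val p g"
  have mono: "?D j" if l: "?D l" and jl: "j \<le> l" for j l
  proof -
    obtain h where h: "holo_germ h" "\<forall>\<^sub>F x in nhds 0. g (chart (p @ [Affine 0]) x) = (x $ 1) ^ l * h x"
      using l by blast
    obtain d where d: "l = j + d" using jl le_Suc_ex by blast
    have "\<forall>\<^sub>F x in nhds 0. g (chart (p @ [Affine 0]) x) = (x $ 1) ^ j * ((x $ 1) ^ d * h x)"
      using h(2) by eventually_elim (simp add: d power_add)
    moreover have "holo_germ (\<lambda>x. (x $ 1) ^ d * h x)" by (intro holo_germ_intros h)
    ultimately show ?thesis by blast
  qed
  have "?D 0"
    by (intro exI[of _ "\<lambda>x. g (chart (p @ [Affine 0]) x)"] conjI holo_germ_compose_chart[OF assms]) simp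
  show "?D k"
  proof (rule ccontr)
    assume no: "\<not> ?D k"
    then have "0 < k" using \<open>?D 0\<close> by (cases k) auto
    have "exc_val p g \<le> enat (k - 1)"
      unfolding exc_val_def
    proof (rule Sup_least, clarify)
      fix l h assume "holo_germ h" "\<forall>\<^sub>F x in nhds 0. g (chart (p @ [Affine 0]) x) = (x $ 1) ^ l * h x"
      then have "\<not> k \<le> l" using mono no by blast
      then show "enat l \<le> enat (k - 1)" by simp
    qed
    with le have "enat k \<le> enat (k - 1)" by (rule order_trans)
    with \<open>0 < k\<close> show False by simp
  qed
next
  assume "?D k"
  then show "enat k \<le> exc_val p g" unfolding exc_val_def by (intro Sup_upper) blast
qed

lemma exc_val_eqI:
  assumes "holo_germ g" "holo_germ h"
    "\<forall>\<^sub>F x in nhds 0. g (chart (p @ [Affine 0]) x) = (x $ 1) ^ k * h x"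
    "\<exists>\<^sub>F w in nhds 0. h (vector [0, w]) \<noteq> 0"
  shows "exc_val p g = enat k"
proof (rule antisym)
  show "enat k \<le> exc_val p g" using assms le_exc_val_iff by blast
  have "\<not> enat (Suc k) \<le> exc_val p g"
  proof
    assume "enat (Suc k) \<le> exc_val p g"
    then obtain h' where h': "holo_germ h'"
        "\<forall>\<^sub>F x in nhds 0. g (chart (p @ [Affine 0]) x) = (x $ 1) ^ Suc k * h' x"
      using le_exc_val_iff[OF assms(1)] by blast
    have "\<forall>\<^sub>F x in nhds 0. x $ 1 ^ Suc k * h' x = x $ 1 ^ k * h x"
      using h'(2) assms(3) by eventually_elim (metis (no_types))
    from u_power_le[OF h'(1) assms(2) this assms(4)] show False by simp
  qed
  then show "exc_val p g \<le> enat k" by (cases "exc_val p g") auto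
qed

text \<open>Meaningful for nonzero germs only, for which \<open>exc_val\<close> is finite.\<close>

definition exc_mult :: "(complex ^ 2 \<Rightarrow> complex) \<Rightarrow> near_point \<Rightarrow> nat" where
  "exc_mult g p = the_enat (exc_val p g)"

text \<open>Near \<open>q\<close> the total transform of \<open>g\<close> is a monomial in the equations of the exceptional components through
  \<open>q\<close> times \<open>h\<close>, an equation of the strict transform: \<open>h\<close> does not vanish identically on these components.  Its
  multiplicity \<open>m\<close> is recorded for the comparison of valuations.\<close>

definition residual_germ where
  "residual_germ g q h m \<longleftrightarrow> holo_germ h \<and> has_mult h m \<and>
     (\<forall>\<^sub>F x in nhds 0. g (chart q x) =
        x $ 1 ^ axis_exponent (exc_mult g) (u_axis q) * x $ 2 ^ axis_exponent (exc_mult g) (w_axis q) * h x) \<and>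
     (u_axis q \<noteq> None \<longrightarrow> (\<exists>\<^sub>F w in nhds 0. h (vector [0, w]) \<noteq> 0)) \<and>
     (w_axis q \<noteq> None \<longrightarrow> (\<exists>\<^sub>F u in nhds 0. h (vector [u, 0]) \<noteq> 0))"

text \<open>The exponents are written with the numbers at \<open>q\<close>: that \<open>A + B + m\<close> is the valuation of the new
  exceptional curve is a consequence, obtained from the case \<open>c = 0\<close>.\<close>

lemma residual_germ_pull_affine:
  assumes g: "holo_germ g" and res: "residual_germ g q h m"
  defines "A \<equiv> axis_exponent (exc_mult g) (u_axis q)" and "B \<equiv> axis_exponent (exc_mult g) (w_axis q)"
  obtains h' m' where "holo_germ h'" "has_mult h' m'" "m' \<le> m"
    "\<forall>\<^sub>F x in nhds 0. g (chart (q @ [Affine c]) x) = x $ 1 ^ (A + B + m) * x $ 2 ^ (if c = 0 then B else 0) * h' x"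
    "\<exists>\<^sub>F w in nhds 0. h' (vector [0, w]) \<noteq> 0"
    "c = 0 \<Longrightarrow> w_axis q \<noteq> None \<Longrightarrow> \<exists>\<^sub>F u in nhds 0. h' (vector [u, 0]) \<noteq> 0"
proof -
  have h: "holo_germ h" "has_mult h m"
    and ev: "\<forall>\<^sub>F x in nhds 0. g (chart q x) = x $ 1 ^ A * x $ 2 ^ B * h x"
    and nz: "w_axis q \<noteq> None \<longrightarrow> (\<exists>\<^sub>F u in nhds 0. h (vector [u, 0]) \<noteq> 0)"
    using res by (auto simp: residual_germ_def A_def B_def)
  obtain h0 n k where h0: "holo_germ h0" "n \<le> m" "isCont k 0" "k 0 \<noteq> 0"
    "\<forall>\<^sub>F x in nhds 0. h (blowup_chart (Affine c) x) = x $ 1 ^ m * h0 x"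
    "\<And>w. h0 (vector [0, w]) = w ^ n * k w"
    using blowup_affine[OF h(2)] by blast
  \<comment> \<open>For \<open>c \<noteq> 0\<close> the old axis \<open>w = 0\<close> does not pass through the new point, and its power is a unit.\<close>
  define h' where "h' = (if c = 0 then h0 else (\<lambda>x. (c + x $ 2) ^ B * h0 x))"
  have hol: "holo_germ h'" using h0(1) by (auto simp: h'_def intro!: holo_germ_intros)
  have slice: "slice_order h' n"
  proof (cases "c = 0")
    case True
    then show ?thesis using h0 by (auto simp: h'_def slice_order_def)
  next
    case False
    then show ?thesis unfolding slice_order_def h'_def
      by (intro exI[of _ "\<lambda>w. (c + w) ^ B * k w"]) (use h0 in \<open>auto intro!: continuous_intros simp: mult_ac\<close>)
  qed
  note nz' = slice_order_imp_nonzero[OF slice]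
  obtain m' where m': "has_mult h' m'"
    using has_mult_exists[OF hol] nonzero_slice_imp_nonzero nz' by blast
  have "m' \<le> m" using has_mult_le_slice_order[OF m' slice] h0(2) by simp
  moreover have "\<forall>\<^sub>F x in nhds 0. g (chart (q @ [Affine c]) x) = x $ 1 ^ (A + B + m) * x $ 2 ^ (if c = 0 then B else 0) * h' x"
    using eventually_compose_filterlim[OF ev filterlim_blowup_chart[of "Affine c"]] h0(5)
    by eventually_elim (auto simp: chart_append h'_def power_add power_mult_distrib mult_ac)
  moreover have "\<exists>\<^sub>F u in nhds 0. h' (vector [u, 0]) \<noteq> 0" if "c = 0" "w_axis q \<noteq> None"
  proof (rule ccontr)
    assume "\<not> ?thesis"
    then have "\<forall>\<^sub>F u in nhds 0. h0 (vector [u, 0]) = 0" using that by (simp add: frequently_def h'_def)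
    with eventually_slice_u0[OF h0(5)] have "\<forall>\<^sub>F u in nhds 0. h (vector [u, 0]) = 0"
      by eventually_elim (simp add: that)
    with nz that show False by (simp add: frequently_def)
  qed
  ultimately show ?thesis using that[OF hol m' _ _ nz'] by blast
qed

text \<open>The multiplicity of the total transform is that of the strict transform plus the exponents of the
  components through \<open>q\<close>.\<close>

lemma residual_germ_exc_mult:
  assumes g: "holo_germ g" and res: "residual_germ g q h m"
  shows "exc_val q g = enat (exc_mult g q)"
    "exc_mult g q = axis_exponent (exc_mult g) (u_axis q) + axis_exponent (exc_mult g) (w_axis q) + m"
proof -
  let ?A = "axis_exponent (exc_mult g) (u_axis q)" and ?B = "axis_exponent (exc_mult g) (w_axis q)"
  obtain h' m' where h': "holo_germ h'"
    "\<forall>\<^sub>F x in nhds 0. g (chart (q @ [Affine 0]) x) = x $ 1 ^ (?A + ?B + m) * x $ 2 ^ ?B * h' x"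
    "\<exists>\<^sub>F w in nhds 0. h' (vector [0, w]) \<noteq> 0"
    by (rule residual_germ_pull_affine[OF g res, where c = 0]) (simp; blast)
  have "\<exists>\<^sub>F w in nhds 0. w ^ ?B * h' (vector [0, w]) \<noteq> 0"
  proof (rule ccontr)
    assume "\<not> ?thesis"
    then have ev: "\<forall>\<^sub>F w in nhds 0. w = 0 \<or> h' (vector [0, w]) = 0"
      by (auto simp: frequently_def elim: eventually_mono)
    have "isCont (\<lambda>w. h' (vector [0, w])) 0"
      using isCont_vector_slice(2)[where h = h' and a = 0 and b = 0] holo_germ_isCont[OF h'(1)] by simp
    moreover have "\<forall>\<^sub>F w in at 0. h' (vector [0, w]) = 0"
      using ev by (auto simp: eventually_at_filter elim: eventually_mono)
    then have "((\<lambda>w. h' (vector [0, w])) \<longlongrightarrow> 0) (at 0)" by (simp add: tendsto_cong)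
    ultimately have "h' 0 = 0" unfolding isCont_def by (metis LIM_unique vector_2_zero)
    then have "\<forall>\<^sub>F w in nhds 0. h' (vector [0, w]) = 0"
      using ev by (auto elim: eventually_mono)
    with h'(3) show False by (simp add: frequently_def)
  qed
  then have "exc_val q g = enat (?A + ?B + m)"
    using h' by (intro exc_val_eqI[OF g, of "\<lambda>x. x $ 2 ^ ?B * h' x"]) (auto intro!: holo_germ_intros simp: mult.assoc)
  then show "exc_val q g = enat (exc_mult g q)" "exc_mult g q = ?A + ?B + m"
    by (simp_all add: exc_mult_def)
qed

lemma residual_germ_pull:
  assumes g: "holo_germ g" and res: "residual_germ g q h m"
  obtains h' m' where "residual_germ g (q @ [d]) h' m'" "m' \<le> m"
proof (cases d)
  case (Affine c)
  note N = residual_germ_exc_mult(2)[OF g res]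
  obtain h' m' where "holo_germ h'" "has_mult h' m'" "m' \<le> m"
    "\<forall>\<^sub>F x in nhds 0. g (chart (q @ [Affine c]) x) = x $ 1 ^ exc_mult g q *
        x $ 2 ^ (if c = 0 then axis_exponent (exc_mult g) (w_axis q) else 0) * h' x"
    "\<exists>\<^sub>F w in nhds 0. h' (vector [0, w]) \<noteq> 0"
    "c = 0 \<Longrightarrow> w_axis q \<noteq> None \<Longrightarrow> \<exists>\<^sub>F u in nhds 0. h' (vector [u, 0]) \<noteq> 0"
    unfolding N by (rule residual_germ_pull_affine[OF g res, where c = c]) blast
  then have "residual_germ g (q @ [d]) h' m'" unfolding residual_germ_def Affine by auto
  with \<open>m' \<le> m\<close> show ?thesis by (rule that[rotated])
next
  case Infinite
  let ?A = "axis_exponent (exc_mult g) (u_axis q)" and ?B = "axis_exponent (exc_mult g) (w_axis q)"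
  note N = residual_germ_exc_mult(2)[OF g res]
  have h: "holo_germ h" "has_mult h m"
    and ev: "\<forall>\<^sub>F x in nhds 0. g (chart q x) = x $ 1 ^ ?A * x $ 2 ^ ?B * h x"
    and nz: "u_axis q \<noteq> None \<longrightarrow> (\<exists>\<^sub>F w in nhds 0. h (vector [0, w]) \<noteq> 0)"
    using res by (auto simp: residual_germ_def)
  obtain h' n k where h': "holo_germ h'" "n \<le> m" "isCont k 0" "k 0 \<noteq> 0"
    "\<forall>\<^sub>F x in nhds 0. h (blowup_chart Infinite x) = x $ 2 ^ m * h' x"
    "\<And>u. h' (vector [u, 0]) = u ^ n * k u"
    using blowup_infinite[OF h(2)] by blast
  have slice: "slice_order (\<lambda>x. h' (swap2 x)) n" using h' by (auto simp: slice_order_def)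
  have nz1: "\<exists>\<^sub>F u in nhds 0. h' (vector [u, 0]) \<noteq> 0" using slice_order_imp_nonzero[OF slice] by simp
  obtain m' where m': "has_mult h' m'"
    using has_mult_exists[OF h'(1)] nonzero_slice_imp_nonzero nz1 by blast
  have "m' \<le> m" using has_mult_le_slice_order[OF has_mult_swap[OF m'] slice] h'(2) by simp
  have "\<forall>\<^sub>F x in nhds 0. g (chart (q @ [Infinite]) x) = x $ 1 ^ ?A * x $ 2 ^ exc_mult g q * h' x"
    using eventually_compose_filterlim[OF ev filterlim_blowup_chart[of Infinite]] h'(5)
    by eventually_elim (auto simp: chart_append N power_add power_mult_distrib mult_ac)
  moreover have "\<exists>\<^sub>F w in nhds 0. h' (vector [0, w]) \<noteq> 0" if "u_axis q \<noteq> None"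
  proof (rule ccontr)
    assume "\<not> ?thesis"
    then have "\<forall>\<^sub>F w in nhds 0. h' (vector [0, w]) = 0" by (simp add: frequently_def)
    with eventually_slice_0w[OF h'(5)] have "\<forall>\<^sub>F w in nhds 0. h (vector [0, w]) = 0"
      by eventually_elim simp
    with nz that show False by (simp add: frequently_def)
  qed
  ultimately have "residual_germ g (q @ [d]) h' m'"
    unfolding residual_germ_def Infinite using h'(1) m' nz1 by auto
  with \<open>m' \<le> m\<close> show ?thesis by (rule that[rotated])
qed

lemma residual_germ_exists:
  assumes g: "holo_germ g" and nz: "\<exists>\<^sub>F x in nhds 0. g x \<noteq> 0"
  shows "\<exists>h m. residual_germ g q h m \<and> m \<le> exc_mult g []"
proof (induction q rule: rev_induct)
  case Nil
  obtain m where "has_mult g m" using has_mult_exists[OF g nz] by blast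
  then have "residual_germ g [] g m" using g by (simp add: residual_germ_def)
  moreover from residual_germ_exc_mult(2)[OF g this] have "m = exc_mult g []" by simp
  ultimately show ?case by blast
next
  case (snoc d q)
  then obtain h m where hm: "residual_germ g q h m" "m \<le> exc_mult g []" by blast
  obtain h' m' where "residual_germ g (q @ [d]) h' m'" "m' \<le> m" by (rule residual_germ_pull[OF g hm(1)])
  with hm(2) show ?case by (blast intro: order_trans)
qed

lemma exc_mult_Nil_le:
  assumes g: "holo_germ g" and nz: "\<exists>\<^sub>F x in nhds 0. g x \<noteq> 0"
  shows "exc_mult g [] \<le> exc_mult g q"
proof (induction q rule: rev_induct)
  case (snoc d p)
  obtain h m where "residual_germ g (p @ [d]) h m" using residual_germ_exists[OF g nz] by blast
  from residual_germ_exc_mult(2)[OF g this] have "exc_mult g p \<le> exc_mult g (p @ [d])" by (cases d) auto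
  with snoc show ?case by simp
qed simp

lemma axis_shorter:
  "u_axis q = Some p \<Longrightarrow> length p < length q" "w_axis q = Some p \<Longrightarrow> length p < length q"
proof (induction q arbitrary: p rule: rev_induct)
  case (snoc d q)
  { case 1 with snoc show ?case by (cases d) fastforce+ next
    case 2 with snoc show ?case by (cases d) (fastforce split: if_splits)+ }
qed simp_all

text \<open>The valuation at \<open>q\<close> is the sum of at most two valuations at points blown up earlier and of the
  multiplicity of the strict transform, which is at most the multiplicity of \<open>g\<close>.  So each blow-up at most
  triples the bound.\<close>

lemma exc_mult_le_Nil:
  assumes g: "holo_germ g" and nz: "\<exists>\<^sub>F x in nhds 0. g x \<noteq> 0"
  shows "exc_mult g q \<le> 3 ^ length q * exc_mult g []"
proof (induction q rule: length_induct)
  case (1 q)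
  show ?case
  proof (cases q)
    case (Cons d q')
    define L where "L = length q'"
    have bound: "axis_exponent (exc_mult g) a \<le> 3 ^ L * exc_mult g []" if "\<And>p. a = Some p \<Longrightarrow> length p < length q" for a
    proof (cases a)
      case (Some p)
      then have "length p < length q" using that by blast
      moreover from this have "(3::nat) ^ length p \<le> 3 ^ L" by (intro power_increasing) (auto simp: Cons L_def)
      ultimately show ?thesis using 1[rule_format, of p] Some
        by (simp add: order_trans[OF _ mult_right_mono])
    qed simp
    obtain h m where res: "residual_germ g q h m" and m: "m \<le> exc_mult g []"
      using residual_germ_exists[OF g nz] by blast
    have "exc_mult g q \<le> 3 ^ L * exc_mult g [] + 3 ^ L * exc_mult g [] + exc_mult g []"
      unfolding residual_germ_exc_mult(2)[OF g res]
      by (intro add_mono bound m) (blast intro: axis_shorter)+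
    also have "\<dots> \<le> 3 ^ L * exc_mult g [] + 3 ^ L * exc_mult g [] + 3 ^ L * exc_mult g []" by simp
    finally show ?thesis by (simp add: Cons L_def)
  qed simp
qed

lemma exc_val_eq_exc_mult:
  assumes g: "holo_germ g" and nz: "\<exists>\<^sub>F x in nhds 0. g x \<noteq> 0"
  shows "exc_val p g = enat (exc_mult g p)"
  using residual_germ_exists[OF g nz] residual_germ_exc_mult(1)[OF g] by blast

lemma exc_val_zero_germ:
  assumes g: "holo_germ g" and z: "\<forall>\<^sub>F x in nhds 0. g x = 0"
  shows "enat k \<le> exc_val p g"
proof -
  have "\<forall>\<^sub>F x in nhds 0. g (chart (p @ [Affine 0]) x) = x $ 1 ^ k * 0"
    using eventually_compose_filterlim[OF z filterlim_chart] by simp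
  then show ?thesis unfolding le_exc_val_iff[OF g] by (blast intro: holo_germ_const)
qed

text \<open>Izumi's inequality in the form in which it is used below: both valuations are compared with the
  multiplicity at the origin.\<close>

lemma exc_val_comparison:
  assumes g: "holo_germ g" and le: "enat (3 ^ length q * b) \<le> exc_val q g"
  shows "enat b \<le> exc_val p g"
proof (cases "\<forall>\<^sub>F x in nhds 0. g x = 0")
  case True
  then show ?thesis by (rule exc_val_zero_germ[OF g])
next
  case False
  then have nz: "\<exists>\<^sub>F x in nhds 0. g x \<noteq> 0" by (simp add: frequently_def)
  have "3 ^ length q * b \<le> exc_mult g q"
    using le by (simp add: exc_val_eq_exc_mult[OF g nz])
  also note exc_mult_le_Nil[OF g nz, of q]
  finally have "b \<le> exc_mult g []" by simp
  then have "b \<le> exc_mult g p" using exc_mult_Nil_le[OF g nz, of p] by simp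
  then show ?thesis by (simp add: exc_val_eq_exc_mult[OF g nz])
qed

lemma mpow_form_imp_le_exc_val:
  assumes g: "holo_germ g" and c: "mpow_form m g c"
  shows "enat m \<le> exc_val p g"
proof -
  have "enat m \<le> exc_val [] g"
    unfolding le_exc_val_iff[OF g] using mpow_form_blowup[OF c, of 0] by auto
  then show ?thesis using exc_val_comparison[OF g, of "[]" m p] by simp
qed

lemma le_exc_val_add:
  assumes "holo_germ g" "holo_germ h" "enat k \<le> exc_val p g" "enat k \<le> exc_val p h"
  shows "enat k \<le> exc_val p (\<lambda>x. g x + h x)"
proof -
  obtain a b where ab: "holo_germ a" "\<forall>\<^sub>F x in nhds 0. g (chart (p @ [Affine 0]) x) = (x $ 1) ^ k * a x"
    "holo_germ b" "\<forall>\<^sub>F x in nhds 0. h (chart (p @ [Affine 0]) x) = (x $ 1) ^ k * b x"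
    using assms le_exc_val_iff by meson
  have "\<forall>\<^sub>F x in nhds 0. g (chart (p @ [Affine 0]) x) + h (chart (p @ [Affine 0]) x) = (x $ 1) ^ k * (a x + b x)"
    using ab(2,4) by eventually_elim (simp add: algebra_simps)
  moreover have "holo_germ (\<lambda>x. a x + b x)" by (intro holo_germ_add ab)
  ultimately show ?thesis unfolding le_exc_val_iff[OF holo_germ_add[OF assms(1,2)]] by blast
qed

lemma le_exc_val_scale:
  assumes "holo_germ g" "enat k \<le> exc_val p g"
  shows "enat k \<le> exc_val p (\<lambda>x. c * g x)"
proof -
  obtain a where a: "holo_germ a" "\<forall>\<^sub>F x in nhds 0. g (chart (p @ [Affine 0]) x) = (x $ 1) ^ k * a x"
    using assms le_exc_val_iff by meson
  have "\<forall>\<^sub>F x in nhds 0. c * g (chart (p @ [Affine 0]) x) = (x $ 1) ^ k * (c * a x)"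
    using a(2) by eventually_elim simp
  moreover have "holo_germ (\<lambda>x. c * a x)" by (intro holo_germ_mult holo_germ_const a)
  ultimately show ?thesis
    unfolding le_exc_val_iff[OF holo_germ_mult[OF holo_germ_const[of c] assms(1)]] by blast
qed

section \<open>Exceptional components and strict transforms in local coordinates\<close>

text \<open>Points of the exceptional divisor near \<open>q\<close> are those mapped to the origin.  The restriction to a neighbourhood
  matters in direction \<open>Affine c\<close> with \<open>c \<noteq> 0\<close>, where the old axis \<open>w = 0\<close> becomes \<open>w = - c\<close>.\<close>

lemma chart_axes:
  "q \<noteq> [] \<Longrightarrow> \<forall>\<^sub>F x in nhds 0. chart q x = 0 \<longleftrightarrow>
     (u_axis q \<noteq> None \<and> x $ 1 = 0) \<or> (w_axis q \<noteq> None \<and> x $ 2 = 0)"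
proof (induction q rule: rev_induct)
  case (snoc d q)
  have ax: "u_axis q \<noteq> None \<or> w_axis q \<noteq> None" if "q \<noteq> []"
    using that by (cases q rule: rev_cases; cases "last q") auto
  have 1: "\<forall>\<^sub>F x in nhds 0. chart q (blowup_chart d x) = 0 \<longleftrightarrow>
      (if q = [] then blowup_chart d x = 0 else
        (u_axis q \<noteq> None \<and> blowup_chart d x $ 1 = 0) \<or> (w_axis q \<noteq> None \<and> blowup_chart d x $ 2 = 0))"
  proof (cases "q = []")
    case False
    from eventually_compose_filterlim[OF snoc.IH[OF this] filterlim_blowup_chart] False
    show ?thesis by simp
  qed simp
  show ?case
  proof (cases d)
    case (Affine c)
    have "((\<lambda>x. c + x $ 2) \<longlongrightarrow> c + (0 :: complex ^ 2) $ 2) (nhds (0 :: complex ^ 2))"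
      by (intro tendsto_intros tendsto_ident_nhds)
    then have "c \<noteq> 0 \<Longrightarrow> \<forall>\<^sub>F x in nhds (0 :: complex ^ 2). c + x $ 2 \<noteq> 0"
      by (intro tendsto_imp_eventually_ne) auto
    then have 2: "\<forall>\<^sub>F x in nhds (0 :: complex ^ 2). c \<noteq> 0 \<longrightarrow> c + x $ 2 \<noteq> 0"
      by (cases "c = 0") auto
    from 1 2 show ?thesis
      by eventually_elim (use Affine ax in \<open>auto simp: chart_append vec_eq_iff forall_2\<close>)
  next
    case Infinite
    from 1 show ?thesis
      by eventually_elim (use Infinite ax in \<open>auto simp: chart_append vec_eq_iff forall_2\<close>)
  qed
qed simp

lemma closure_zero_iff_frequently:
  fixes T :: "'a::real_normed_vector set"
  shows "0 \<in> closure T \<longleftrightarrow> (\<exists>\<^sub>F x in nhds 0. x \<in> T)"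
proof -
  have "(\<forall>\<^sub>F x in nhds 0. x \<notin> T) \<longleftrightarrow> (\<exists>U. open U \<and> 0 \<in> U \<and> U \<inter> T = {})"
    by (auto simp: eventually_nhds)
  also have "\<dots> \<longleftrightarrow> 0 \<notin> closure T"
  proof
    assume "\<exists>U. open U \<and> 0 \<in> U \<and> U \<inter> T = {}"
    then show "0 \<notin> closure T" using open_Int_closure_eq_empty by blast
  next
    assume "0 \<notin> closure T"
    then show "\<exists>U. open U \<and> 0 \<in> U \<and> U \<inter> T = {}"
      using closure_subset[of T] by (intro exI[of _ "- closure T"]) auto
  qed
  finally show ?thesis by (auto simp: frequently_def)
qed

lemma strict_transform_frequently:
  "0 \<in> strict_transform s A \<longleftrightarrow> (\<exists>\<^sub>F x in nhds 0. chart s x \<in> A \<and> chart s x \<noteq> 0)"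
  unfolding strict_transform_def closure_zero_iff_frequently by simp

text \<open>The strict transform of \<open>u = 0\<close> passes only through the point \<open>[0 : 1]\<close> of the next exceptional curve,
  and there it is again \<open>u = 0\<close>.\<close>

lemma strict_transform_u_axis:
  "0 \<in> strict_transform s {x. x $ 1 = 0} \<Longrightarrow> s = replicate (length s) Infinite"
proof (induction s)
  case (Cons d s)
  have fr: "\<exists>\<^sub>F x in nhds 0. blowup_chart d (chart s x) $ 1 = 0 \<and> blowup_chart d (chart s x) \<noteq> 0"
    using Cons.prems by (simp add: strict_transform_frequently)
  show ?case
  proof (cases d)
    case (Affine c)
    with fr show ?thesis by (auto simp: vec_eq_iff forall_2 dest: frequently_ex)
  next
    case Infinite
    have "\<exists>\<^sub>F x in nhds 0. chart s x $ 1 = 0 \<and> chart s x \<noteq> 0"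
      by (rule frequently_elim1[OF fr]) (auto simp: Infinite vec_eq_iff forall_2)
    then have "0 \<in> strict_transform s {x. x $ 1 = 0}" by (simp add: strict_transform_frequently)
    from Cons.IH[OF this] Infinite show ?thesis by simp
  qed
qed simp

text \<open>As for \<open>u = 0\<close>, with the point \<open>[1 : 0]\<close>.  In the direction \<open>c \<noteq> 0\<close> the preimage is the line
  \<open>w = - c\<close>, which is nonempty but stays away from the point.\<close>

lemma strict_transform_w_axis:
  "0 \<in> strict_transform s {x. x $ 2 = 0} \<Longrightarrow> s = replicate (length s) (Affine 0)"
proof (induction s)
  case (Cons d s)
  have fr: "\<exists>\<^sub>F x in nhds 0. blowup_chart d (chart s x) $ 2 = 0 \<and> blowup_chart d (chart s x) \<noteq> 0"
    using Cons.prems by (simp add: strict_transform_frequently)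
  show ?case
  proof (cases d)
    case (Affine c)
    have "((\<lambda>x. chart s x $ 2) \<longlongrightarrow> (0 :: complex ^ 2) $ 2) (nhds 0)"
      by (intro tendsto_vec_nth filterlim_chart)
    then have lim: "((\<lambda>x. chart s x $ 2) \<longlongrightarrow> 0) (nhds 0)" by simp
    have "c = 0"
    proof (rule ccontr)
      assume "c \<noteq> 0"
      then have "\<forall>\<^sub>F x in nhds 0. chart s x $ 2 \<noteq> - c"
        using lim by (intro tendsto_imp_eventually_ne) auto
      from frequently_eventually_conj[OF fr this] show False
        by (auto simp: Affine vec_eq_iff forall_2 add_eq_0_iff dest!: frequently_ex)
    qed
    have "\<exists>\<^sub>F x in nhds 0. chart s x $ 2 = 0 \<and> chart s x \<noteq> 0"
      by (rule frequently_elim1[OF fr]) (auto simp: Affine \<open>c = 0\<close> vec_eq_iff forall_2)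
    then have "0 \<in> strict_transform s {x. x $ 2 = 0}" by (simp add: strict_transform_frequently)
    from Cons.IH[OF this] Affine \<open>c = 0\<close> show ?thesis by simp
  next
    case Infinite
    with fr show ?thesis by (auto simp: vec_eq_iff forall_2 dest: frequently_ex)
  qed
qed simp

lemma axis_append_replicate:
  "u_axis (p @ Affine c # replicate n Infinite) = Some p"
  "w_axis (p @ Infinite # replicate n (Affine 0)) = Some p"
proof (induction n)
  case 0
  { case 1 show ?case by simp next case 2 show ?case by simp }
next
  case (Suc n)
  { case 1 show ?case using Suc(1) axis_simps(5)[of "p @ Affine c # replicate n Infinite"]
      by (simp del: axis_simps add: replicate_append_same)
    next
    case 2 show ?case using Suc(2) axis_simps(4)[of "p @ Infinite # replicate n (Affine 0)" 0]
      by (simp del: axis_simps add: replicate_append_same) }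
qed

lemma exc_component_axis:
  assumes "q \<in> exc_component node i"
  shows "u_axis q = Some (node i) \<or> w_axis q = Some (node i)"
proof -
  obtain d s where q: "q = node i @ d # s" and s: "0 \<in> strict_transform s (blowup_chart d -` {0})"
    using assms by (auto simp: exc_component_def)
  show ?thesis
  proof (cases d)
    case (Affine c)
    have "blowup_chart d -` {0} = {x. x $ 1 = 0}" by (auto simp: Affine vec_eq_iff forall_2)
    with s have "s = replicate (length s) Infinite" by (simp add: strict_transform_u_axis)
    then show ?thesis using axis_append_replicate(1)[of "node i" c "length s"] by (simp add: q Affine)
  next
    case Infinite
    have "blowup_chart d -` {0} = {x. x $ 2 = 0}" by (auto simp: Infinite vec_eq_iff forall_2)
    with s have "s = replicate (length s) (Affine 0)" by (simp add: strict_transform_w_axis)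
    then show ?thesis using axis_append_replicate(2)[of "node i" "length s"] by (simp add: q Infinite)
  qed
qed

lemma axis_prefix:
  "u_axis q = Some p \<Longrightarrow> \<exists>d s. q = p @ d # s" "w_axis q = Some p \<Longrightarrow> \<exists>d s. q = p @ d # s"
proof (induction q arbitrary: p rule: rev_induct)
  case (snoc d q)
  { case 1 with snoc show ?case by (cases d) fastforce+ next
    case 2 with snoc show ?case by (cases d) (fastforce split: if_splits)+ }
qed simp_all

lemma range_node_prefix:
  assumes "blowup_centres node" "p @ s \<in> range node" shows "p \<in> range node"
  using assms(2)
proof (induction s rule: rev_induct)
  case (snoc d s)
  then show ?case using assms(1) unfolding blowup_centres_def by (metis append_assoc)
qed simp

lemma exc_divisor_axis:
  assumes "blowup_centres node" "q \<in> exc_divisor node" "u_axis q = Some p \<or> w_axis q = Some p"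
  obtains i where "p = node i"
proof -
  obtain d s where q: "q = p @ d # s" using assms(3) axis_prefix by blast
  obtain p' d' where p': "q = p' @ [d']" "p' \<in> range node" using assms(2) by (auto simp: exc_divisor_def)
  have "p' = p @ butlast (d # s)" using q p'(1) by (metis butlast_append butlast_snoc list.discI)
  then have "p \<in> range node" using range_node_prefix[OF assms(1)] p'(2) by blast
  then show ?thesis using that by blast
qed

text \<open>Hurwitz's theorem: as \<open>h(0,w)\<close> has an isolated zero at \<open>w = 0\<close>, the nearby functions \<open>h(u,w)\<close> of
  \<open>w\<close> have zeros close to it.\<close>

lemma zeros_near_slice:
  fixes h :: "complex ^ 2 \<Rightarrow> complex"
  assumes h: "holo_germ h" "h 0 = 0" and nz: "\<exists>\<^sub>F w in nhds 0. h (vector [0, w]) \<noteq> 0" and e: "0 < e"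
  shows "\<forall>\<^sub>F u in nhds 0. \<exists>w. norm w < e \<and> h (vector [u, w]) = 0"
proof (rule ccontr)
  assume no: "\<not> ?thesis"
  obtain r where r: "0 < r" and d: "\<And>x. x \<in> ball 0 r \<Longrightarrow> cdiff_at h x"
    using holo_germ_ball[OF h(1)] by blast
  define s where "s = min e (r/2)"
  have s: "0 < s" "s \<le> e" "s \<le> r/2" using e r by (auto simp: s_def)
  have small: "vector [u, w] \<in> ball (0 :: complex ^ 2) r" if "norm u < s" "norm w < s" for u w
    using norm_vector_2_le[of u w] that s by auto
  have "\<exists>u. norm u < s / Suc n \<and> (\<forall>w. norm w < e \<longrightarrow> h (vector [u, w]) \<noteq> 0)" for n
  proof -
    have fr: "\<exists>\<^sub>F u in nhds 0. \<forall>w. norm w < e \<longrightarrow> h (vector [u, w]) \<noteq> 0"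
      using no by (simp add: not_eventually)
    have "\<forall>\<^sub>F u in nhds (0::complex). u \<in> ball 0 (s / Suc n)"
      using s by (intro eventually_nhds_in_open) auto
    from frequently_ex[OF frequently_eventually_conj[OF fr this]] show ?thesis by auto
  qed
  then have "\<forall>n. \<exists>u. norm u < s / Suc n \<and> (\<forall>w. norm w < e \<longrightarrow> h (vector [u, w]) \<noteq> 0)" by blast
  from choice[OF this] obtain u where
    u: "\<And>n. norm (u n) < s / Suc n" "\<And>n w. norm w < e \<Longrightarrow> h (vector [u n, w]) \<noteq> 0" by blast
  have us: "norm (u n) < s" for n
  proof -
    have "s * 1 \<le> s * real (Suc n)" using s(1) by (intro mult_left_mono) auto
    then have "s / Suc n \<le> s" by (simp add: divide_le_eq)
    with u(1)[of n] show ?thesis by linarith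
  qed
  have ulim: "u \<longlonglongrightarrow> 0"
  proof (rule Lim_null_comparison)
    show "\<forall>\<^sub>F n in sequentially. norm (u n) \<le> s * inverse (real (Suc n))"
      using u(1) by (auto simp: field_simps intro!: always_eventually less_imp_le)
    show "(\<lambda>n. s * inverse (real (Suc n))) \<longlonglongrightarrow> 0"
      using tendsto_mult_right_zero[OF LIMSEQ_inverse_real_of_nat] .
  qed
  have hol: "(\<lambda>w. h (vector [a, w])) holomorphic_on ball 0 s" if "norm a < s" for a
    unfolding holomorphic_on_def
  proof (rule ballI, rule field_differentiable_at_within, rule cdiff_at_compose_arc[where G = h])
    fix w :: complex assume "w \<in> ball 0 s"
    then show "cdiff_at h (vector [a, w])" using d small that by auto
    show "(\<lambda>t. (vector [a, t] :: complex ^ 2) $ i) field_differentiable at w" for i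
      using exhaust_2[of i] by (auto intro: derivative_intros)
  qed
  have "h (vector [0, 0]) \<noteq> 0"
  proof (rule Hurwitz_no_zeros[of "ball 0 s" "\<lambda>n w. h (vector [u n, w])" "\<lambda>w. h (vector [0, w])" 0])
    show "(\<lambda>w. h (vector [u n, w])) holomorphic_on ball 0 s" for n by (rule hol[OF us])
    show "(\<lambda>w. h (vector [0, w])) holomorphic_on ball 0 s" by (rule hol) (use s in simp)
    show "h (vector [u n, w]) \<noteq> 0" if "w \<in> ball 0 s" for n w using u(2)[of w n] that s by auto
    show "\<not> (\<lambda>w. h (vector [0, w])) constant_on ball 0 s"
    proof
      assume "(\<lambda>w. h (vector [0, w])) constant_on ball 0 s"
      then obtain c where c: "\<And>w. w \<in> ball 0 s \<Longrightarrow> h (vector [0, w]) = c" by (auto simp: constant_on_def)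
      from c[of 0] s h(2) have "c = 0" by simp
      have "\<forall>\<^sub>F w in nhds (0::complex). w \<in> ball 0 s" using s by (intro eventually_nhds_in_open) auto
      then have "\<forall>\<^sub>F w in nhds 0. h (vector [0, w]) = 0"
        by eventually_elim (use c \<open>c = 0\<close> in auto)
      with nz show False by (simp add: frequently_def)
    qed
    show "uniform_limit K (\<lambda>n w. h (vector [u n, w])) (\<lambda>w. h (vector [0, w])) sequentially"
      if K: "compact K" "K \<subseteq> ball 0 s" for K
    proof (rule uniform_limitI)
      fix \<epsilon> :: real assume \<epsilon>: "0 < \<epsilon>"
      have ch: "continuous_on (ball 0 r) h" by (intro cdiff_on_imp_continuous_on d)
      have "continuous_on (ball 0 s \<times> K) (\<lambda>p. h (vector [fst p, snd p]))"
        by (rule continuous_on_compose2[OF ch])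
           (use K small in \<open>auto intro!: continuous_intros simp: subset_iff\<close>)
      from continuous_on_prod_compactE[OF this K(1), of 0 "\<epsilon>/2"] obtain X where
        X: "0 \<in> X" "open X" "\<forall>a\<in>X \<inter> ball 0 s. \<forall>w\<in>K. dist (h (vector [a, w])) (h (vector [0, w])) \<le> \<epsilon>/2"
        using s \<epsilon> by auto
      have "\<forall>\<^sub>F n in sequentially. u n \<in> X" using ulim X by (auto simp: tendsto_def)
      then show "\<forall>\<^sub>F n in sequentially. \<forall>w\<in>K. dist (h (vector [u n, w])) (h (vector [0, w])) < \<epsilon>"
        by eventually_elim (use X(3) us \<epsilon> in force)
    qed
  qed (use s in auto)
  then show False using h(2) by simp
qed

text \<open>Zeros of \<open>h\<close> close to \<open>q\<close> lie on the total transform of the curve.  They can be chosen off the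
  exceptional components, since \<open>h\<close> does not vanish identically on these.\<close>

lemma residual_zero_imp_strict_curve_point:
  assumes q: "q \<in> exc_divisor node" and res: "residual_germ f q h m" and h0: "h 0 = 0"
  shows "q \<in> strict_curve_points node f"
proof -
  have h: "holo_germ h"
    and ev: "\<forall>\<^sub>F x in nhds 0. f (chart q x) = x $ 1 ^ axis_exponent (exc_mult f) (u_axis q) *
        x $ 2 ^ axis_exponent (exc_mult f) (w_axis q) * h x"
    and nzu: "u_axis q \<noteq> None \<Longrightarrow> \<exists>\<^sub>F w in nhds 0. h (vector [0, w]) \<noteq> 0"
    and nzw: "w_axis q \<noteq> None \<Longrightarrow> \<exists>\<^sub>F u in nhds 0. h (vector [u, 0]) \<noteq> 0"
    using res by (auto simp: residual_germ_def)
  have ne: "q \<noteq> []" using q by (auto simp: exc_divisor_def)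
  have "\<exists>\<^sub>F x in nhds 0. f (chart q x) = 0 \<and> chart q x \<noteq> 0"
  proof (rule ccontr)
    assume "\<not> ?thesis"
    then have "\<forall>\<^sub>F x in nhds 0. \<not> (f (chart q x) = 0 \<and> chart q x \<noteq> 0)" by (simp add: frequently_def)
    with ev chart_axes[OF ne] have "\<forall>\<^sub>F x in nhds 0. h x = 0 \<longrightarrow>
        (u_axis q \<noteq> None \<and> x $ 1 = 0) \<or> (w_axis q \<noteq> None \<and> x $ 2 = 0)"
      by eventually_elim auto
    then obtain e where e: "0 < e" "\<And>x. norm x < e \<Longrightarrow> h x = 0 \<Longrightarrow>
        (u_axis q \<noteq> None \<and> x $ 1 = 0) \<or> (w_axis q \<noteq> None \<and> x $ 2 = 0)"
      unfolding eventually_nhds_metric by auto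
    have on_axes: "(u_axis q \<noteq> None \<and> u = 0) \<or> (w_axis q \<noteq> None \<and> w = 0)"
      if "h (vector [u, w]) = 0" "norm u < e/2" "norm w < e/2" for u w
      using e(2)[OF _ that(1)] norm_vector_2_le[of u w] that(2,3) by auto
    have small: "\<forall>\<^sub>F u in nhds (0::complex). norm u < e/2"
      using e(1) eventually_nhds_in_open[of "ball (0::complex) (e/2)" 0] by simp
    have punct: "\<exists>\<^sub>F u in nhds (0::complex). u \<noteq> 0"
      by (rule ccontr) (use at_neq_bot[of "0::complex"] in \<open>auto simp: frequently_def eventually_at_filter trivial_limit_def elim: eventually_mono\<close>)
    show False
    proof (cases "u_axis q = None")
      case False
      have "\<exists>\<^sub>F u in nhds 0. u \<noteq> 0 \<and> (w_axis q \<noteq> None \<longrightarrow> h (vector [u, 0]) \<noteq> 0)"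
      proof (cases "w_axis q = None")
        case False
        show ?thesis by (rule frequently_elim1[OF nzw[OF False]]) (auto simp: h0)
      qed (use punct in simp)
      from frequently_ex[OF frequently_eventually_conj[OF this
          eventually_conj[OF small zeros_near_slice[OF h h0 nzu[OF False], of "e/2"]]]] e(1)
      obtain u w where "u \<noteq> 0" "w_axis q \<noteq> None \<longrightarrow> h (vector [u, 0]) \<noteq> 0" "norm u < e/2" "norm w < e/2"
        "h (vector [u, w]) = 0" by auto
      with on_axes show False by blast
    next
      case True
      have "w_axis q \<noteq> None" using True ne by (cases q rule: rev_cases; cases "last q") auto
      then have "\<exists>\<^sub>F w in nhds 0. h (swap2 (vector [0, w])) \<noteq> 0" using nzw by simp
      from zeros_near_slice[OF holo_germ_compose_swap[OF h] _ this, of "e/2"]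
      have "\<forall>\<^sub>F w in nhds 0. \<exists>u. norm u < e/2 \<and> h (vector [u, w]) = 0" using h0 e(1) by simp
      from frequently_ex[OF frequently_eventually_conj[OF punct eventually_conj[OF small this]]]
      obtain u w where "w \<noteq> 0" "norm w < e/2" "norm u < e/2" "h (vector [u, w]) = 0" by blast
      with on_axes True show False by blast
    qed
  qed
  then show ?thesis using q by (simp add: strict_curve_points_def strict_transform_frequently)
qed

section \<open>Lifting arcs\<close>

lemma analytic_order_decomposition:
  assumes "e analytic_on {0}" "\<not> (\<forall>\<^sub>F t in nhds 0. e t = 0)"
  obtains n k where "k analytic_on {0}" "k 0 \<noteq> 0" "\<forall>\<^sub>F t in nhds 0. e t = t ^ n * k t"
proof -
  obtain r where r: "0 < r" "e holomorphic_on ball 0 r" using assms(1) by (auto simp: analytic_on_def)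
  have "\<exists>w\<in>ball 0 r. e w \<noteq> 0"
  proof (rule ccontr)
    assume no: "\<not> ?thesis"
    have "\<forall>\<^sub>F t in nhds (0::complex). t \<in> ball 0 r" using r by (intro eventually_nhds_in_open) auto
    then have "\<forall>\<^sub>F t in nhds 0. e t = 0" by eventually_elim (use no in blast)
    with assms(2) show False by simp
  qed
  have z: "0 \<in> ball (0::complex) r" using r by simp
  obtain s where s: "0 < s" "zor_poly e 0 holomorphic_on cball 0 s"
      "\<forall>w\<in>cball 0 s. e w = zor_poly e 0 w * (w - 0) ^ nat (zorder e 0) \<and> zor_poly e 0 w \<noteq> 0"
    using zorder_exist_zero[OF r(2) open_ball connected_ball z \<open>\<exists>w\<in>ball 0 r. e w \<noteq> 0\<close>, THEN conjunct2] by blast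
  have "zor_poly e 0 analytic_on {0}"
    unfolding analytic_on_def using s(1) holomorphic_on_subset[OF s(2) ball_subset_cball] by blast
  moreover have "zor_poly e 0 0 \<noteq> 0" using s(1,3) by simp
  moreover have "\<forall>\<^sub>F t in nhds (0::complex). t \<in> ball 0 s" using s by (intro eventually_nhds_in_open) auto
  then have "\<forall>\<^sub>F t in nhds 0. e t = t ^ nat (zorder e 0) * zor_poly e 0 t"
    by eventually_elim (use s(3) in \<open>auto simp: mult.commute\<close>)
  ultimately show ?thesis by (rule that)
qed

lemma analytic_vector_2:
  "a analytic_on {0} \<Longrightarrow> b analytic_on {0} \<Longrightarrow> (\<lambda>t. (vector [a t, b t] :: complex ^ 2) $ i) analytic_on {0}"
  using exhaust_2[of i] by auto

lemma analytic_quotient_exists: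
  assumes "a analytic_on {0}" "b analytic_on {0}" "\<not> (\<forall>\<^sub>F t in nhds 0. a t = 0) \<or> \<not> (\<forall>\<^sub>F t in nhds 0. b t = 0)"
  shows "(\<exists>\<eta>. \<eta> analytic_on {0} \<and> (\<forall>\<^sub>F t in nhds 0. b t = a t * \<eta> t)) \<or>
    (\<exists>\<eta>. \<eta> analytic_on {0} \<and> \<eta> 0 = 0 \<and> (\<forall>\<^sub>F t in nhds 0. a t = b t * \<eta> t))"
proof (cases "(\<forall>\<^sub>F t in nhds 0. a t = 0) \<or> (\<forall>\<^sub>F t in nhds 0. b t = 0)")
  case True
  then show ?thesis by (auto intro!: exI[of _ "\<lambda>_. 0"])
next
  case False
  obtain n k where k: "k analytic_on {0}" "k 0 \<noteq> 0" "\<forall>\<^sub>F t in nhds 0. a t = t ^ n * k t"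
    using analytic_order_decomposition[OF assms(1)] False by blast
  obtain m l where l: "l analytic_on {0}" "l 0 \<noteq> 0" "\<forall>\<^sub>F t in nhds 0. b t = t ^ m * l t"
    using analytic_order_decomposition[OF assms(2)] False by blast
  have nz: "\<forall>\<^sub>F t in nhds 0. k t \<noteq> 0" "\<forall>\<^sub>F t in nhds 0. l t \<noteq> 0"
    using k l analytic_at_imp_isCont tendsto_at_iff_tendsto_nhds
    by (auto intro!: tendsto_imp_eventually_ne simp: isCont_def)
  show ?thesis
  proof (cases "n \<le> m")
    case True
    then obtain d where d: "m = n + d" by (metis le_Suc_ex)
    have "(\<lambda>t. t ^ d * (l t / k t)) analytic_on {0}" using k l by (intro analytic_intros) auto
    moreover have "\<forall>\<^sub>F t in nhds 0. b t = a t * (t ^ d * (l t / k t))"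
      using k(3) l(3) nz(1) by eventually_elim (simp add: d power_add)
    ultimately show ?thesis by blast
  next
    case False
    then obtain d where d: "n = m + Suc d" by (metis add_Suc_right less_imp_Suc_add not_le)
    have "(\<lambda>t. t ^ Suc d * (k t / l t)) analytic_on {0}" using k l by (intro analytic_intros) auto
    moreover have "\<forall>\<^sub>F t in nhds 0. a t = b t * (t ^ Suc d * (k t / l t))"
      using k(3) l(3) nz(2) by eventually_elim (simp add: d power_add)
    ultimately show ?thesis by (intro disjI2 exI[of _ "\<lambda>t. t ^ Suc d * (k t / l t)"]) auto
  qed
qed

text \<open>The arc has a tangent direction, the limit of the quotient of its coordinates, and lifts to the
  blow-up at the corresponding point.\<close>

lemma arc_lift_step:
  fixes \<phi> :: "complex \<Rightarrow> complex ^ 2"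
  assumes "arc_on UNIV \<phi>" "\<not> (\<forall>\<^sub>F t in nhds 0. \<phi> t = 0)"
  obtains d \<psi> where "arc_on UNIV \<psi>" "\<forall>\<^sub>F t in nhds 0. \<phi> t = blowup_chart d (\<psi> t)"
proof -
  define a where "a = (\<lambda>t. \<phi> t $ 1)"
  define b where "b = (\<lambda>t. \<phi> t $ 2)"
  have ab: "a analytic_on {0}" "b analytic_on {0}" "a 0 = 0" "b 0 = 0"
    using assms(1) by (auto simp: arc_on_def a_def b_def)
  have "\<not> (\<forall>\<^sub>F t in nhds 0. a t = 0) \<or> \<not> (\<forall>\<^sub>F t in nhds 0. b t = 0)"
    using assms(2) eventually_conj[of "\<lambda>t. a t = 0" _ "\<lambda>t. b t = 0"]
    by (auto simp: a_def b_def vec_eq_iff forall_2)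
  from analytic_quotient_exists[OF ab(1,2) this] show ?thesis
  proof (elim disjE exE conjE)
    fix \<eta> assume \<eta>: "\<eta> analytic_on {0}" "\<forall>\<^sub>F t in nhds 0. b t = a t * \<eta> t"
    show ?thesis
    proof (rule that)
      show "arc_on UNIV (\<lambda>t. vector [a t, \<eta> t - \<eta> 0] :: complex ^ 2)"
        unfolding arc_on_def using ab \<eta>(1) by (auto intro!: analytic_vector_2 analytic_intros)
      show "\<forall>\<^sub>F t in nhds 0. \<phi> t = blowup_chart (Affine (\<eta> 0)) (vector [a t, \<eta> t - \<eta> 0])"
        using \<eta>(2) by eventually_elim (simp add: vec_eq_iff forall_2 a_def b_def)
    qed
  next
    fix \<eta> assume \<eta>: "\<eta> analytic_on {0}" "\<eta> 0 = 0" "\<forall>\<^sub>F t in nhds 0. a t = b t * \<eta> t"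
    show ?thesis
    proof (rule that)
      show "arc_on UNIV (\<lambda>t. vector [\<eta> t, b t] :: complex ^ 2)"
        unfolding arc_on_def using ab \<eta>(1,2) by (auto intro!: analytic_vector_2 analytic_intros)
      show "\<forall>\<^sub>F t in nhds 0. \<phi> t = blowup_chart Infinite (vector [\<eta> t, b t])"
        using \<eta>(3) by eventually_elim (simp add: vec_eq_iff forall_2 a_def b_def mult.commute)
    qed
  qed
qed

lemma arc_filterlim:
  assumes "arc_on V \<phi>" shows "filterlim \<phi> (nhds 0) (nhds 0)"
proof (rule vec_tendstoI)
  fix i
  have "isCont (\<lambda>t. \<phi> t $ i) 0" "\<phi> 0 = 0" using assms by (auto simp: arc_on_def analytic_at_imp_isCont)
  then show "((\<lambda>t. \<phi> t $ i) \<longlongrightarrow> 0 $ i) (nhds 0)"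
    using tendsto_at_iff_tendsto_nhds[of "\<lambda>t. \<phi> t $ i" 0] by (simp add: isCont_def)
qed

text \<open>The lifting goes on as long as the current point is a centre.  Since there are finitely many
  centres and the lists get longer, it stops at a point of the exceptional divisor.\<close>

lemma arc_lift:
  fixes node :: "'r::finite \<Rightarrow> near_point" and \<phi> :: "complex \<Rightarrow> complex ^ 2"
  assumes node: "blowup_centres node" and \<phi>: "arc_on UNIV \<phi>" "\<not> (\<forall>\<^sub>F t in nhds 0. \<phi> t = 0)"
  obtains q \<psi> where "q \<in> exc_divisor node" "arc_on UNIV \<psi>" "\<forall>\<^sub>F t in nhds 0. \<phi> t = chart q (\<psi> t)"
proof -
  define L where "L = (\<lambda>q. \<exists>\<psi>. arc_on UNIV \<psi> \<and> (\<forall>\<^sub>F t in nhds 0. \<phi> t = chart q (\<psi> t)))"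
  have "\<exists>q\<in>exc_divisor node. L q"
  proof (rule ccontr)
    assume no: "\<not> ?thesis"
    have "\<exists>q\<in>range node. length q = n \<and> L q" for n
    proof (induction n)
      case 0
      have "L []" using \<phi>(1) by (auto simp: L_def)
      then show ?case using node by (auto simp: blowup_centres_def)
    next
      case (Suc n)
      then obtain q \<psi> where q: "q \<in> range node" "length q = n" and
        \<psi>: "arc_on UNIV \<psi>" "\<forall>\<^sub>F t in nhds 0. \<phi> t = chart q (\<psi> t)"
        by (auto simp: L_def)
      have "\<not> (\<forall>\<^sub>F t in nhds 0. \<psi> t = 0)"
      proof
        assume "\<forall>\<^sub>F t in nhds 0. \<psi> t = 0"
        with \<psi>(2) have "\<forall>\<^sub>F t in nhds 0. \<phi> t = 0" by eventually_elim simp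
        with \<phi>(2) show False ..
      qed
      from arc_lift_step[OF \<psi>(1) this] obtain d \<psi>' where
        \<psi>': "arc_on UNIV \<psi>'" "\<forall>\<^sub>F t in nhds 0. \<psi> t = blowup_chart d (\<psi>' t)" by blast
      have "\<forall>\<^sub>F t in nhds 0. \<phi> t = chart (q @ [d]) (\<psi>' t)"
        using \<psi>(2) \<psi>'(2) by eventually_elim (simp add: chart_append)
      then have "L (q @ [d])" using \<psi>'(1) by (auto simp: L_def)
      moreover from this have "q @ [d] \<in> range node"
        using no q(1) by (auto simp: exc_divisor_def)
      ultimately show ?case using q(2) by (intro bexI[of _ "q @ [d]"]) auto
    qed
    then have "(UNIV :: nat set) \<subseteq> length ` range node" by (metis (no_types) image_eqI subsetI)
    then show False using infinite_UNIV_nat by (meson finite finite_imageI finite_subset)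
  qed
  then show ?thesis using that by (auto simp: L_def)
qed

section \<open>Orders along arcs\<close>

definition vanishes_to :: "nat \<Rightarrow> (complex \<Rightarrow> complex) \<Rightarrow> bool" where
  "vanishes_to k e \<longleftrightarrow> (\<exists>d. d analytic_on {0} \<and> (\<forall>\<^sub>F t in nhds 0. e t = t ^ k * d t))"

definition exact_order :: "nat \<Rightarrow> (complex \<Rightarrow> complex) \<Rightarrow> bool" where
  "exact_order k e \<longleftrightarrow> (\<exists>d. d analytic_on {0} \<and> d 0 \<noteq> 0 \<and> (\<forall>\<^sub>F t in nhds 0. e t = t ^ k * d t))"

lemma exact_order_imp_vanishes_to: "exact_order k e \<Longrightarrow> vanishes_to k e"
  by (auto simp: exact_order_def vanishes_to_def)

lemma analytic_imp_vanishes_to_0: "e analytic_on {0} \<Longrightarrow> vanishes_to 0 e"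
  by (auto simp: vanishes_to_def)

lemma vanishes_to_zero: "\<forall>\<^sub>F t in nhds 0. e t = 0 \<Longrightarrow> vanishes_to k e"
  unfolding vanishes_to_def by (intro exI[of _ "\<lambda>_. 0"]) auto

lemma vanishes_to_cong: "\<forall>\<^sub>F t in nhds 0. e t = e' t \<Longrightarrow> vanishes_to k e' \<Longrightarrow> vanishes_to k e"
proof -
  assume ev: "\<forall>\<^sub>F t in nhds 0. e t = e' t" and "vanishes_to k e'"
  then obtain d where d: "d analytic_on {0}" "\<forall>\<^sub>F t in nhds 0. e' t = t ^ k * d t"
    by (auto simp: vanishes_to_def)
  have "\<forall>\<^sub>F t in nhds 0. e t = t ^ k * d t" using ev d(2) by eventually_elim simp
  with d show ?thesis unfolding vanishes_to_def by blast
qed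

lemma exact_order_cong: "\<forall>\<^sub>F t in nhds 0. e t = e' t \<Longrightarrow> exact_order k e' \<Longrightarrow> exact_order k e"
proof -
  assume ev: "\<forall>\<^sub>F t in nhds 0. e t = e' t" and "exact_order k e'"
  then obtain d where d: "d analytic_on {0}" "d 0 \<noteq> 0" "\<forall>\<^sub>F t in nhds 0. e' t = t ^ k * d t"
    by (auto simp: exact_order_def)
  have "\<forall>\<^sub>F t in nhds 0. e t = t ^ k * d t" using ev d(3) by eventually_elim simp
  with d show ?thesis unfolding exact_order_def by blast
qed

lemma vanishes_to_add:
  assumes "vanishes_to k e" "vanishes_to k e'" shows "vanishes_to k (\<lambda>t. e t + e' t)"
proof -
  obtain d d' where d: "d analytic_on {0}" "\<forall>\<^sub>F t in nhds 0. e t = t ^ k * d t"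
      "d' analytic_on {0}" "\<forall>\<^sub>F t in nhds 0. e' t = t ^ k * d' t"
    using assms by (auto simp: vanishes_to_def)
  have "\<forall>\<^sub>F t in nhds 0. e t + e' t = t ^ k * (d t + d' t)"
    using d(2,4) by eventually_elim (simp add: algebra_simps)
  moreover have "(\<lambda>t. d t + d' t) analytic_on {0}" by (intro analytic_intros d)
  ultimately show ?thesis unfolding vanishes_to_def by blast
qed

lemma vanishes_to_mult:
  assumes "vanishes_to k e" "vanishes_to l e'" shows "vanishes_to (k + l) (\<lambda>t. e t * e' t)"
proof -
  obtain d d' where d: "d analytic_on {0}" "\<forall>\<^sub>F t in nhds 0. e t = t ^ k * d t"
      "d' analytic_on {0}" "\<forall>\<^sub>F t in nhds 0. e' t = t ^ l * d' t"
    using assms by (auto simp: vanishes_to_def)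
  have "\<forall>\<^sub>F t in nhds 0. e t * e' t = t ^ (k + l) * (d t * d' t)"
    using d(2,4) by eventually_elim (simp add: power_add)
  moreover have "(\<lambda>t. d t * d' t) analytic_on {0}" by (intro analytic_intros d)
  ultimately show ?thesis unfolding vanishes_to_def by blast
qed

lemma exact_order_mult:
  assumes "exact_order k e" "exact_order l e'" shows "exact_order (k + l) (\<lambda>t. e t * e' t)"
proof -
  obtain d d' where d: "d analytic_on {0}" "\<forall>\<^sub>F t in nhds 0. e t = t ^ k * d t" "d 0 \<noteq> 0"
      "d' analytic_on {0}" "\<forall>\<^sub>F t in nhds 0. e' t = t ^ l * d' t" "d' 0 \<noteq> 0"
    using assms by (auto simp: exact_order_def)
  have "\<forall>\<^sub>F t in nhds 0. e t * e' t = t ^ (k + l) * (d t * d' t)"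
    using d(2,5) by eventually_elim (simp add: power_add)
  moreover have "(\<lambda>t. d t * d' t) analytic_on {0}" "d 0 * d' 0 \<noteq> 0" using d by (auto intro: analytic_intros)
  ultimately show ?thesis unfolding exact_order_def by blast
qed

lemma vanishes_to_power: "vanishes_to k e \<Longrightarrow> vanishes_to (n * k) (\<lambda>t. e t ^ n)"
  by (induction n) (auto intro: analytic_imp_vanishes_to_0 vanishes_to_mult)

lemma exact_order_0: "e analytic_on {0} \<Longrightarrow> e 0 \<noteq> 0 \<Longrightarrow> exact_order 0 e"
  unfolding exact_order_def by (intro exI[of _ e]) auto

lemma exact_order_power: "exact_order k e \<Longrightarrow> exact_order (n * k) (\<lambda>t. e t ^ n)"
  by (induction n) (auto intro: exact_order_0 exact_order_mult)

lemma vanishes_to_mono: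
  assumes "vanishes_to l e" "k \<le> l" shows "vanishes_to k e"
proof -
  obtain d where d: "d analytic_on {0}" "\<forall>\<^sub>F t in nhds 0. e t = t ^ l * d t"
    using assms by (auto simp: vanishes_to_def)
  obtain j where j: "l = k + j" using assms(2) le_Suc_ex by blast
  have "\<forall>\<^sub>F t in nhds 0. e t = t ^ k * (t ^ j * d t)"
    using d(2) by eventually_elim (simp add: j power_add)
  moreover have "(\<lambda>t. t ^ j * d t) analytic_on {0}" by (intro analytic_intros d)
  ultimately show ?thesis unfolding vanishes_to_def by blast
qed

lemma vanishes_to_le_exact_order:
  assumes "vanishes_to k e" "exact_order n e" shows "k \<le> n"
proof -
  obtain d d' where d: "d analytic_on {0}" "\<forall>\<^sub>F t in nhds 0. e t = t ^ k * d t"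
      "d' analytic_on {0}" "\<forall>\<^sub>F t in nhds 0. e t = t ^ n * d' t" "d' 0 \<noteq> 0"
    using assms by (auto simp: vanishes_to_def exact_order_def)
  have "\<forall>\<^sub>F t in at 0. t ^ k * d t = t ^ n * d' t"
    using eventually_conj[OF d(2,4)] by (auto simp: eventually_at_filter elim: eventually_mono)
  then show ?thesis
    by (rule power_order_le) (use d in \<open>auto intro: analytic_at_imp_isCont\<close>)
qed

lemma exact_order_exists:
  assumes "e analytic_on {0}" "\<not> (\<forall>\<^sub>F t in nhds 0. e t = 0)" obtains n where "exact_order n e"
  using analytic_order_decomposition[OF assms] unfolding exact_order_def by blast

lemma vanishes_to_sqrt:
  assumes "z analytic_on {0}" "vanishes_to (2 * k) (\<lambda>t. (z t)\<^sup>2)" shows "vanishes_to k z"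
proof (cases "\<forall>\<^sub>F t in nhds 0. z t = 0")
  case True
  then show ?thesis by (rule vanishes_to_zero)
next
  case False
  obtain n where n: "exact_order n z" using exact_order_exists[OF assms(1) False] by blast
  from exact_order_power[OF this, of 2] have "2 * k \<le> 2 * n"
    by (rule vanishes_to_le_exact_order[OF assms(2)])
  then show ?thesis using exact_order_imp_vanishes_to[OF n] by (auto intro: vanishes_to_mono)
qed

lemma order_at_0_cong:
  assumes "\<forall>\<^sub>F t in nhds 0. e t = e' t" shows "order_at_0 e = order_at_0 e'"
proof -
  have "(\<forall>\<^sub>F t in nhds 0. e t = 0) \<longleftrightarrow> (\<forall>\<^sub>F t in nhds 0. e' t = 0)"
    by (rule eventually_subst) (use assms in \<open>auto elim: eventually_mono\<close>)
  moreover have "zorder e 0 = zorder e' 0"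
    by (rule zorder_cong) (use assms in \<open>auto simp: eventually_at_filter elim: eventually_mono\<close>)
  ultimately show ?thesis by (simp add: order_at_0_def)
qed

lemma exact_order_imp_order_at_0:
  assumes "exact_order n e" shows "order_at_0 e = enat n"
proof -
  obtain d where d: "d analytic_on {0}" "d 0 \<noteq> 0" "\<forall>\<^sub>F t in nhds 0. e t = t ^ n * d t"
    using assms by (auto simp: exact_order_def)
  obtain U where U: "open U" "0 \<in> U" "d holomorphic_on U" using d(1) by (auto simp: analytic_at)
  obtain V where V: "open V" "0 \<in> V" "\<And>t. t \<in> V \<Longrightarrow> e t = t ^ n * d t" using d(3) by (auto simp: eventually_nhds)
  have "zorder e 0 = int n"
    by (rule zorder_eqI[of "U \<inter> V" _ d]) (use U V d(2) in \<open>auto intro: holomorphic_on_subset simp: power_int_def\<close>)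
  moreover have "\<not> (\<forall>\<^sub>F t in nhds 0. e t = 0)"
  proof
    assume "\<forall>\<^sub>F t in nhds 0. e t = 0"
    from vanishes_to_le_exact_order[OF vanishes_to_zero[OF this, of "Suc n"] assms] show False by simp
  qed
  ultimately show ?thesis by (simp add: order_at_0_def)
qed

lemma le_order_at_0_iff:
  assumes "e analytic_on {0}" shows "enat k \<le> order_at_0 e \<longleftrightarrow> vanishes_to k e"
proof (cases "\<forall>\<^sub>F t in nhds 0. e t = 0")
  case True
  then show ?thesis by (simp add: order_at_0_def vanishes_to_zero)
next
  case False
  obtain n where n: "exact_order n e" using exact_order_exists[OF assms False] by blast
  show ?thesis
    using exact_order_imp_order_at_0[OF n] vanishes_to_le_exact_order[OF _ n]
      vanishes_to_mono[OF exact_order_imp_vanishes_to[OF n]] by auto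
qed

lemma analytic_atI:
  assumes "\<forall>\<^sub>F t in nhds 0. e field_differentiable at t" shows "e analytic_on {0 :: complex}"
proof -
  obtain U where "open U" "0 \<in> U" "\<And>t. t \<in> U \<Longrightarrow> e field_differentiable at t"
    using assms by (auto simp: eventually_nhds)
  then show ?thesis unfolding analytic_at holomorphic_on_def
    by (intro exI[of _ U]) (auto intro: field_differentiable_at_within)
qed

lemma analytic_at_imp_eventually:
  assumes "e analytic_on {0 :: complex}" shows "\<forall>\<^sub>F t in nhds 0. e field_differentiable at t"
proof -
  obtain U where U: "open U" "0 \<in> U" "e holomorphic_on U" using assms by (auto simp: analytic_at)
  then show ?thesis unfolding eventually_nhds
    by (intro exI[of _ U]) (auto intro: holomorphic_on_imp_differentiable_at)
qed

lemma analytic_compose_arc: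
  assumes "arc_on V \<phi>" "holo_germ G" shows "(\<lambda>t. G (\<phi> t)) analytic_on {0}"
proof (rule analytic_atI)
  have "\<forall>\<^sub>F t in nhds 0. \<forall>i. (\<lambda>t. \<phi> t $ i) field_differentiable at t"
    using assms(1) by (intro eventually_all_finite analytic_at_imp_eventually) (simp add: arc_on_def)
  moreover have "\<forall>\<^sub>F t in nhds 0. cdiff_at G (\<phi> t)"
    using assms(2) arc_filterlim[OF assms(1)] unfolding holo_germ_iff_cdiff by (rule eventually_compose_filterlim)
  ultimately show "\<forall>\<^sub>F t in nhds 0. (\<lambda>t. G (\<phi> t)) field_differentiable at t"
    by eventually_elim (auto intro: cdiff_at_compose_arc)
qed

section \<open>A generic arc through an exceptional component\<close>

text \<open>If \<open>h\<close> vanished on \<open>u = 0\<close>, one more factor \<open>u\<close> could be split off.\<close>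

lemma exc_val_leading_germ:
  assumes g: "holo_germ g" and nz: "\<exists>\<^sub>F x in nhds 0. g x \<noteq> 0"
  obtains h where "holo_germ h" "\<forall>\<^sub>F x in nhds 0. g (chart (p @ [Affine 0]) x) = x $ 1 ^ exc_mult g p * h x"
    "\<forall>\<^sub>F w in at 0. h (vector [0, w]) \<noteq> 0"
proof -
  have val: "exc_val p g = enat (exc_mult g p)" by (rule exc_val_eq_exc_mult[OF g nz])
  obtain h where h: "holo_germ h" "\<forall>\<^sub>F x in nhds 0. g (chart (p @ [Affine 0]) x) = x $ 1 ^ exc_mult g p * h x"
    using le_exc_val_iff[OF g, of "exc_mult g p" p] val by auto
  have nz': "\<not> (\<forall>\<^sub>F w in nhds 0. h (vector [0, w]) = 0)"
  proof
    assume "\<forall>\<^sub>F w in nhds 0. h (vector [0, w]) = 0"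
    moreover have "((\<lambda>x. x $ 2) \<longlongrightarrow> (0 :: complex ^ 2) $ 2) (nhds (0 :: complex ^ 2))"
      by (intro tendsto_vec_nth tendsto_ident_nhds)
    ultimately have z: "\<forall>\<^sub>F x :: complex ^ 2 in nhds 0. h (vector [0, x $ 2]) = 0"
      by (intro eventually_compose_filterlim[where F = "nhds 0" and G = "nhds 0" and f = "\<lambda>x :: complex ^ 2. x $ 2"]) auto
    obtain H where H: "holo_germ H" "\<forall>\<^sub>F x in nhds 0. h x = h (vector [0, x $ 2]) + x $ 1 * H x"
      using holo_germ_divide_u[OF h(1)] by blast
    have "\<forall>\<^sub>F x in nhds 0. g (chart (p @ [Affine 0]) x) = x $ 1 ^ Suc (exc_mult g p) * H x"
      using h(2) z H(2) by eventually_elim simp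
    then have "enat (Suc (exc_mult g p)) \<le> exc_val p g" using le_exc_val_iff[OF g] H(1) by blast
    then show False by (simp add: val)
  qed
  have "arc_on UNIV (\<lambda>w. vector [0, w] :: complex ^ 2)"
    unfolding arc_on_def by (auto intro!: analytic_vector_2 analytic_intros)
  from analytic_order_decomposition[OF analytic_compose_arc[OF this h(1)] nz'] obtain n k where
    k: "k analytic_on {0}" "k 0 \<noteq> 0" "\<forall>\<^sub>F w in nhds 0. h (vector [0, w]) = w ^ n * k w" by blast
  have "\<forall>\<^sub>F w in nhds 0. k w \<noteq> 0"
    using k(1,2) analytic_at_imp_isCont tendsto_at_iff_tendsto_nhds[of k 0]
    by (auto intro!: tendsto_imp_eventually_ne simp: isCont_def)
  with k(3) have "\<forall>\<^sub>F w in nhds 0. w \<noteq> 0 \<longrightarrow> h (vector [0, w]) \<noteq> 0" by eventually_elim simp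
  then have "\<forall>\<^sub>F w in at 0. h (vector [0, w]) \<noteq> 0" by (simp add: eventually_at_filter)
  with h show ?thesis using that by blast
qed

lemma cdiff_at_chart: "cdiff_at (\<lambda>x. chart q x $ i) x"
proof (induction q arbitrary: i x)
  case (Cons d q)
  have "cdiff_at (\<lambda>x. blowup_chart d x $ i) y" for y
    using exhaust_2[of i] by (cases d) (auto intro!: cdiff_at_mult cdiff_at_add)
  from cdiff_at_compose[where G = "\<lambda>x. blowup_chart d x $ i", OF Cons this] show ?case by simp
qed simp

text \<open>The quotient \<open>e / e(0)\<close> takes values near \<open>1\<close>, away from the cut of the logarithm.\<close>

lemma analytic_sqrt_exists:
  assumes "e analytic_on {0}" "e 0 \<noteq> (0::complex)"
  obtains s where "s analytic_on {0}" "s 0 \<noteq> 0" "\<forall>\<^sub>F t in nhds 0. (s t)\<^sup>2 = e t"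
proof -
  define s where "s = (\<lambda>t. csqrt (e 0) * exp (Ln (e t / e 0) / 2))"
  have "(\<lambda>t. e t / e 0) analytic_on {0}" by (intro analytic_intros assms)
  then have L: "(\<lambda>t. Ln (e t / e 0)) analytic_on {0}" by (rule analytic_on_ln) (simp add: assms(2))
  have "(\<lambda>t. exp (Ln (e t / e 0) / 2)) analytic_on {0}"
  proof -
    have "(\<lambda>t. Ln (e t / e 0) / 2) analytic_on {0}"
      by (rule analytic_on_divide[OF L analytic_on_const]) simp
    moreover have "exp analytic_on (UNIV :: complex set)"
      by (simp add: analytic_on_open holomorphic_on_exp)
    then have "exp analytic_on ((\<lambda>t. Ln (e t / e 0) / 2) ` {0})" by (rule analytic_on_subset) simp
    ultimately show ?thesis using analytic_on_compose unfolding o_def by blast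
  qed
  then have "s analytic_on {0}" unfolding s_def by (intro analytic_on_mult analytic_on_const)
  moreover have "s 0 \<noteq> 0" using assms(2) by (simp add: s_def)
  moreover have "\<forall>\<^sub>F t in nhds 0. e t \<noteq> 0"
    using assms analytic_at_imp_isCont tendsto_at_iff_tendsto_nhds[of e 0]
    by (auto intro!: tendsto_imp_eventually_ne simp: isCont_def)
  then have "\<forall>\<^sub>F t in nhds 0. (s t)\<^sup>2 = e t"
  proof eventually_elim
    case (elim t)
    have "(s t)\<^sup>2 = e 0 * exp (Ln (e t / e 0))"
      by (simp add: s_def power_mult_distrib flip: exp_double)
    with elim assms(2) show ?case by (simp add: exp_Ln)
  qed
  ultimately show ?thesis by (rule that)
qed

text \<open>The arc is \<open>t \<mapsto> (t\<^bsup>s\<^esup>, c)\<close> in the coordinates at \<open>[1 : 0]\<close>, with a small \<open>c\<close> at which neither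
  of the strict transforms of \<open>f\<close> and \<open>g\<close> meets the exceptional curve.  Then \<open>f\<close> has the even order
  \<open>s m\<close> on it, and the remaining unit has a square root.\<close>

lemma generic_arc:
  assumes f: "holo_germ f" "\<exists>\<^sub>F x in nhds 0. f x \<noteq> 0" and g: "holo_germ g" "\<exists>\<^sub>F x in nhds 0. g x \<noteq> 0"
    and s: "0 < s" "even (s * exc_mult f p)"
  obtains \<alpha> \<zeta> where "arc_on UNIV \<alpha>" "\<zeta> analytic_on {0}" "\<forall>\<^sub>F t in nhds 0. (\<zeta> t)\<^sup>2 = f (\<alpha> t)"
    "exact_order (s * exc_mult g p) (\<lambda>t. g (\<alpha> t))" "exact_order (s * exc_mult f p div 2) \<zeta>"
proof -
  let ?q = "p @ [Affine 0]"
  obtain hf where hf: "holo_germ hf" "\<forall>\<^sub>F x in nhds 0. f (chart ?q x) = x $ 1 ^ exc_mult f p * hf x"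
    "\<forall>\<^sub>F w in at 0. hf (vector [0, w]) \<noteq> 0" by (rule exc_val_leading_germ[OF f])
  obtain hg where hg: "holo_germ hg" "\<forall>\<^sub>F x in nhds 0. g (chart ?q x) = x $ 1 ^ exc_mult g p * hg x"
    "\<forall>\<^sub>F w in at 0. hg (vector [0, w]) \<noteq> 0" by (rule exc_val_leading_germ[OF g])
  have "\<forall>\<^sub>F y in nhds 0. (\<forall>\<^sub>F x in nhds y. f (chart ?q x) = x $ 1 ^ exc_mult f p * hf x \<and>
      g (chart ?q x) = x $ 1 ^ exc_mult g p * hg x \<and> cdiff_at hf x \<and> cdiff_at hg x)"
    using hf(1,2) hg(1,2) unfolding holo_germ_iff_cdiff by (simp add: eventually_eventually eventually_conj_iff)
  from eventually_slice_0w[OF this]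
  have "\<forall>\<^sub>F w in at 0. (\<forall>\<^sub>F x in nhds (vector [0, w]). f (chart ?q x) = x $ 1 ^ exc_mult f p * hf x \<and>
      g (chart ?q x) = x $ 1 ^ exc_mult g p * hg x \<and> cdiff_at hf x \<and> cdiff_at hg x)"
    by (auto simp: eventually_at_filter elim: eventually_mono)
  from eventually_happens'[OF _ eventually_conj[OF this eventually_conj[OF hf(3) hg(3)]]] obtain c where
    c: "\<forall>\<^sub>F x in nhds (vector [0, c]). f (chart ?q x) = x $ 1 ^ exc_mult f p * hf x \<and>
      g (chart ?q x) = x $ 1 ^ exc_mult g p * hg x \<and> cdiff_at hf x \<and> cdiff_at hg x"
      "hf (vector [0, c]) \<noteq> 0" "hg (vector [0, c]) \<noteq> 0" by auto
  define \<beta> where "\<beta> = (\<lambda>t. vector [t ^ s, c] :: complex ^ 2)"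
  have \<beta>_diff: "(\<lambda>t. \<beta> t $ i) field_differentiable at t" for i t
    using exhaust_2[of i] unfolding \<beta>_def by (auto intro!: derivative_intros)
  have \<beta>0: "\<beta> 0 = vector [0, c]" using s(1) by (simp add: \<beta>_def zero_power)
  have \<beta>_lim: "filterlim \<beta> (nhds (vector [0, c])) (nhds 0)"
  proof (rule vec_tendstoI)
    fix i
    have "isCont (\<lambda>t. \<beta> t $ i) 0" using \<beta>_diff field_differentiable_imp_continuous_at by blast
    then show "((\<lambda>t. \<beta> t $ i) \<longlongrightarrow> (vector [0, c] :: complex ^ 2) $ i) (nhds 0)"
      using tendsto_at_iff_tendsto_nhds[of "\<lambda>t. \<beta> t $ i" 0] by (simp add: isCont_def \<beta>0)
  qed
  define \<alpha> where "\<alpha> = (\<lambda>t. chart ?q (\<beta> t))"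
  have "blowup_chart (Affine 0) (vector [0, c]) = 0" by (simp add: vec_eq_iff forall_2)
  then have "\<alpha> 0 = 0" by (simp add: \<alpha>_def \<beta>0 chart_append)
  moreover have "(\<lambda>t. \<alpha> t $ i) analytic_on {0}" for i
    unfolding \<alpha>_def
    by (intro analytic_atI always_eventually allI
        cdiff_at_compose_arc[where G = "\<lambda>x. chart ?q x $ i" and \<phi> = \<beta>] \<beta>_diff cdiff_at_chart)
  ultimately have \<alpha>: "arc_on UNIV \<alpha>" by (simp add: arc_on_def)
  have ev: "\<forall>\<^sub>F t in nhds 0. f (\<alpha> t) = (t ^ s) ^ exc_mult f p * hf (\<beta> t) \<and>
      g (\<alpha> t) = (t ^ s) ^ exc_mult g p * hg (\<beta> t) \<and> cdiff_at hf (\<beta> t) \<and> cdiff_at hg (\<beta> t)"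
    using eventually_compose_filterlim[OF c(1) \<beta>_lim] by eventually_elim (simp add: \<alpha>_def, simp add: \<beta>_def)
  have an: "(\<lambda>t. hf (\<beta> t)) analytic_on {0}" "(\<lambda>t. hg (\<beta> t)) analytic_on {0}"
    by (rule analytic_atI, rule eventually_mono[OF ev], rule cdiff_at_compose_arc[OF \<beta>_diff], simp)+
  obtain r where r: "r analytic_on {0}" "r 0 \<noteq> 0" "\<forall>\<^sub>F t in nhds 0. (r t)\<^sup>2 = hf (\<beta> t)"
    using analytic_sqrt_exists[OF an(1)] c(2) \<beta>0 by auto
  define \<zeta> where "\<zeta> = (\<lambda>t. t ^ (s * exc_mult f p div 2) * r t)"
  have \<zeta>: "\<zeta> analytic_on {0}" unfolding \<zeta>_def by (intro analytic_intros r)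
  have "\<forall>\<^sub>F t in nhds 0. (\<zeta> t)\<^sup>2 = f (\<alpha> t)"
    using r(3) ev by eventually_elim (use s(2) in \<open>simp add: \<zeta>_def power_mult_distrib flip: power_mult\<close>)
  moreover have "exact_order (s * exc_mult g p) (\<lambda>t. g (\<alpha> t))"
    unfolding exact_order_def
    by (rule exI[of _ "\<lambda>t. hg (\<beta> t)"], intro conjI an, simp add: \<beta>0 c(3), rule eventually_mono[OF ev])
       (simp add: power_mult)
  moreover have "exact_order (s * exc_mult f p div 2) \<zeta>"
    unfolding exact_order_def \<zeta>_def using r by (intro exI[of _ r]) auto
  ultimately show ?thesis using that[OF \<alpha> \<zeta>] by blast
qed

section \<open>The arc filtration in terms of divisorial valuations\<close>

lemma vanishes_to_pullback:
  assumes ev: "\<forall>\<^sub>F x in nhds 0. g (chart q x) = x $ 1 ^ axis_exponent N (u_axis q) * x $ 2 ^ axis_exponent N (w_axis q) * h x"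
    and h: "holo_germ h" and \<psi>: "arc_on UNIV \<psi>"
    and k: "u_axis q \<noteq> None \<Longrightarrow> vanishes_to k1 (\<lambda>t. \<psi> t $ 1)" "w_axis q \<noteq> None \<Longrightarrow> vanishes_to k2 (\<lambda>t. \<psi> t $ 2)"
  shows "vanishes_to (axis_exponent N (u_axis q) * k1 + axis_exponent N (w_axis q) * k2) (\<lambda>t. g (chart q (\<psi> t)))"
proof -
  have "vanishes_to (axis_exponent N (u_axis q) * k1) (\<lambda>t. \<psi> t $ 1 ^ axis_exponent N (u_axis q))"
    using k(1) by (cases "u_axis q") (auto intro: vanishes_to_power analytic_imp_vanishes_to_0)
  moreover have "vanishes_to (axis_exponent N (w_axis q) * k2) (\<lambda>t. \<psi> t $ 2 ^ axis_exponent N (w_axis q))"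
    using k(2) by (cases "w_axis q") (auto intro: vanishes_to_power analytic_imp_vanishes_to_0)
  moreover have "vanishes_to 0 (\<lambda>t. h (\<psi> t))"
    by (rule analytic_imp_vanishes_to_0[OF analytic_compose_arc[OF \<psi> h]])
  ultimately have "vanishes_to (axis_exponent N (u_axis q) * k1 + axis_exponent N (w_axis q) * k2 + 0)
      (\<lambda>t. \<psi> t $ 1 ^ axis_exponent N (u_axis q) * \<psi> t $ 2 ^ axis_exponent N (w_axis q) * h (\<psi> t))"
    by (intro vanishes_to_mult)
  then show ?thesis
    using vanishes_to_cong[OF eventually_compose_filterlim[OF ev arc_filterlim[OF \<psi>]]] by simp
qed

lemma pullback_factorization:
  assumes g: "holo_germ g" and N: "\<And>p. u_axis q = Some p \<or> w_axis q = Some p \<Longrightarrow> enat (N p) \<le> exc_val p g"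
  obtains h where "holo_germ h"
    "\<forall>\<^sub>F x in nhds 0. g (chart q x) = x $ 1 ^ axis_exponent N (u_axis q) * x $ 2 ^ axis_exponent N (w_axis q) * h x"
proof (cases "\<forall>\<^sub>F x in nhds 0. g x = 0")
  case True
  from eventually_compose_filterlim[OF this filterlim_chart] show ?thesis
    by (intro that[of "\<lambda>_. 0"]) (auto intro: holo_germ_const)
next
  case False
  then have nz: "\<exists>\<^sub>F x in nhds 0. g x \<noteq> 0" by (simp add: frequently_def)
  have le: "N p \<le> exc_mult g p" if "u_axis q = Some p \<or> w_axis q = Some p" for p
    using N[OF that] by (simp add: exc_val_eq_exc_mult[OF g nz])
  have "axis_exponent N (u_axis q) \<le> axis_exponent (exc_mult g) (u_axis q)"
    "axis_exponent N (w_axis q) \<le> axis_exponent (exc_mult g) (w_axis q)"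
    using le by (cases "u_axis q"; cases "w_axis q"; simp)+
  then obtain a b where ab: "axis_exponent (exc_mult g) (u_axis q) = axis_exponent N (u_axis q) + a"
    "axis_exponent (exc_mult g) (w_axis q) = axis_exponent N (w_axis q) + b" by (meson le_Suc_ex)
  obtain h m where res: "residual_germ g q h m" using residual_germ_exists[OF g nz] by blast
  then have h: "holo_germ h" by (simp add: residual_germ_def)
  have "\<forall>\<^sub>F x in nhds 0. g (chart q x) = x $ 1 ^ axis_exponent (exc_mult g) (u_axis q) * x $ 2 ^ axis_exponent (exc_mult g) (w_axis q) * h x"
    using res by (simp add: residual_germ_def)
  then have "\<forall>\<^sub>F x in nhds 0. g (chart q x) = x $ 1 ^ axis_exponent N (u_axis q) * x $ 2 ^ axis_exponent N (w_axis q) *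
      (x $ 1 ^ a * x $ 2 ^ b * h x)"
    by eventually_elim (simp add: ab power_add)
  moreover have "holo_germ (\<lambda>x. x $ 1 ^ a * x $ 2 ^ b * h x)"
    by (intro holo_germ_mult holo_germ_power holo_germ_nth h)
  ultimately show ?thesis by (rule that[rotated])
qed

lemma exact_order_pos:
  assumes "exact_order k e" "e 0 = 0" shows "0 < k"
proof (rule ccontr)
  assume "\<not> 0 < k"
  with assms(1) obtain d where "d 0 \<noteq> 0" "\<forall>\<^sub>F t in nhds 0. e t = d t" by (auto simp: exact_order_def)
  with assms(2) eventually_nhds_x_imp_x show False by fastforce
qed

lemma exact_order_unique: "exact_order k e \<Longrightarrow> exact_order l e \<Longrightarrow> k = l"
  by (meson antisym exact_order_imp_vanishes_to vanishes_to_le_exact_order)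

text \<open>The number \<open>\<sigma>\<^sub>i\<close> of the component created at \<open>p\<close>.\<close>

definition parity_factor :: "(complex ^ 2 \<Rightarrow> complex) \<Rightarrow> near_point \<Rightarrow> nat" where
  "parity_factor f p = (if even (exc_mult f p) then 1 else 2)"

text \<open>Suppose that a lifted arc at \<open>q\<close> meets the axes \<open>u = 0\<close> and \<open>w = 0\<close> with multiplicities \<open>k1\<close> and \<open>k2\<close>,
  and that a square root of \<open>f\<close> along it vanishes to order \<open>z\<close>.  These are the possible reasons for which the orders along the arc are
  bounded below by the weighted valuations: some component is met at least \<open>\<sigma>\<close> times, or two
  components with \<open>\<sigma> = 2\<close> are met.\<close>

definition controls_order :: "(complex ^ 2 \<Rightarrow> complex) \<Rightarrow> near_point \<Rightarrow> nat \<Rightarrow> nat \<Rightarrow> nat \<Rightarrow> bool" where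
  "controls_order f q k1 k2 z \<longleftrightarrow>
     (\<exists>p. u_axis q = Some p \<and> parity_factor f p \<le> k1 \<and> k1 * exc_mult f p \<le> 2 * z) \<or>
     (\<exists>p. w_axis q = Some p \<and> parity_factor f p \<le> k2 \<and> k2 * exc_mult f p \<le> 2 * z) \<or>
     (\<exists>p p'. u_axis q = Some p \<and> w_axis q = Some p' \<and> parity_factor f p = 2 \<and> parity_factor f p' = 2 \<and>
        1 \<le> k1 \<and> 1 \<le> k2 \<and> exc_mult f p + exc_mult f p' \<le> 2 * z)"

text \<open>For a single component, \<open>\<sigma>\<^sub>i \<le> k\<^sub>i\<close> does it; for two components, add the two assumed inequalities.  The
  case \<open>c = 0\<close> is for \<open>a\<close>, and \<open>c = 1\<close> for \<open>z b\<close>, where the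
  doubled assumption avoids halves.\<close>

lemma controls_order_bound:
  assumes G: "controls_order f q k1 k2 z"
    and N: "\<And>p. u_axis q = Some p \<or> w_axis q = Some p \<Longrightarrow>
      2 * k \<le> parity_factor f p * (2 * N p + c * exc_mult f p)" and c: "c \<le> 1"
  shows "k \<le> c * z + (axis_exponent N (u_axis q) * k1 + axis_exponent N (w_axis q) * k2)"
proof -
  have single: "2 * k \<le> 2 * (c * z) + 2 * (N p * j)"
    if p: "u_axis q = Some p \<or> w_axis q = Some p" "parity_factor f p \<le> j" "j * exc_mult f p \<le> 2 * z" for p j
  proof -
    have "2 * k \<le> j * (2 * N p + c * exc_mult f p)"
      using order_trans[OF N[OF p(1)] mult_right_mono[OF p(2)]] by simp
    also have "\<dots> = 2 * (N p * j) + c * (j * exc_mult f p)" by (simp add: algebra_simps)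
    also have "\<dots> \<le> 2 * (N p * j) + c * (2 * z)" by (intro add_left_mono mult_left_mono p) simp
    finally show ?thesis by simp
  qed
  from G show ?thesis unfolding controls_order_def
  proof (elim disjE exE conjE)
    fix p assume "u_axis q = Some p" "parity_factor f p \<le> k1" "k1 * exc_mult f p \<le> 2 * z"
    with single[of p k1] show ?thesis by simp
  next
    fix p assume "w_axis q = Some p" "parity_factor f p \<le> k2" "k2 * exc_mult f p \<le> 2 * z"
    with single[of p k2] show ?thesis by simp
  next
    fix p p' assume *: "u_axis q = Some p" "w_axis q = Some p'" "parity_factor f p = 2" "parity_factor f p' = 2"
        "1 \<le> k1" "1 \<le> k2" "exc_mult f p + exc_mult f p' \<le> 2 * z"
    have "c * exc_mult f p + c * exc_mult f p' \<le> 2 * (c * z)"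
      using mult_left_mono[OF *(7), of c] by (simp add: algebra_simps)
    moreover have "N p \<le> N p * k1" "N p' \<le> N p' * k2" using *(5,6) by simp_all
    moreover have "k \<le> 2 * N p + c * exc_mult f p" "k \<le> 2 * N p' + c * exc_mult f p'"
      using N[of p] N[of p'] * by auto
    moreover have "k \<le> Z + (i + j)"
      if "x + y \<le> 2 * Z" "n \<le> i" "n' \<le> j" "k \<le> 2 * n + x" "k \<le> 2 * n' + y"
      for x y Z n n' i j :: nat using that by linarith
    ultimately have "k \<le> c * z + (N p * k1 + N p' * k2)" by blast
    then show ?thesis by (simp add: *)
  qed
qed

text \<open>If \<open>h(0) \<noteq> 0\<close>, then \<open>f\<close> is a monomial times a unit at \<open>q\<close> and \<open>2 z = k1 A + k2 B\<close>; the cases are then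
  forced by parity.  Otherwise \<open>q\<close> is on the strict transform of the curve, and the hypothesis provides
  a component of even multiplicity through \<open>q\<close>; this includes the arcs on which \<open>f\<close> vanishes
  identically.\<close>

lemma arc_controls_order:
  fixes node :: "'r::finite \<Rightarrow> near_point"
  assumes f: "holo_germ f" "\<exists>\<^sub>F x in nhds 0. f x \<noteq> 0" and node: "blowup_centres node"
    and strict: "strict_curve_points node f \<subseteq> (\<Union>i\<in>{i. even (exc_mult f (node i))}. exc_component node i)"
    and \<alpha>: "arc_on UNIV \<alpha>" "\<not> (\<forall>\<^sub>F t in nhds 0. \<alpha> t = 0)"
    and \<zeta>: "\<zeta> analytic_on {0}" "\<forall>\<^sub>F t in nhds 0. (\<zeta> t)\<^sup>2 = f (\<alpha> t)"
  obtains q \<psi> k1 k2 z where "q \<in> exc_divisor node" "arc_on UNIV \<psi>" "\<forall>\<^sub>F t in nhds 0. \<alpha> t = chart q (\<psi> t)"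
    "u_axis q \<noteq> None \<Longrightarrow> vanishes_to k1 (\<lambda>t. \<psi> t $ 1)" "w_axis q \<noteq> None \<Longrightarrow> vanishes_to k2 (\<lambda>t. \<psi> t $ 2)"
    "vanishes_to z \<zeta>" "controls_order f q k1 k2 z"
proof -
  obtain q \<psi> where q: "q \<in> exc_divisor node" and \<psi>: "arc_on UNIV \<psi>" "\<forall>\<^sub>F t in nhds 0. \<alpha> t = chart q (\<psi> t)"
    by (rule arc_lift[OF node \<alpha>])
  have ne: "q \<noteq> []" using q by (auto simp: exc_divisor_def)
  have ax: "u_axis q \<noteq> None \<or> w_axis q \<noteq> None" using ne by (cases q rule: rev_cases; cases "last q") auto
  have ev0: "\<forall>\<^sub>F t in nhds 0. \<alpha> t = 0 \<longleftrightarrow> (u_axis q \<noteq> None \<and> \<psi> t $ 1 = 0) \<or> (w_axis q \<noteq> None \<and> \<psi> t $ 2 = 0)"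
    using eventually_compose_filterlim[OF chart_axes[OF ne] arc_filterlim[OF \<psi>(1)]] \<psi>(2) by eventually_elim simp
  have an: "(\<lambda>t. \<psi> t $ i) analytic_on {0}" "\<psi> 0 $ i = 0" for i using \<psi>(1) by (auto simp: arc_on_def)
  have order: "\<exists>k. exact_order k (\<lambda>t. \<psi> t $ i) \<and> 0 < k"
    if on_axis: "\<forall>\<^sub>F t in nhds 0. \<psi> t $ i = 0 \<longrightarrow> \<alpha> t = 0" for i
  proof -
    have "\<not> (\<forall>\<^sub>F t in nhds 0. \<psi> t $ i = 0)"
    proof
      assume "\<forall>\<^sub>F t in nhds 0. \<psi> t $ i = 0"
      with on_axis have "\<forall>\<^sub>F t in nhds 0. \<alpha> t = 0" by eventually_elim simp
      with \<alpha>(2) show False ..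
    qed
    then obtain k where "exact_order k (\<lambda>t. \<psi> t $ i)" using exact_order_exists[OF an(1)] by blast
    with exact_order_pos[OF this an(2)] show ?thesis by blast
  qed
  have "\<exists>k. exact_order k (\<lambda>t. \<psi> t $ 1) \<and> 0 < k" if "u_axis q \<noteq> None"
    by (rule order, rule eventually_mono[OF ev0]) (use that in simp)
  then obtain k1 where k1: "u_axis q \<noteq> None \<Longrightarrow> exact_order k1 (\<lambda>t. \<psi> t $ 1)" "u_axis q \<noteq> None \<Longrightarrow> 0 < k1" by blast
  have "\<exists>k. exact_order k (\<lambda>t. \<psi> t $ 2) \<and> 0 < k" if "w_axis q \<noteq> None"
    by (rule order, rule eventually_mono[OF ev0]) (use that in simp)
  then obtain k2 where k2: "w_axis q \<noteq> None \<Longrightarrow> exact_order k2 (\<lambda>t. \<psi> t $ 2)" "w_axis q \<noteq> None \<Longrightarrow> 0 < k2" by blast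
  let ?A = "axis_exponent (exc_mult f) (u_axis q)" and ?B = "axis_exponent (exc_mult f) (w_axis q)"
  obtain h m where res: "residual_germ f q h m" using residual_germ_exists[OF f] by blast
  then have h: "holo_germ h"
    and ev: "\<forall>\<^sub>F x in nhds 0. f (chart q x) = x $ 1 ^ ?A * x $ 2 ^ ?B * h x"
    by (auto simp: residual_germ_def)
  have ev': "\<forall>\<^sub>F t in nhds 0. (\<zeta> t)\<^sup>2 = \<psi> t $ 1 ^ ?A * \<psi> t $ 2 ^ ?B * h (\<psi> t)"
    using eventually_compose_filterlim[OF ev arc_filterlim[OF \<psi>(1)]] \<psi>(2) \<zeta>(2) by eventually_elim simp
  have "\<exists>z. vanishes_to z \<zeta> \<and> controls_order f q k1 k2 z"
  proof (cases "h 0 = 0")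
    case False
    have "exact_order (?A * k1) (\<lambda>t. \<psi> t $ 1 ^ ?A)"
      using k1 by (cases "u_axis q") (auto intro: exact_order_power exact_order_0)
    moreover have "exact_order (?B * k2) (\<lambda>t. \<psi> t $ 2 ^ ?B)"
      using k2 by (cases "w_axis q") (auto intro: exact_order_power exact_order_0)
    moreover have "exact_order 0 (\<lambda>t. h (\<psi> t))"
      using exact_order_0[OF analytic_compose_arc[OF \<psi>(1) h]] \<psi>(1) False by (simp add: arc_on_def)
    ultimately have "exact_order (?A * k1 + ?B * k2 + 0) (\<lambda>t. \<psi> t $ 1 ^ ?A * \<psi> t $ 2 ^ ?B * h (\<psi> t))"
      by (intro exact_order_mult)
    then have sq: "exact_order (?A * k1 + ?B * k2) (\<lambda>t. (\<zeta> t)\<^sup>2)"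
      using exact_order_cong[OF ev'] by simp
    have "\<not> (\<forall>\<^sub>F t in nhds 0. \<zeta> t = 0)"
    proof
      assume "\<forall>\<^sub>F t in nhds 0. \<zeta> t = 0"
      then have "\<forall>\<^sub>F t in nhds 0. (\<zeta> t)\<^sup>2 = 0" by eventually_elim simp
      from vanishes_to_le_exact_order[OF vanishes_to_zero[OF this] sq] show False using Suc_n_not_le_n by blast
    qed
    then obtain z where z: "exact_order z \<zeta>" using exact_order_exists[OF \<zeta>(1)] by blast
    have eq: "?A * k1 + ?B * k2 = 2 * z" by (rule exact_order_unique[OF sq exact_order_power[OF z]])
    have "controls_order f q k1 k2 z"
    proof (cases "u_axis q")
      case None
      then obtain p where p: "w_axis q = Some p" using ax by auto
      have "k2 * exc_mult f p = 2 * z" "even (exc_mult f p * k2)" using eq by (simp_all add: None p mult.commute)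
      moreover have "0 < k2" using k2 p by simp
      ultimately have "parity_factor f p \<le> k2" by (auto simp: parity_factor_def elim!: evenE)
      then show ?thesis unfolding controls_order_def using p \<open>k2 * exc_mult f p = 2 * z\<close> by auto
    next
      case (Some p)
      note u = this
      have k1': "0 < k1" using k1 u by simp
      show ?thesis
      proof (cases "w_axis q")
        case None
        have "k1 * exc_mult f p = 2 * z" "even (exc_mult f p * k1)" using eq by (simp_all add: None u mult.commute)
        then have "parity_factor f p \<le> k1" using k1' by (auto simp: parity_factor_def elim!: evenE)
        then show ?thesis unfolding controls_order_def using u \<open>k1 * exc_mult f p = 2 * z\<close> by auto
      next
        case (Some p')
        have k2': "0 < k2" using k2 Some by simp
        have e: "exc_mult f p * k1 + exc_mult f p' * k2 = 2 * z" using eq by (simp add: u Some)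
        show ?thesis
        proof (cases "parity_factor f p \<le> k1")
          case True
          have "k1 * exc_mult f p \<le> 2 * z" using e by (simp add: mult.commute)
          then show ?thesis unfolding controls_order_def using u True by blast
        next
          case False
          then have 1: "k1 = 1" "parity_factor f p = 2" using k1' by (auto simp: parity_factor_def split: if_splits)
          show ?thesis
          proof (cases "parity_factor f p' \<le> k2")
            case True
            have "k2 * exc_mult f p' \<le> 2 * z" using e by (simp add: mult.commute)
            then show ?thesis unfolding controls_order_def using Some True by blast
          next
            case False
            then have 2: "k2 = 1" "parity_factor f p' = 2" using k2' by (auto simp: parity_factor_def split: if_splits)
            show ?thesis unfolding controls_order_def using u Some 1 2 e by simp
          qed
        qed
      qed
    qed
    with exact_order_imp_vanishes_to[OF z] show ?thesis by blast
  next
    case True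
    have "q \<in> strict_curve_points node f" by (rule residual_zero_imp_strict_curve_point[OF q res True])
    then obtain i where i: "even (exc_mult f (node i))" "q \<in> exc_component node i" using strict by blast
    have pf: "parity_factor f (node i) = 1" using i by (simp add: parity_factor_def)
    have "vanishes_to (?A * k1 + ?B * k2) (\<lambda>t. f (chart q (\<psi> t)))"
      using exact_order_imp_vanishes_to k1(1) k2(1) by (intro vanishes_to_pullback[OF ev h \<psi>(1)]) auto
    moreover have "\<forall>\<^sub>F t in nhds 0. (\<zeta> t)\<^sup>2 = f (chart q (\<psi> t))" using \<psi>(2) \<zeta>(2) by eventually_elim simp
    ultimately have sq: "vanishes_to (?A * k1 + ?B * k2) (\<lambda>t. (\<zeta> t)\<^sup>2)" by (rule vanishes_to_cong[rotated])
    have root: "vanishes_to (k * exc_mult f (node i) div 2) \<zeta>" if "k * exc_mult f (node i) \<le> ?A * k1 + ?B * k2" for k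
      by (intro vanishes_to_sqrt[OF \<zeta>(1)] vanishes_to_mono[OF sq]) (use that i(1) in simp)
    from exc_component_axis[OF i(2)] show ?thesis
    proof
      assume u: "u_axis q = Some (node i)"
      have "vanishes_to (k1 * exc_mult f (node i) div 2) \<zeta>" by (rule root) (simp add: u mult.commute)
      moreover have "controls_order f q k1 k2 (k1 * exc_mult f (node i) div 2)"
        unfolding controls_order_def using u pf k1(2) i(1) by auto
      ultimately show ?thesis by blast
    next
      assume w: "w_axis q = Some (node i)"
      have "vanishes_to (k2 * exc_mult f (node i) div 2) \<zeta>" by (rule root) (simp add: w mult.commute)
      moreover have "controls_order f q k1 k2 (k2 * exc_mult f (node i) div 2)"
        unfolding controls_order_def using w pf k2(2) i(1) by auto
      ultimately show ?thesis by blast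
    qed
  qed
  then obtain z where "vanishes_to z \<zeta>" "controls_order f q k1 k2 z" by blast
  then show ?thesis
    using that[OF q \<psi>] k1(1) k2(1) exact_order_imp_vanishes_to by blast
qed

text \<open>The numbers \<open>Na\<close> and \<open>Nb\<close> replace the valuations, which are infinite for zero germs.\<close>

lemma vanishes_to_on_double_cover:
  fixes node :: "'r::finite \<Rightarrow> near_point"
  assumes f: "holo_germ f" "\<exists>\<^sub>F x in nhds 0. f x \<noteq> 0" "f 0 = 0" and node: "blowup_centres node"
    and strict: "strict_curve_points node f \<subseteq> (\<Union>i\<in>{i. even (exc_mult f (node i))}. exc_component node i)"
    and a: "holo_germ a" and b: "holo_germ b"
    and Na: "\<And>i. enat (Na (node i)) \<le> exc_val (node i) a" "\<And>i. k \<le> parity_factor f (node i) * Na (node i)"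
    and Nb: "\<And>i. enat (Nb (node i)) \<le> exc_val (node i) b"
      "\<And>i. 2 * k \<le> parity_factor f (node i) * (2 * Nb (node i) + exc_mult f (node i))"
    and \<alpha>: "arc_on UNIV \<alpha>" and \<zeta>: "\<zeta> analytic_on {0}" "\<forall>\<^sub>F t in nhds 0. (\<zeta> t)\<^sup>2 = f (\<alpha> t)"
  shows "vanishes_to k (\<lambda>t. a (\<alpha> t) + \<zeta> t * b (\<alpha> t))"
proof (cases "\<forall>\<^sub>F t in nhds 0. \<alpha> t = 0")
  case True
  with \<zeta>(2) f(3) have \<zeta>0: "\<forall>\<^sub>F t in nhds 0. \<zeta> t = 0" by (auto elim: eventually_elim2)
  show ?thesis
  proof (cases k)
    case 0
    then show ?thesis
      by (intro analytic_imp_vanishes_to_0[THEN vanishes_to_mono] analytic_on_add analytic_on_mult \<zeta> analytic_compose_arc[OF \<alpha>] a b) simp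
  next
    case (Suc l)
    obtain i :: 'r where True by blast
    have "Na (node i) \<noteq> 0" using Na(2)[of i] Suc by (cases "Na (node i)") auto
    then have "enat 1 \<le> exc_val (node i) a" using Na(1)[of i] by (metis enat_ord_simps(1) less_one not_le order_trans)
    then obtain h where "\<forall>\<^sub>F x in nhds 0. a (chart (node i @ [Affine 0]) x) = x $ 1 ^ 1 * h x"
      using le_exc_val_iff[OF a] by blast
    from eventually_nhds_x_imp_x[OF this] have a0: "a 0 = 0" by simp
    have "\<forall>\<^sub>F t in nhds 0. a (\<alpha> t) + \<zeta> t * b (\<alpha> t) = 0" using True \<zeta>0 by eventually_elim (simp add: a0)
    then show ?thesis by (rule vanishes_to_zero)
  qed
next
  case False
  obtain q \<psi> k1 k2 z where q: "q \<in> exc_divisor node" and \<psi>: "arc_on UNIV \<psi>" "\<forall>\<^sub>F t in nhds 0. \<alpha> t = chart q (\<psi> t)"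
    and k: "u_axis q \<noteq> None \<Longrightarrow> vanishes_to k1 (\<lambda>t. \<psi> t $ 1)" "w_axis q \<noteq> None \<Longrightarrow> vanishes_to k2 (\<lambda>t. \<psi> t $ 2)"
    and z: "vanishes_to z \<zeta>" "controls_order f q k1 k2 z"
    using arc_controls_order[OF f(1,2) node strict \<alpha> False \<zeta>] by blast
  have axis: "\<exists>i. p = node i" if "u_axis q = Some p \<or> w_axis q = Some p" for p
    using exc_divisor_axis[OF node q that] by blast
  have pull: "vanishes_to (axis_exponent N (u_axis q) * k1 + axis_exponent N (w_axis q) * k2) (\<lambda>t. g (\<alpha> t))"
    if g: "holo_germ g" and N: "\<And>i. enat (N (node i)) \<le> exc_val (node i) g" for g N
  proof -
    obtain h where "holo_germ h"
      "\<forall>\<^sub>F x in nhds 0. g (chart q x) = x $ 1 ^ axis_exponent N (u_axis q) * x $ 2 ^ axis_exponent N (w_axis q) * h x"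
      by (rule pullback_factorization[OF g, of q N]) (use axis N in blast)+
    from vanishes_to_pullback[OF this(2,1) \<psi>(1) k]
    have "vanishes_to (axis_exponent N (u_axis q) * k1 + axis_exponent N (w_axis q) * k2) (\<lambda>t. g (chart q (\<psi> t)))"
      by blast
    moreover have "\<forall>\<^sub>F t in nhds 0. g (\<alpha> t) = g (chart q (\<psi> t))" using \<psi>(2) by eventually_elim simp
    ultimately show ?thesis by (rule vanishes_to_cong[rotated])
  qed
  have "k \<le> 0 * z + (axis_exponent Na (u_axis q) * k1 + axis_exponent Na (w_axis q) * k2)"
    by (rule controls_order_bound[OF z(2)]) (use axis Na(2) in fastforce)+
  then have "vanishes_to k (\<lambda>t. a (\<alpha> t))" using vanishes_to_mono[OF pull[OF a Na(1)]] by simp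
  moreover have "k \<le> 1 * z + (axis_exponent Nb (u_axis q) * k1 + axis_exponent Nb (w_axis q) * k2)"
    by (rule controls_order_bound[OF z(2)]) (use axis Nb(2) in fastforce)+
  then have "vanishes_to k (\<lambda>t. \<zeta> t * b (\<alpha> t))"
    using vanishes_to_mono[OF vanishes_to_mult[OF z(1) pull[OF b Nb(1)]]] by simp
  ultimately show ?thesis by (rule vanishes_to_add)
qed

text \<open>With \<open>\<zeta>\<close> also \<open>- \<zeta>\<close> is a square root, so both summands vanish to order \<open>k\<close>.  On a generic arc their
  orders are known.\<close>

lemma vanishing_on_double_cover_bounds:
  assumes f: "holo_germ f" "\<exists>\<^sub>F x in nhds 0. f x \<noteq> 0"
    and a: "holo_germ a" and b: "holo_germ b"
    and van: "\<And>\<alpha> \<zeta>. arc_on UNIV \<alpha> \<Longrightarrow> \<zeta> analytic_on {0} \<Longrightarrow> \<forall>\<^sub>F t in nhds 0. (\<zeta> t)\<^sup>2 = f (\<alpha> t) \<Longrightarrow>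
        vanishes_to k (\<lambda>t. a (\<alpha> t) + \<zeta> t * b (\<alpha> t))"
  shows "\<exists>n. enat n \<le> exc_val p a \<and> k \<le> parity_factor f p * n"
    and "\<exists>n. enat n \<le> exc_val p b \<and> 2 * k \<le> parity_factor f p * (2 * n + exc_mult f p)"
proof -
  let ?s = "parity_factor f p"
  have s: "0 < ?s" "even (?s * exc_mult f p)" by (auto simp: parity_factor_def)
  have split: "vanishes_to k (\<lambda>t. a (\<alpha> t))" "vanishes_to k (\<lambda>t. \<zeta> t * b (\<alpha> t))"
    if arc: "arc_on UNIV \<alpha>" "\<zeta> analytic_on {0}" "\<forall>\<^sub>F t in nhds 0. (\<zeta> t)\<^sup>2 = f (\<alpha> t)" for \<alpha> \<zeta>
  proof -
    have plus: "vanishes_to k (\<lambda>t. a (\<alpha> t) + \<zeta> t * b (\<alpha> t))" by (rule van[OF arc])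
    have minus: "vanishes_to k (\<lambda>t. a (\<alpha> t) + - \<zeta> t * b (\<alpha> t))"
      by (rule van[OF arc(1)]) (use arc in \<open>auto intro: analytic_intros\<close>)
    have half: "vanishes_to 0 (\<lambda>t. c)" for c by (rule analytic_imp_vanishes_to_0) simp
    from vanishes_to_mult[OF half[of "1/2"] vanishes_to_add[OF plus minus]]
    show "vanishes_to k (\<lambda>t. a (\<alpha> t))" by (simp add: algebra_simps)
    from vanishes_to_mult[OF half[of "1/2"] vanishes_to_add[OF plus vanishes_to_mult[OF half[of "-1"] minus, simplified]]]
    show "vanishes_to k (\<lambda>t. \<zeta> t * b (\<alpha> t))" by (simp add: algebra_simps)
  qed
  show "\<exists>n. enat n \<le> exc_val p a \<and> k \<le> ?s * n"
  proof (cases "\<forall>\<^sub>F x in nhds 0. a x = 0")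
    case True
    then show ?thesis using exc_val_zero_germ[OF a] s by (intro exI[of _ k]) auto
  next
    case False
    then have nz: "\<exists>\<^sub>F x in nhds 0. a x \<noteq> 0" by (simp add: frequently_def)
    obtain \<alpha> \<zeta> where arc: "arc_on UNIV \<alpha>" "\<zeta> analytic_on {0}" "\<forall>\<^sub>F t in nhds 0. (\<zeta> t)\<^sup>2 = f (\<alpha> t)"
      "exact_order (?s * exc_mult a p) (\<lambda>t. a (\<alpha> t))" using generic_arc[OF f a nz s] by blast
    from vanishes_to_le_exact_order[OF split(1)[OF arc(1-3)] arc(4)]
    show ?thesis using exc_val_eq_exc_mult[OF a nz, of p] by (intro exI[of _ "exc_mult a p"]) simp
  qed
  show "\<exists>n. enat n \<le> exc_val p b \<and> 2 * k \<le> ?s * (2 * n + exc_mult f p)"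
  proof (cases "\<forall>\<^sub>F x in nhds 0. b x = 0")
    case True
    then show ?thesis using exc_val_zero_germ[OF b] by (intro exI[of _ k]) (auto simp: parity_factor_def)
  next
    case False
    then have nz: "\<exists>\<^sub>F x in nhds 0. b x \<noteq> 0" by (simp add: frequently_def)
    obtain \<alpha> \<zeta> where arc: "arc_on UNIV \<alpha>" "\<zeta> analytic_on {0}" "\<forall>\<^sub>F t in nhds 0. (\<zeta> t)\<^sup>2 = f (\<alpha> t)"
      "exact_order (?s * exc_mult b p) (\<lambda>t. b (\<alpha> t))" "exact_order (?s * exc_mult f p div 2) \<zeta>"
      using generic_arc[OF f b nz s] by blast
    from vanishes_to_le_exact_order[OF split(2)[OF arc(1-3)] exact_order_mult[OF arc(5,4)]]
    have "2 * k \<le> ?s * (2 * exc_mult b p + exc_mult f p)" using s(2) by (auto simp: algebra_simps elim!: evenE)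
    then show ?thesis using exc_val_eq_exc_mult[OF b nz, of p] by (intro exI[of _ "exc_mult b p"]) simp
  qed
qed

section \<open>Bases modulo a subspace\<close>

text \<open>Linear independence of the residue classes modulo \<open>W\<close>, together with their being distinct.\<close>

definition indep_mod :: "('a \<Rightarrow> complex) set \<Rightarrow> ('a \<Rightarrow> complex) set \<Rightarrow> bool" where
  "indep_mod W B \<longleftrightarrow> (\<forall>b\<in>B. b \<notin> fun_space.span (W \<union> (B - {b})))"

lemma basis_mod_iff: "basis_mod V W B \<longleftrightarrow> B \<subseteq> V \<and> V \<subseteq> fun_space.span (W \<union> B) \<and> indep_mod W B"
  by (simp add: basis_mod_def indep_mod_def)

lemma indep_mod_subset: "indep_mod W B \<Longrightarrow> C \<subseteq> B \<Longrightarrow> indep_mod W C"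
  unfolding indep_mod_def by (meson Diff_mono Un_mono fun_space.span_mono subset_iff subset_refl)

lemma indep_mod_union_independent:
  assumes "finite B" "indep_mod W B" "T \<subseteq> W" "fun_space.independent T"
  shows "fun_space.independent (T \<union> B) \<and> T \<inter> B = {}"
  using assms(1,2)
proof (induction B)
  case empty
  then show ?case using assms by simp
next
  case (insert b B)
  have b: "b \<notin> fun_space.span (W \<union> B)"
    using insert.prems insert.hyps unfolding indep_mod_def by (metis Diff_insert_absorb insertI1)
  then have "b \<notin> fun_space.span (T \<union> B)"
    using assms(3) by (meson Un_mono fun_space.span_mono subset_iff subset_refl)
  moreover have "b \<notin> T" using b assms(3) fun_space.span_base by blast
  moreover have "indep_mod W B" using insert.prems by (rule indep_mod_subset) auto
  ultimately show ?case using insert.IH insert.hyps by (auto simp: fun_space.independent_insert)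
qed

lemma span_finite_support:
  assumes "x \<in> fun_space.span S" obtains T where "finite T" "T \<subseteq> S" "x \<in> fun_space.span T"
proof -
  obtain t r where "finite t" "t \<subseteq> S" "x = (\<Sum>a\<in>t. fun_scale (r a) a)"
    using assms unfolding fun_space.span_explicit by blast
  moreover from this have "x \<in> fun_space.span t"
    by (simp only:) (rule fun_space.span_sum, rule fun_space.span_scale, rule fun_space.span_base)
  ultimately show ?thesis using that by blast
qed

text \<open>Finitely many elements of \<open>W\<close> take part in the finitely many linear combinations.  A basis of their span
  turns the claim into the usual bound for independent sets in a span.\<close>

lemma indep_mod_card_le_finite:
  assumes "finite B" "indep_mod W B" "finite F" "B \<subseteq> fun_space.span (W \<union> F)"
  shows "card B \<le> card F"
proof -
  have "\<forall>b\<in>B. \<exists>T. finite T \<and> T \<subseteq> W \<union> F \<and> b \<in> fun_space.span T"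
    using assms(4) span_finite_support by (metis subsetD)
  from bchoice[OF this] obtain t where t: "\<forall>b\<in>B. finite (t b) \<and> t b \<subseteq> W \<union> F \<and> b \<in> fun_space.span (t b)" ..
  \<comment> \<open>The part of \<open>W\<close> that is used.\<close>
  define T1 where "T1 = (\<Union>b\<in>B. t b) \<inter> W"
  have T1: "finite T1" "T1 \<subseteq> W" using t assms(1) by (auto simp: T1_def)
  have B: "B \<subseteq> fun_space.span (T1 \<union> F)"
  proof
    fix b assume "b \<in> B"
    with t have "t b \<subseteq> T1 \<union> F" "b \<in> fun_space.span (t b)" by (auto simp: T1_def)
    then show "b \<in> fun_space.span (T1 \<union> F)" using fun_space.span_mono by blast
  qed
  obtain T where T: "T \<subseteq> T1" "fun_space.independent T" "T1 \<subseteq> fun_space.span T"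
    using fun_space.maximal_independent_subset[of T1] by blast
  have fT: "finite T" using T(1) T1(1) finite_subset by blast
  have ind: "fun_space.independent (T \<union> B)" "T \<inter> B = {}"
    using indep_mod_union_independent[OF assms(1,2) _ T(2)] T(1) T1(2) by auto
  have "T1 \<union> F \<subseteq> fun_space.span (T \<union> F)"
    using T(3) fun_space.span_mono[of T "T \<union> F"] fun_space.span_superset[of "T \<union> F"] by blast
  then have "fun_space.span (T1 \<union> F) \<subseteq> fun_space.span (T \<union> F)"
    by (rule fun_space.span_minimal) (rule fun_space.subspace_span)
  then have "T \<union> B \<subseteq> fun_space.span (T \<union> F)"
    using B fun_space.span_superset[of "T \<union> F"] by blast
  from fun_space.independent_span_bound[OF _ ind(1) this] fT assms(3)
  have "card (T \<union> B) \<le> card (T \<union> F)" by simp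
  also have "\<dots> \<le> card T + card F" by (rule card_Un_le)
  finally show ?thesis using card_Un_disjoint[OF fT assms(1) ind(2)] by simp
qed

lemma indep_mod_card_le:
  assumes "indep_mod W B" "finite F" "B \<subseteq> fun_space.span (W \<union> F)"
  shows "finite B" "card B \<le> card F"
proof -
  show fin: "finite B"
  proof (rule ccontr)
    assume "infinite B"
    then obtain C where C: "C \<subseteq> B" "finite C" "card C = Suc (card F)"
      using infinite_arbitrarily_large by blast
    have "card C \<le> card F"
      using indep_mod_card_le_finite[OF C(2) indep_mod_subset[OF assms(1) C(1)] assms(2)] C(1) assms(3) by blast
    with C(3) show False by simp
  qed
  show "card B \<le> card F" by (rule indep_mod_card_le_finite[OF fin assms])
qed

lemma quot_dim_eq_card:
  assumes "basis_mod V W B" "finite B" shows "quot_dim V W = card B"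
proof -
  define C where "C = (SOME C. basis_mod V W C)"
  have C: "basis_mod V W C" unfolding C_def using assms(1) by (rule someI)
  have "finite C" "card C \<le> card B"
    using indep_mod_card_le[of W C B] assms C by (auto simp: basis_mod_iff)
  moreover have "card B \<le> card C"
    using indep_mod_card_le(2)[of W B C] assms C \<open>finite C\<close> by (auto simp: basis_mod_iff)
  ultimately show ?thesis by (simp add: quot_dim_def C_def[symmetric])
qed

lemma indep_mod_insert:
  assumes "indep_mod W B" "v \<notin> fun_space.span (W \<union> B)" shows "indep_mod W (insert v B)"
  unfolding indep_mod_def
proof
  fix b assume b: "b \<in> insert v B"
  have vB: "v \<notin> B" using assms(2) fun_space.span_base by blast
  show "b \<notin> fun_space.span (W \<union> (insert v B - {b}))"
  proof (cases "b = v")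
    case True
    with assms(2) vB show ?thesis by simp
  next
    case False
    with b have bB: "b \<in> B" by simp
    show ?thesis
    proof
      assume "b \<in> fun_space.span (W \<union> (insert v B - {b}))"
      moreover have "W \<union> (insert v B - {b}) = insert v (W \<union> (B - {b}))" using False by auto
      ultimately have "b \<in> fun_space.span (insert v (W \<union> (B - {b})))" by simp
      moreover have "b \<notin> fun_space.span (W \<union> (B - {b}))" using assms(1) bB by (simp add: indep_mod_def)
      ultimately have "v \<in> fun_space.span (insert b (W \<union> (B - {b})))" by (rule fun_space.in_span_insert)
      moreover have "insert b (W \<union> (B - {b})) = W \<union> B" using bB by auto
      ultimately show False using assms(2) by simp
    qed
  qed
qed

lemma basis_mod_exists:
  assumes "finite F" "V \<subseteq> fun_space.span (W \<union> F)"
  obtains B where "basis_mod V W B" "finite B"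
proof -
  define P where "P = (\<lambda>B. B \<subseteq> V \<and> indep_mod W B)"
  have bound: "finite B \<and> card B \<le> card F" if "P B" for B
    using indep_mod_card_le[of W B F] that assms by (auto simp: P_def)
  have "P {}" by (simp add: P_def indep_mod_def)
  then obtain B where B: "P B" "\<And>C. P C \<Longrightarrow> card C \<le> card B"
    using ex_has_greatest_nat[of P "{}" card "Suc (card F)"] bound by (metis le_imp_less_Suc)
  have "V \<subseteq> fun_space.span (W \<union> B)"
  proof
    fix v assume v: "v \<in> V"
    show "v \<in> fun_space.span (W \<union> B)"
    proof (rule ccontr)
      assume n: "v \<notin> fun_space.span (W \<union> B)"
      then have "P (insert v B)" using B(1) v by (simp add: P_def indep_mod_insert)
      moreover have "v \<notin> B" using n fun_space.span_base by blast
      ultimately show False using B(2)[of "insert v B"] bound[OF B(1)] by simp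
    qed
  qed
  with B(1) have "basis_mod V W B" by (simp add: basis_mod_iff P_def)
  then show ?thesis using that bound[OF B(1)] by blast
qed

text \<open>An element of \<open>U\<close> cannot involve members of \<open>B\<close>, which are independent modulo \<open>U\<close>.\<close>

lemma indep_mod_cancel:
  assumes "finite B" "indep_mod U B" "A \<subseteq> U" "x \<in> U" "x \<in> fun_space.span (A \<union> B)"
  shows "x \<in> fun_space.span A"
  using assms(1,2,5)
proof (induction B)
  case (insert c B)
  have "x \<in> fun_space.span (A \<union> B)"
  proof (rule ccontr)
    assume n: "x \<notin> fun_space.span (A \<union> B)"
    have "x \<in> fun_space.span (insert c (A \<union> B))" using insert.prems(2) by simp
    from fun_space.in_span_insert[OF this n] have "c \<in> fun_space.span (insert x (A \<union> B))" .
    moreover have "insert x (A \<union> B) \<subseteq> U \<union> B" using assms(3,4) by blast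
    ultimately have "c \<in> fun_space.span (U \<union> B)" using fun_space.span_mono by blast
    then show False using insert.prems(1) insert.hyps by (simp add: indep_mod_def)
  qed
  moreover have "indep_mod U B" using insert.prems(1) by (rule indep_mod_subset) auto
  ultimately show ?case using insert.IH by simp
qed simp

text \<open>Gives \<open>dim V/W = dim V/U + dim U/W\<close>.\<close>

lemma basis_mod_trans:
  assumes B: "basis_mod V U B" "finite B" and C: "basis_mod U W C" "finite C"
    and "W \<subseteq> U" "U \<subseteq> V"
  shows "basis_mod V W (B \<union> C)" "B \<inter> C = {}"
proof -
  have B': "B \<subseteq> V" "V \<subseteq> fun_space.span (U \<union> B)" "indep_mod U B" using B by (auto simp: basis_mod_iff)
  have C': "C \<subseteq> U" "U \<subseteq> fun_space.span (W \<union> C)" "indep_mod W C" using C by (auto simp: basis_mod_iff)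
  have notU: "b \<notin> U" if "b \<in> B" for b
    using B'(3) that fun_space.span_base unfolding indep_mod_def by blast
  then show disj: "B \<inter> C = {}" using C'(1) by blast
  have "U \<union> B \<subseteq> fun_space.span (W \<union> (B \<union> C))"
    using C'(2) fun_space.span_mono[of "W \<union> C" "W \<union> (B \<union> C)"] fun_space.span_superset[of "W \<union> (B \<union> C)"] by blast
  then have "fun_space.span (U \<union> B) \<subseteq> fun_space.span (W \<union> (B \<union> C))"
    by (rule fun_space.span_minimal) (rule fun_space.subspace_span)
  moreover have "indep_mod W (B \<union> C)"
    unfolding indep_mod_def
  proof
    fix b assume "b \<in> B \<union> C"
    then show "b \<notin> fun_space.span (W \<union> (B \<union> C - {b}))"
    proof
      assume b: "b \<in> B"
      have "W \<union> (B \<union> C - {b}) \<subseteq> U \<union> (B - {b})" using assms(5) C'(1) by blast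
      then show ?thesis using B'(3) b fun_space.span_mono unfolding indep_mod_def by blast
    next
      assume b: "b \<in> C"
      show ?thesis
      proof
        assume "b \<in> fun_space.span (W \<union> (B \<union> C - {b}))"
        moreover have "W \<union> (B \<union> C - {b}) = (W \<union> (C - {b})) \<union> B" using b disj by blast
        ultimately have "b \<in> fun_space.span ((W \<union> (C - {b})) \<union> B)" by simp
        then have "b \<in> fun_space.span (W \<union> (C - {b}))"
          by (rule indep_mod_cancel[OF B(2) B'(3), rotated 2]) (use b C'(1) assms(5) in auto)
        then show False using C'(3) b by (simp add: indep_mod_def)
      qed
    qed
  qed
  ultimately show "basis_mod V W (B \<union> C)"
    using B' C'(1) assms(6) unfolding basis_mod_iff by blast
qed

lemma quot_dim_add:
  assumes F: "finite F" "V \<subseteq> fun_space.span (W \<union> F)" and "W \<subseteq> U" "U \<subseteq> V"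
  shows "quot_dim V W = quot_dim V U + quot_dim U W"
proof -
  have "V \<subseteq> fun_space.span (U \<union> F)" using F(2) fun_space.span_mono[of "W \<union> F" "U \<union> F"] assms(3) by blast
  then obtain B where B: "basis_mod V U B" "finite B" by (rule basis_mod_exists[OF F(1)])
  have "U \<subseteq> fun_space.span (W \<union> F)" using F(2) assms(4) by blast
  then obtain C where C: "basis_mod U W C" "finite C" by (rule basis_mod_exists[OF F(1)])
  note BC = basis_mod_trans[OF B C assms(3,4)]
  show ?thesis
    using quot_dim_eq_card[OF BC(1)] quot_dim_eq_card[OF B] quot_dim_eq_card[OF C] B(2) C(2) BC(2)
    by (simp add: card_Un_disjoint)
qed

text \<open>A linear map that induces an isomorphism \<open>V/W \<rightarrow> V'/W'\<close> carries bases to bases.\<close>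

lemma basis_mod_image:
  fixes T :: "('a \<Rightarrow> complex) \<Rightarrow> ('b \<Rightarrow> complex)"
  assumes lin: "Vector_Spaces.linear fun_scale fun_scale T"
    and sub: "fun_space.subspace V" "fun_space.subspace W'" and WV: "W \<subseteq> V"
    and im: "T ` V \<subseteq> V'" and gen: "V' \<subseteq> fun_space.span (W' \<union> T ` V)"
    and ker: "\<And>x. x \<in> V \<Longrightarrow> T x \<in> W' \<longleftrightarrow> x \<in> W"
    and B: "basis_mod V W B"
  shows "basis_mod V' W' (T ` B)" "inj_on T B"
proof -
  interpret T: Vector_Spaces.linear fun_scale fun_scale T by (rule lin)
  have B': "B \<subseteq> V" "V \<subseteq> fun_space.span (W \<union> B)" "indep_mod W B" using B by (auto simp: basis_mod_iff)
  have key: "b \<in> fun_space.span (W \<union> C)" if b: "b \<in> B" and C: "C \<subseteq> B" and Tb: "T b \<in> fun_space.span (W' \<union> T ` C)" for b C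
  proof -
    obtain w y where wy: "T b = w + y" "w \<in> fun_space.span W'" "y \<in> fun_space.span (T ` C)"
      using Tb unfolding fun_space.span_Un by blast
    then obtain c where c: "y = T c" "c \<in> fun_space.span C" unfolding T.span_image by blast
    have cV: "c \<in> V" using c(2) fun_space.span_minimal[of C V] C B'(1) sub(1) by blast
    have "T (b - c) = w" using wy(1) c(1) by (simp add: T.diff)
    also have "w \<in> W'" using wy(2) fun_space.span_minimal[OF subset_refl sub(2)] by blast
    finally have "b - c \<in> W"
      using ker[of "b - c"] fun_space.subspace_diff[OF sub(1)] b B'(1) cV by blast
    then have "(b - c) + c \<in> fun_space.span (W \<union> C)"
      using c(2) fun_space.span_mono[of C "W \<union> C"] by (intro fun_space.span_add) (auto intro: fun_space.span_base)
    then show ?thesis by simp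
  qed
  show inj: "inj_on T B"
  proof (rule inj_onI, rule ccontr)
    fix b c assume bc: "b \<in> B" "c \<in> B" "T b = T c" "b \<noteq> c"
    have "T b \<in> fun_space.span (W' \<union> T ` {c})" using bc(3) by (simp add: fun_space.span_base)
    then have "b \<in> fun_space.span (W \<union> {c})" using key[OF bc(1), of "{c}"] bc(2) by blast
    moreover have "W \<union> {c} \<subseteq> W \<union> (B - {b})" using bc by blast
    ultimately show False using B'(3) bc(1) fun_space.span_mono unfolding indep_mod_def by blast
  qed
  have "W' \<union> T ` V \<subseteq> fun_space.span (W' \<union> T ` B)"
  proof -
    have "T ` V \<subseteq> fun_space.span (T ` (W \<union> B))" unfolding T.span_image using B'(2) by blast
    also have "\<dots> \<subseteq> fun_space.span (W' \<union> T ` B)"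
      by (rule fun_space.span_mono) (use ker WV in blast)
    finally show ?thesis using fun_space.span_superset[of "W' \<union> T ` B"] by blast
  qed
  then have "fun_space.span (W' \<union> T ` V) \<subseteq> fun_space.span (W' \<union> T ` B)"
    by (rule fun_space.span_minimal) (rule fun_space.subspace_span)
  moreover have "indep_mod W' (T ` B)"
    unfolding indep_mod_def
  proof (clarify)
    fix b assume b: "b \<in> B" "T b \<in> fun_space.span (W' \<union> (T ` B - {T b}))"
    have "T ` B - {T b} = T ` (B - {b})" using inj b(1) by (auto simp: inj_on_def)
    with b have "b \<in> fun_space.span (W \<union> (B - {b}))" using key[of b "B - {b}"] by auto
    with B'(3) b(1) show False by (simp add: indep_mod_def)
  qed
  ultimately show "basis_mod V' W' (T ` B)" using gen im B'(1) unfolding basis_mod_iff by blast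
qed

section \<open>The ideals of the divisorial filtration\<close>

lemma div_ideal_iff:
  "g \<in> div_ideal node v \<longleftrightarrow> holo_germ g \<and> (\<forall>i. enat (nat (v i)) \<le> exc_val (node i) g)"
  by (simp add: div_ideal_def div_val_eq_exc_val)

lemma div_ideal_antimono: "(\<And>i. v i \<le> w i) \<Longrightarrow> div_ideal node w \<subseteq> div_ideal node v"
proof (clarsimp simp: div_ideal_iff)
  fix g i assume le: "\<And>i. v i \<le> w i" and g: "\<forall>i. enat (nat (w i)) \<le> exc_val (node i) g"
  have "enat (nat (v i)) \<le> enat (nat (w i))" using le[of i] by (simp add: nat_mono)
  also have "\<dots> \<le> exc_val (node i) g" using g by blast
  finally show "enat (nat (v i)) \<le> exc_val (node i) g" .
qed

lemma subspace_div_ideal: "fun_space.subspace (div_ideal node v)"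
proof (rule fun_space.subspaceI)
  show "0 \<in> div_ideal node v"
    using exc_val_zero_germ[of "\<lambda>_. 0"] by (simp add: div_ideal_iff zero_fun_def holo_germ_const)
  show "g + h \<in> div_ideal node v" if "g \<in> div_ideal node v" "h \<in> div_ideal node v" for g h
    using that by (auto simp: div_ideal_iff plus_fun_def intro: holo_germ_add le_exc_val_add)
  show "fun_scale c g \<in> div_ideal node v" if "g \<in> div_ideal node v" for c g
    using that by (auto simp: div_ideal_iff fun_scale_def intro: holo_germ_mult holo_germ_const le_exc_val_scale)
qed

text \<open>Taylor expansion: modulo the \<open>m\<close>-th power of the maximal ideal, germs are polynomials of degree less than \<open>m\<close>.\<close>

lemma holo_germ_spanned_mod_mpow:
  "\<exists>F. finite F \<and> {g. holo_germ g} \<subseteq> fun_space.span ({g. holo_germ g \<and> (\<exists>c. mpow_form m g c)} \<union> F)"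
proof (induction m)
  case 0
  have "mpow_form 0 g (\<lambda>_. g)" if "holo_germ g" for g using that by (simp add: mpow_form_def)
  then have "{g. holo_germ g} \<subseteq> {g. holo_germ g \<and> (\<exists>c. mpow_form 0 g c)} \<union> {}" by blast
  then show ?case using fun_space.span_superset by (meson finite.emptyI order_trans)
next
  case (Suc m)
  let ?I = "\<lambda>m. {g. holo_germ g \<and> (\<exists>c. mpow_form m g c)}"
  obtain F where F: "finite F" "{g. holo_germ g} \<subseteq> fun_space.span (?I m \<union> F)" using Suc by blast
  define mon where "mon = (\<lambda>j (x :: complex ^ 2). x $ 1 ^ j * x $ 2 ^ (m - j))"
  let ?F = "F \<union> mon ` {..m}"
  have "?I m \<subseteq> fun_space.span (?I (Suc m) \<union> ?F)"
  proof clarify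
    fix g c assume g: "holo_germ g" and c: "mpow_form m g c"
    define p where "p = (\<Sum>j\<le>m. fun_scale (c j 0) (mon j))"
    have p_eq: "p x = (\<Sum>j\<le>m. c j 0 * mon j x)" for x
    proof -
      have "sum h A x = (\<Sum>j\<in>A. h j x)" for h :: "nat \<Rightarrow> complex ^ 2 \<Rightarrow> complex" and A
        by (induction A rule: infinite_finite_induct) (auto simp: zero_fun_def plus_fun_def)
      then show ?thesis by (simp add: p_def fun_scale_def)
    qed
    have hp: "holo_germ p"
      unfolding p_eq[abs_def] mon_def by (intro holo_germ_sum holo_germ_mult holo_germ_power holo_germ_const holo_germ_nth)
    have hd: "holo_germ (g - p)" using holo_germ_diff[OF g hp] by (simp add: fun_diff_def)
    have "mpow_form m (g - p) (\<lambda>j x. c j x - c j 0)"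
      unfolding mpow_form_def
    proof
      show "\<forall>j. holo_germ (\<lambda>x. c j x - c j 0)"
        using c by (auto simp: mpow_form_def intro: holo_germ_diff holo_germ_const)
      show "\<forall>\<^sub>F x in nhds 0. (g - p) x = (\<Sum>j\<le>m. x $ 1 ^ j * x $ 2 ^ (m - j) * (c j x - c j 0))"
        using c[unfolded mpow_form_def, THEN conjunct2]
        by eventually_elim (simp add: p_eq mon_def algebra_simps sum_subtractf)
    qed
    from mpow_form_Suc[OF this] hd have "g - p \<in> fun_space.span (?I (Suc m) \<union> ?F)"
      by (intro fun_space.span_base) auto
    moreover have "p \<in> fun_space.span (?I (Suc m) \<union> ?F)"
      unfolding p_def by (intro fun_space.span_sum fun_space.span_scale fun_space.span_base) auto
    ultimately have "(g - p) + p \<in> fun_space.span (?I (Suc m) \<union> ?F)" by (rule fun_space.span_add)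
    then show "g \<in> fun_space.span (?I (Suc m) \<union> ?F)" by simp
  qed
  moreover have "F \<subseteq> fun_space.span (?I (Suc m) \<union> ?F)"
    using fun_space.span_superset[of "?I (Suc m) \<union> ?F"] by blast
  ultimately have "?I m \<union> F \<subseteq> fun_space.span (?I (Suc m) \<union> ?F)" by (rule Un_least)
  then have "fun_space.span (?I m \<union> F) \<subseteq> fun_space.span (?I (Suc m) \<union> ?F)"
    by (rule fun_space.span_minimal) (rule fun_space.subspace_span)
  with F(2) have "{g. holo_germ g} \<subseteq> fun_space.span (?I (Suc m) \<union> ?F)" by (rule order_trans)
  moreover have "finite ?F" using F(1) by simp
  ultimately show ?case by blast
qed

text \<open>Each \<open>J(v)\<close> has finite codimension, since it contains a power of the maximal ideal.\<close>

lemma holo_germ_spanned_mod_div_ideal: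
  fixes node :: "'r::finite \<Rightarrow> near_point"
  obtains F where "finite F" "{g. holo_germ g} \<subseteq> fun_space.span (div_ideal node v \<union> F)"
proof -
  define m where "m = Max (range (\<lambda>i. nat (v i)))"
  have m: "nat (v i) \<le> m" for i by (simp add: m_def)
  obtain F where F: "finite F" "{g. holo_germ g} \<subseteq> fun_space.span ({g. holo_germ g \<and> (\<exists>c. mpow_form m g c)} \<union> F)"
    using holo_germ_spanned_mod_mpow by blast
  have "{g. holo_germ g \<and> (\<exists>c. mpow_form m g c)} \<subseteq> div_ideal node v"
  proof (clarsimp simp: div_ideal_iff)
    fix g c i assume "holo_germ g" "mpow_form m g c"
    from mpow_form_imp_le_exc_val[OF this, of "node i"] m[of i]
    show "enat (nat (v i)) \<le> exc_val (node i) g" by (meson enat_ord_simps(1) order_trans)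
  qed
  then have "fun_space.span ({g. holo_germ g \<and> (\<exists>c. mpow_form m g c)} \<union> F) \<subseteq> fun_space.span (div_ideal node v \<union> F)"
    by (intro fun_space.span_mono) blast
  with F show ?thesis using that by blast
qed

text \<open>The function \<open>d(v) = dim \<O>/J(v)\<close>, through which all other dimensions are expressed.\<close>

definition div_codim :: "('r::finite \<Rightarrow> near_point) \<Rightarrow> ('r \<Rightarrow> int) \<Rightarrow> int" where
  "div_codim node v = int (quot_dim {g. holo_germ g} (div_ideal node v))"

lemma quot_dim_div_ideal:
  assumes "\<And>i. v i \<le> w i"
  shows "int (quot_dim (div_ideal node v) (div_ideal node w)) = div_codim node w - div_codim node v"
proof -
  obtain F where F: "finite F" "{g. holo_germ g} \<subseteq> fun_space.span (div_ideal node w \<union> F)"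
    by (rule holo_germ_spanned_mod_div_ideal)
  have "quot_dim {g. holo_germ g} (div_ideal node w) =
      quot_dim {g. holo_germ g} (div_ideal node v) + quot_dim (div_ideal node v) (div_ideal node w)"
  proof (rule quot_dim_add[OF F])
    show "div_ideal node w \<subseteq> div_ideal node v" by (rule div_ideal_antimono[OF assms])
    show "div_ideal node v \<subseteq> {g. holo_germ g}" by (auto simp: div_ideal_iff)
  qed
  then show ?thesis by (simp add: div_codim_def)
qed

lemma basis_mod_div_ideal:
  obtains B where "basis_mod (div_ideal node v) (div_ideal node w) B" "finite B"
proof -
  obtain F where F: "finite F" "{g. holo_germ g} \<subseteq> fun_space.span (div_ideal node w \<union> F)"
    by (rule holo_germ_spanned_mod_div_ideal)
  then have "div_ideal node v \<subseteq> fun_space.span (div_ideal node w \<union> F)" by (auto simp: div_ideal_iff)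
  from basis_mod_exists[OF F(1) this] show ?thesis using that by blast
qed

section \<open>The arc filtration of the double cover\<close>

text \<open>The smallest \<open>n\<close> with \<open>s\<^sub>i n + M\<^sub>i \<ge> k\<close>.  It is negative where \<open>k < M\<^sub>i\<close> by enough, which is why
  levels are integers.\<close>

definition ceiling_level :: "('r \<Rightarrow> nat) \<Rightarrow> ('r \<Rightarrow> nat) \<Rightarrow> nat \<Rightarrow> 'r \<Rightarrow> int" where
  "ceiling_level s M k i = \<lceil>(real k - real (M i)) / real (s i)\<rceil>"

lemma ceiling_level_le_iff:
  assumes "0 < s i" shows "ceiling_level s M k i \<le> n \<longleftrightarrow> int k \<le> int (s i) * n + int (M i)"
proof -
  have "ceiling_level s M k i \<le> n \<longleftrightarrow> real k - real (M i) \<le> of_int n * real (s i)"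
    using assms by (simp add: ceiling_level_def ceiling_le_iff pos_divide_le_eq)
  also have "\<dots> \<longleftrightarrow> real_of_int (int k) \<le> real_of_int (int (s i) * n + int (M i))"
    by (simp add: algebra_simps)
  finally show ?thesis by (simp only: of_int_le_iff)
qed

lemma div_ideal_ceiling_level:
  assumes "\<And>i. 0 < s i"
  shows "g \<in> div_ideal node (ceiling_level s M k) \<longleftrightarrow>
    holo_germ g \<and> (\<forall>i. \<exists>n. enat n \<le> exc_val (node i) g \<and> k \<le> s i * n + M i)"
proof -
  have "enat (nat (ceiling_level s M k i)) \<le> e \<longleftrightarrow> (\<exists>n. enat n \<le> e \<and> k \<le> s i * n + M i)" for i e
  proof
    assume le: "enat (nat (ceiling_level s M k i)) \<le> e"
    have "ceiling_level s M k i \<le> int (nat (ceiling_level s M k i))" by simp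
    then have "int k \<le> int (s i) * int (nat (ceiling_level s M k i)) + int (M i)"
      unfolding ceiling_level_le_iff[of s i, OF assms] .
    then have "k \<le> s i * nat (ceiling_level s M k i) + M i"
      unfolding of_nat_mult[symmetric] of_nat_add[symmetric] of_nat_le_iff .
    with le show "\<exists>n. enat n \<le> e \<and> k \<le> s i * n + M i" by blast
  next
    assume "\<exists>n. enat n \<le> e \<and> k \<le> s i * n + M i"
    then obtain n where n: "enat n \<le> e" "k \<le> s i * n + M i" by blast
    have "int k \<le> int (s i) * int n + int (M i)"
      unfolding of_nat_mult[symmetric] of_nat_add[symmetric] of_nat_le_iff by (rule n(2))
    then have "ceiling_level s M k i \<le> int n" unfolding ceiling_level_le_iff[of s i, OF assms] .
    then have "nat (ceiling_level s M k i) \<le> n" by simp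
    then show "enat (nat (ceiling_level s M k i)) \<le> e" using n(1) by (meson enat_ord_simps(1) order_trans)
  qed
  then show ?thesis by (simp add: div_ideal_iff)
qed

definition base_proj :: "complex ^ 3 \<Rightarrow> complex ^ 2" where "base_proj x = vector [x $ 1, x $ 2]"

definition decomposes :: "(complex ^ 2 \<Rightarrow> complex) \<Rightarrow> (complex ^ 3 \<Rightarrow> complex) \<Rightarrow>
    (complex ^ 2 \<Rightarrow> complex) \<Rightarrow> (complex ^ 2 \<Rightarrow> complex) \<Rightarrow> bool" where
  "decomposes f g a b \<longleftrightarrow>
     (\<forall>\<^sub>F x in nhds 0. x \<in> stabilization f \<longrightarrow> g x = a (base_proj x) + x $ 3 * b (base_proj x))"

lemma holo_germ_decomposition:
  assumes "holo_germ a" "holo_germ b"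
  shows "holo_germ (\<lambda>x. a (base_proj x) + x $ 3 * b (base_proj x))"
proof -
  have 1: "holo_germ (\<lambda>x. base_proj x $ i)" for i
    unfolding base_proj_def by (intro holo_germ_vector_2 holo_germ_nth)
  have 0: "base_proj 0 = 0" by (simp add: base_proj_def)
  show ?thesis
    by (intro holo_germ_add holo_germ_mult holo_germ_nth
        holo_germ_compose[where G = a, OF 1 0 assms(1)] holo_germ_compose[where G = b, OF 1 0 assms(2)])
qed

lemma germ_ring_stabilization_iff:
  assumes "holo_germ f" "f 0 = 0"
  shows "g \<in> germ_ring (stabilization f) \<longleftrightarrow> (\<exists>a b. holo_germ a \<and> holo_germ b \<and> decomposes f g a b)"
proof
  assume "g \<in> germ_ring (stabilization f)"
  then obtain G where G: "holo_germ G" "\<forall>\<^sub>F x in nhds 0. x \<in> stabilization f \<longrightarrow> g x = G x"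
    by (auto simp: germ_ring_def)
  obtain a b :: "complex ^ 2 \<Rightarrow> complex" where ab: "holo_germ a" "holo_germ b" "\<forall>\<^sub>F x in nhds 0. x \<in> stabilization f \<longrightarrow>
      G x = a (vector [x $ 1, x $ 2]) + x $ 3 * b (vector [x $ 1, x $ 2])"
    by (rule double_cover_decomposition[OF G(1) assms])
  have "decomposes f g a b" unfolding decomposes_def base_proj_def
    using G(2) ab(3) by eventually_elim simp
  with ab show "\<exists>a b. holo_germ a \<and> holo_germ b \<and> decomposes f g a b" by blast
next
  assume "\<exists>a b. holo_germ a \<and> holo_germ b \<and> decomposes f g a b"
  then show "g \<in> germ_ring (stabilization f)"
    unfolding germ_ring_def decomposes_def using holo_germ_decomposition by blast
qed

text \<open>An arc on \<open>S\<close> is the same as an arc in the plane with a square root of \<open>f\<close> along it; that the square root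
  vanishes at \<open>0\<close> follows from \<open>f 0 = 0\<close>.\<close>

lemma le_arc_val_stabilization_iff:
  assumes f: "f 0 = 0" and a: "holo_germ a" and b: "holo_germ b" and dec: "decomposes f g a b"
  shows "enat k \<le> arc_val (stabilization f) g \<longleftrightarrow>
    (\<forall>\<alpha> \<zeta>. arc_on UNIV \<alpha> \<longrightarrow> \<zeta> analytic_on {0} \<longrightarrow> (\<forall>\<^sub>F t in nhds 0. (\<zeta> t)\<^sup>2 = f (\<alpha> t)) \<longrightarrow>
      vanishes_to k (\<lambda>t. a (\<alpha> t) + \<zeta> t * b (\<alpha> t)))"
proof -
  have order: "enat k \<le> order_at_0 (g \<circ> \<phi>) \<longleftrightarrow>
      vanishes_to k (\<lambda>t. a (base_proj (\<phi> t)) + \<phi> t $ 3 * b (base_proj (\<phi> t)))"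
    if \<phi>: "arc_on (stabilization f) \<phi>" for \<phi>
  proof -
    have "\<forall>\<^sub>F t in nhds 0. \<phi> t \<in> stabilization f" using \<phi> by (simp add: arc_on_def)
    with eventually_compose_filterlim[OF dec[unfolded decomposes_def] arc_filterlim[OF \<phi>]]
    have "\<forall>\<^sub>F t in nhds 0. (g \<circ> \<phi>) t = a (base_proj (\<phi> t)) + \<phi> t $ 3 * b (base_proj (\<phi> t))"
      by eventually_elim simp
    from order_at_0_cong[OF this] show ?thesis
      by (simp only: le_order_at_0_iff[OF analytic_compose_arc[OF \<phi> holo_germ_decomposition[OF a b]]])
  qed
  have "enat k \<le> arc_val (stabilization f) g \<longleftrightarrow>
      (\<forall>\<phi>. arc_on (stabilization f) \<phi> \<longrightarrow> enat k \<le> order_at_0 (g \<circ> \<phi>))"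
    by (simp add: arc_val_def le_INF_iff)
  also have "\<dots> \<longleftrightarrow> (\<forall>\<phi>. arc_on (stabilization f) \<phi> \<longrightarrow>
      vanishes_to k (\<lambda>t. a (base_proj (\<phi> t)) + \<phi> t $ 3 * b (base_proj (\<phi> t))))"
    using order by blast
  also have "\<dots> \<longleftrightarrow> (\<forall>\<alpha> \<zeta>. arc_on UNIV \<alpha> \<longrightarrow> \<zeta> analytic_on {0} \<longrightarrow> (\<forall>\<^sub>F t in nhds 0. (\<zeta> t)\<^sup>2 = f (\<alpha> t)) \<longrightarrow>
      vanishes_to k (\<lambda>t. a (\<alpha> t) + \<zeta> t * b (\<alpha> t)))" (is "?L \<longleftrightarrow> ?R")
  proof
    assume L: ?L
    show ?R
    proof (intro allI impI)
      fix \<alpha> \<zeta> assume \<alpha>: "arc_on UNIV \<alpha>" and \<zeta>: "\<zeta> analytic_on {0}" "\<forall>\<^sub>F t in nhds 0. (\<zeta> t)\<^sup>2 = f (\<alpha> t)"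
      define \<phi> where "\<phi> = (\<lambda>t. vector [\<alpha> t $ 1, \<alpha> t $ 2, \<zeta> t] :: complex ^ 3)"
      have \<alpha>0: "\<alpha> 0 = 0" using \<alpha> by (simp add: arc_on_def)
      have "(\<zeta> 0)\<^sup>2 = f (\<alpha> 0)" using \<zeta>(2) by (rule eventually_nhds_x_imp_x)
      then have \<zeta>0: "\<zeta> 0 = 0" by (simp add: \<alpha>0 f)
      have "(\<lambda>t. \<phi> t $ i) analytic_on {0}" for i
        using exhaust_3[of i] \<alpha> \<zeta>(1) by (auto simp: \<phi>_def arc_on_def)
      moreover have "\<phi> 0 = 0" by (simp add: \<phi>_def \<alpha>0 \<zeta>0 vec_eq_iff forall_3)
      moreover have "\<forall>\<^sub>F t in nhds 0. \<phi> t \<in> stabilization f"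
        using \<zeta>(2) by eventually_elim (simp add: stabilization_def \<phi>_def)
      ultimately have "arc_on (stabilization f) \<phi>" by (simp add: arc_on_def)
      with L have "vanishes_to k (\<lambda>t. a (base_proj (\<phi> t)) + \<phi> t $ 3 * b (base_proj (\<phi> t)))" by blast
      then show "vanishes_to k (\<lambda>t. a (\<alpha> t) + \<zeta> t * b (\<alpha> t))" by (simp add: \<phi>_def base_proj_def)
    qed
  next
    assume R: ?R
    show ?L
    proof (intro allI impI)
      fix \<phi> assume \<phi>: "arc_on (stabilization f) \<phi>"
      have "arc_on UNIV (\<lambda>t. base_proj (\<phi> t))"
        using \<phi> by (auto simp: arc_on_def base_proj_def intro!: analytic_vector_2)
      moreover have "(\<lambda>t. \<phi> t $ 3) analytic_on {0}" using \<phi> by (simp add: arc_on_def)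
      moreover have "\<forall>\<^sub>F t in nhds 0. \<phi> t \<in> stabilization f" using \<phi> by (simp add: arc_on_def)
      then have "\<forall>\<^sub>F t in nhds 0. (\<phi> t $ 3)\<^sup>2 = f (base_proj (\<phi> t))"
        by eventually_elim (simp add: stabilization_def base_proj_def)
      ultimately show "vanishes_to k (\<lambda>t. a (base_proj (\<phi> t)) + \<phi> t $ 3 * b (base_proj (\<phi> t)))"
        using R by blast
    qed
  qed
  finally show ?thesis .
qed

text \<open>The number \<open>\<sigma>\<^sub>i m\<^sub>i / 2\<close>, an integer by the choice of \<open>\<sigma>\<^sub>i\<close>.\<close>

definition cover_shift :: "(complex ^ 2 \<Rightarrow> complex) \<Rightarrow> near_point \<Rightarrow> nat" where
  "cover_shift f p = parity_factor f p * exc_mult f p div 2"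

lemma two_cover_shift: "2 * cover_shift f p = parity_factor f p * exc_mult f p"
  by (simp add: cover_shift_def parity_factor_def)

lemma parity_factor_pos [simp]: "0 < parity_factor f p"
  by (simp add: parity_factor_def)

lemma arc_filtration_stabilization_iff:
  fixes node :: "'r::finite \<Rightarrow> near_point"
  assumes f: "holo_germ f" "\<exists>\<^sub>F x in nhds 0. f x \<noteq> 0" "f 0 = 0" and node: "blowup_centres node"
    and strict: "strict_curve_points node f \<subseteq> (\<Union>i\<in>{i. even (exc_mult f (node i))}. exc_component node i)"
    and a: "holo_germ a" and b: "holo_germ b" and dec: "decomposes f g a b"
  shows "g \<in> arc_filtration (stabilization f) k \<longleftrightarrow>
    a \<in> div_ideal node (ceiling_level (parity_factor f \<circ> node) (\<lambda>i. 0) k) \<and>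
    b \<in> div_ideal node (ceiling_level (parity_factor f \<circ> node) (cover_shift f \<circ> node) k)"
proof -
  let ?s = "\<lambda>i. parity_factor f (node i)"
  have shift: "k \<le> ?s i * n + cover_shift f (node i) \<longleftrightarrow> 2 * k \<le> ?s i * (2 * n + exc_mult f (node i))" for i n
    using two_cover_shift[of f "node i"] by (simp add: add_mult_distrib2 mult.left_commute) linarith
  have ring: "g \<in> germ_ring (stabilization f)"
    using a b dec germ_ring_stabilization_iff[OF f(1,3)] by blast
  have "enat k \<le> arc_val (stabilization f) g \<longleftrightarrow>
      (\<forall>i. \<exists>n. enat n \<le> exc_val (node i) a \<and> k \<le> ?s i * n) \<and>
      (\<forall>i. \<exists>n. enat n \<le> exc_val (node i) b \<and> 2 * k \<le> ?s i * (2 * n + exc_mult f (node i)))"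
    (is "_ \<longleftrightarrow> ?R")
  proof
    assume "enat k \<le> arc_val (stabilization f) g"
    then show ?R
      unfolding le_arc_val_stabilization_iff[OF f(3) a b dec]
      using vanishing_on_double_cover_bounds[OF f(1,2) a b, of k] by blast
  next
    assume R: ?R
    have inj: "inj node" using node by (simp add: blowup_centres_def)
    from R have Ra: "\<forall>i. \<exists>n. enat n \<le> exc_val (node i) a \<and> k \<le> ?s i * n"
      and Rb: "\<forall>i. \<exists>n. enat n \<le> exc_val (node i) b \<and> 2 * k \<le> ?s i * (2 * n + exc_mult f (node i))" by blast+
    from choice[OF Ra] obtain na where na: "\<forall>i. enat (na i) \<le> exc_val (node i) a \<and> k \<le> ?s i * na i" ..
    from choice[OF Rb] obtain nb where
      nb: "\<forall>i. enat (nb i) \<le> exc_val (node i) b \<and> 2 * k \<le> ?s i * (2 * nb i + exc_mult f (node i))" ..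
    have "vanishes_to k (\<lambda>t. a (\<alpha> t) + \<zeta> t * b (\<alpha> t))"
      if "arc_on UNIV \<alpha>" "\<zeta> analytic_on {0}" "\<forall>\<^sub>F t in nhds 0. (\<zeta> t)\<^sup>2 = f (\<alpha> t)" for \<alpha> \<zeta>
      by (rule vanishes_to_on_double_cover[OF f node strict a b, where Na = "na \<circ> inv node" and Nb = "nb \<circ> inv node"])
         (use na nb inj that in auto)
    then show "enat k \<le> arc_val (stabilization f) g"
      unfolding le_arc_val_stabilization_iff[OF f(3) a b dec] by blast
  qed
  then show ?thesis
    using ring a b by (simp add: arc_filtration_def div_ideal_ceiling_level shift)
qed

lemma decomposes_diff:
  "decomposes f g a b \<Longrightarrow> decomposes f g' a' b' \<Longrightarrow> decomposes f (g - g') (a - a') (b - b')"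
  unfolding decomposes_def by (erule (1) eventually_elim2) (simp add: algebra_simps)

lemma subspace_decomposable:
  assumes "fun_space.subspace A" "fun_space.subspace B"
  shows "fun_space.subspace {g. \<exists>a\<in>A. \<exists>b\<in>B. decomposes f g a b}"
proof (rule fun_space.subspaceI)
  have "decomposes f 0 0 0" by (simp add: decomposes_def)
  then show "0 \<in> {g. \<exists>a\<in>A. \<exists>b\<in>B. decomposes f g a b}"
    using fun_space.subspace_0[OF assms(1)] fun_space.subspace_0[OF assms(2)] by blast
next
  fix g g' assume "g \<in> {g. \<exists>a\<in>A. \<exists>b\<in>B. decomposes f g a b}" "g' \<in> {g. \<exists>a\<in>A. \<exists>b\<in>B. decomposes f g a b}"
  then obtain a b a' b' where *: "a \<in> A" "b \<in> B" "decomposes f g a b" "a' \<in> A" "b' \<in> B" "decomposes f g' a' b'"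
    by blast
  have "decomposes f (g + g') (a + a') (b + b')"
    using *(3,6) unfolding decomposes_def by (rule eventually_elim2) (simp add: algebra_simps)
  then show "g + g' \<in> {g. \<exists>a\<in>A. \<exists>b\<in>B. decomposes f g a b}"
    using * fun_space.subspace_add[OF assms(1)] fun_space.subspace_add[OF assms(2)] by blast
next
  fix c g assume "g \<in> {g. \<exists>a\<in>A. \<exists>b\<in>B. decomposes f g a b}"
  then obtain a b where *: "a \<in> A" "b \<in> B" "decomposes f g a b" by blast
  have "decomposes f (fun_scale c g) (fun_scale c a) (fun_scale c b)"
    using *(3) unfolding decomposes_def by (rule eventually_mono) (simp add: fun_scale_def algebra_simps)
  then show "fun_scale c g \<in> {g. \<exists>a\<in>A. \<exists>b\<in>B. decomposes f g a b}"
    using * fun_space.subspace_scale[OF assms(1)] fun_space.subspace_scale[OF assms(2)] by blast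
qed

lemma linear_fun_spaceI:
  assumes "\<And>g h. T (g + h) = T g + T h" "\<And>c g. T (fun_scale c g) = fun_scale c (T g)"
  shows "Vector_Spaces.linear fun_scale fun_scale T"
  by unfold_locales (use assms in auto)

text \<open>The subspace \<open>U\<close> of all \<open>a + z b\<close> with \<open>a \<in> I(k+1)\<close> and \<open>b \<in> I'(k)\<close> lies between \<open>F\<^bsub>k+1\<^esub>\<close> and \<open>F\<^sub>k\<close>.  The
  quotient \<open>F\<^sub>k/U\<close> is \<open>I(k)/I(k+1)\<close> through \<open>a \<mapsto> a\<close>, and \<open>U/F\<^bsub>k+1\<^esub>\<close> is \<open>I'(k)/I'(k+1)\<close> through \<open>b \<mapsto> z b\<close>.  The
  choice of \<open>(a,b)\<close> for a given function is immaterial: two choices differ by a decomposition of \<open>0\<close>, and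
  \<open>0\<close> lies in all \<open>F\<^sub>j\<close>.\<close>

lemma quot_dim_arc_filtration:
  fixes node :: "'r::finite \<Rightarrow> near_point"
  assumes f: "holo_germ f" "\<exists>\<^sub>F x in nhds 0. f x \<noteq> 0" "f 0 = 0" and node: "blowup_centres node"
    and strict: "strict_curve_points node f \<subseteq> (\<Union>i\<in>{i. even (exc_mult f (node i))}. exc_component node i)"
  defines "I \<equiv> \<lambda>k. div_ideal node (ceiling_level (parity_factor f \<circ> node) (\<lambda>i. 0) k)"
    and "I' \<equiv> \<lambda>k. div_ideal node (ceiling_level (parity_factor f \<circ> node) (cover_shift f \<circ> node) k)"
  shows "quot_dim (arc_filtration (stabilization f) k) (arc_filtration (stabilization f) (Suc k)) =
    quot_dim (I k) (I (Suc k)) + quot_dim (I' k) (I' (Suc k))"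
proof -
  let ?F = "arc_filtration (stabilization f)"
  have mem: "g \<in> ?F k \<longleftrightarrow> a \<in> I k \<and> b \<in> I' k" if "holo_germ a" "holo_germ b" "decomposes f g a b" for g a b k
    unfolding I_def I'_def by (rule arc_filtration_stabilization_iff[OF f node strict that])
  have holI: "holo_germ a" if "a \<in> I k" for a k using that by (simp add: I_def div_ideal_iff)
  have holI': "holo_germ a" if "a \<in> I' k" for a k using that by (simp add: I'_def div_ideal_iff)
  have subI: "fun_space.subspace (I k)" "fun_space.subspace (I' k)" for k
    unfolding I_def I'_def by (rule subspace_div_ideal)+
  have F_eq: "?F k = {g. \<exists>a\<in>I k. \<exists>b\<in>I' k. decomposes f g a b}" for k
  proof (intro set_eqI iffI)
    fix g assume g: "g \<in> ?F k"
    then have "g \<in> germ_ring (stabilization f)" by (simp add: arc_filtration_def)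
    then obtain a b where "holo_germ a" "holo_germ b" "decomposes f g a b"
      using germ_ring_stabilization_iff[OF f(1,3)] by blast
    with g mem show "g \<in> {g. \<exists>a\<in>I k. \<exists>b\<in>I' k. decomposes f g a b}" by blast
  next
    fix g assume "g \<in> {g. \<exists>a\<in>I k. \<exists>b\<in>I' k. decomposes f g a b}"
    then show "g \<in> ?F k" using mem holI holI' by blast
  qed
  have antimono: "I (Suc k) \<subseteq> I k" "I' (Suc k) \<subseteq> I' k"
    unfolding I_def I'_def
    by (intro div_ideal_antimono; simp add: ceiling_level_def ceiling_mono divide_right_mono)+
  define U where "U = {g. \<exists>a\<in>I (Suc k). \<exists>b\<in>I' k. decomposes f g a b}"
  have subU: "fun_space.subspace U" unfolding U_def by (intro subspace_decomposable subI)
  have subF: "fun_space.subspace (?F k)" for k unfolding F_eq by (intro subspace_decomposable subI)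
  have zero: "0 \<in> I k" "0 \<in> I' k" for k using fun_space.subspace_0 subI by blast+
  have unique: "a \<in> I j" if "decomposes f 0 a b" "holo_germ a" "holo_germ b" for a b j
    using mem[OF that(2,3,1), of j] fun_space.subspace_0[OF subF] by blast
  define T where "T = (\<lambda>a :: complex ^ 2 \<Rightarrow> complex. \<lambda>x. a (base_proj x))"
  define T' where "T' = (\<lambda>b :: complex ^ 2 \<Rightarrow> complex. \<lambda>x :: complex ^ 3. x $ 3 * b (base_proj x))"
  have decT: "decomposes f (T a) a 0" "decomposes f (T' b) 0 b" for a b
    by (simp_all add: decomposes_def T_def T'_def)
  have linT: "Vector_Spaces.linear fun_scale fun_scale T" "Vector_Spaces.linear fun_scale fun_scale T'"
    by (rule linear_fun_spaceI; simp add: T_def T'_def fun_scale_def fun_eq_iff algebra_simps)+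
  obtain B where B: "basis_mod (I k) (I (Suc k)) B" "finite B"
    unfolding I_def by (rule basis_mod_div_ideal)
  obtain C where C: "basis_mod (I' k) (I' (Suc k)) C" "finite C"
    unfolding I'_def by (rule basis_mod_div_ideal)
  have imT: "T ` I k \<subseteq> ?F k" unfolding F_eq using decT(1) zero(2) by blast
  have genT: "?F k \<subseteq> fun_space.span (U \<union> T ` I k)"
  proof
      fix g assume "g \<in> ?F k"
      then obtain a b where ab: "a \<in> I k" "b \<in> I' k" "decomposes f g a b" unfolding F_eq by blast
      have "g - T a \<in> U" unfolding U_def using decomposes_diff[OF ab(3) decT(1)[of a]] zero(1) ab(2) by force
      then have "(g - T a) + T a \<in> fun_space.span (U \<union> T ` I k)"
        using ab(1) by (intro fun_space.span_add) (auto intro: fun_space.span_base)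
      then show "g \<in> fun_space.span (U \<union> T ` I k)" by simp
  qed
  have kerT: "T a \<in> U \<longleftrightarrow> a \<in> I (Suc k)" if a: "a \<in> I k" for a
  proof
      assume "T a \<in> U"
      then obtain a' b where ab: "a' \<in> I (Suc k)" "b \<in> I' k" "decomposes f (T a) a' b" unfolding U_def by blast
      have "decomposes f 0 (a - a') (0 - b)" using decomposes_diff[OF decT(1)[of a] ab(3)] by simp
      moreover have "holo_germ (a - a')" "holo_germ (0 - b)"
        using holI[OF fun_space.subspace_diff[OF subI(1)]] a ab(1) antimono(1) holI'[OF fun_space.subspace_diff[OF subI(2) zero(2)]] ab(2)
        by blast+
      ultimately have "a - a' \<in> I (Suc k)" by (rule unique)
      from fun_space.subspace_add[OF subI(1) this ab(1)] show "a \<in> I (Suc k)" by simp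
    next
      assume "a \<in> I (Suc k)"
      then show "T a \<in> U" unfolding U_def using decT(1) zero(2) by blast
  qed
  note TB = basis_mod_image[OF linT(1) subI(1) subU antimono(1) imT genT kerT B(1)]
  have UF: "?F (Suc k) \<subseteq> U" "U \<subseteq> ?F k" unfolding F_eq U_def using antimono by blast+
  have imT': "T' ` I' k \<subseteq> U" unfolding U_def using decT(2) zero(1) by blast
  have genT': "U \<subseteq> fun_space.span (?F (Suc k) \<union> T' ` I' k)"
  proof
      fix g assume "g \<in> U"
      then obtain a b where ab: "a \<in> I (Suc k)" "b \<in> I' k" "decomposes f g a b" unfolding U_def by blast
      have "g - T' b \<in> ?F (Suc k)" unfolding F_eq using decomposes_diff[OF ab(3) decT(2)[of b]] zero(2) ab(1) by force
      then have "(g - T' b) + T' b \<in> fun_space.span (?F (Suc k) \<union> T' ` I' k)"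
        using ab(2) by (intro fun_space.span_add) (auto intro: fun_space.span_base)
      then show "g \<in> fun_space.span (?F (Suc k) \<union> T' ` I' k)" by simp
  qed
  have kerT': "T' b \<in> ?F (Suc k) \<longleftrightarrow> b \<in> I' (Suc k)" if b: "b \<in> I' k" for b
    using mem[OF _ _ decT(2)] holI[OF zero(1)] holI'[OF b] zero(1) by blast
  note TC = basis_mod_image[OF linT(2) subI(2) subF antimono(2) imT' genT' kerT' C(1)]
  note BC = basis_mod_trans[OF TB(1) _ TC(1) _ UF]
  have "quot_dim (?F k) (?F (Suc k)) = card (T ` B \<union> T' ` C)"
    by (rule quot_dim_eq_card[OF BC(1)]) (use B(2) C(2) in auto)
  also have "\<dots> = card B + card C"
    using BC(2) B(2) C(2) TB(2) TC(2) by (simp add: card_Un_disjoint card_image)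
  finally show ?thesis using quot_dim_eq_card[OF B] quot_dim_eq_card[OF C] by simp
qed

section \<open>Alternating sums over cubes\<close>

definition cube_corner :: "('r \<Rightarrow> int) \<Rightarrow> 'r set \<Rightarrow> 'r \<Rightarrow> int" where
  "cube_corner v K = (\<lambda>i. v i + (if i \<in> K then 1 else 0))"

text \<open>Up to sign, the mixed difference of \<open>d\<close> in all directions.\<close>

definition cube_sum :: "(('r::finite \<Rightarrow> int) \<Rightarrow> int) \<Rightarrow> ('r \<Rightarrow> int) \<Rightarrow> int" where
  "cube_sum d v = (\<Sum>K\<in>UNIV. (-1) ^ card K * d (cube_corner v K))"

text \<open>The terms for \<open>K\<close> with and without \<open>i\<close> cancel.\<close>

lemma cube_sum_eq_zero:
  fixes d :: "('r::finite \<Rightarrow> int) \<Rightarrow> int"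
  assumes "\<And>K. d (cube_corner v (insert i K)) = d (cube_corner v K)"
  shows "cube_sum d v = 0"
proof -
  \<comment> \<open>The involution that pairs the terms.\<close>
  define tog where "tog = (\<lambda>K. if i \<in> K then K - {i} else insert i K)"
  have tog_tog: "tog (tog K) = K" for K by (auto simp: tog_def)
  have "cube_sum d v = (\<Sum>K\<in>UNIV. - ((-1) ^ card K * d (cube_corner v K)))"
    unfolding cube_sum_def
  proof (rule sum.reindex_bij_witness[of _ tog tog])
    fix K :: "'r set"
    show "- ((-1) ^ card (tog K) * d (cube_corner v (tog K))) = (-1) ^ card K * d (cube_corner v K)"
    proof (cases "i \<in> K")
      case True
      then have "card K = Suc (card (K - {i}))" by (intro card.remove finite)
      then have "(-1 :: int) ^ card K = - ((-1) ^ card (K - {i}))" by (simp only: power_Suc mult_minus1)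
      moreover have "d (cube_corner v K) = d (cube_corner v (K - {i}))"
        using assms[of "K - {i}"] True by (simp add: insert_absorb)
      moreover have "tog K = K - {i}" using True by (simp add: tog_def)
      ultimately show ?thesis by (simp only: mult_minus_left)
    next
      case False
      then show ?thesis using assms[of K] by (simp add: tog_def)
    qed
  qed (simp_all add: tog_tog)
  then show ?thesis by (simp add: sum_negf flip: cube_sum_def)
qed

lemma alternating_sum_Pow:
  "finite S \<Longrightarrow> (\<Sum>K\<in>Pow S. (-1) ^ card K) = (if S = {} then 1 else (0 :: int))"
proof (induction S rule: finite_induct)
  case (insert a S)
  have fin: "finite K" if "K \<subseteq> S" for K using that insert.hyps finite_subset by blast
  have "(\<Sum>K\<in>insert a ` Pow S. (-1) ^ card K) = (\<Sum>K\<in>Pow S. - ((-1) ^ card K :: int))"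
  proof (subst sum.reindex)
    show "inj_on (insert a) (Pow S)" using insert.hyps by (auto simp: inj_on_def)
    have "card (insert a K) = Suc (card K)" if "K \<in> Pow S" for K
      using that insert.hyps fin[of K] by (intro card_insert_disjoint) auto
    then show "sum ((\<lambda>K. (-1) ^ card K) \<circ> insert a) (Pow S) = (\<Sum>K\<in>Pow S. - ((-1) ^ card K :: int))"
      by (intro sum.cong) auto
  qed
  moreover have "Pow S \<inter> insert a ` Pow S = {}" using insert.hyps by blast
  ultimately show ?case using insert.hyps
    by (simp add: Pow_insert sum.union_disjoint sum_negf)
qed simp

text \<open>Moebius inversion: the value \<open>G(w)\<close> occurs once for each \<open>K\<close> with \<open>w - 1\<^sub>K \<ge> a\<close>, with the sign of \<open>K\<close>.  These
  \<open>K\<close> are all subsets of \<open>{i. a\<^sub>i < w\<^sub>i}\<close>, so only \<open>w = a\<close> survives.\<close>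

lemma sum_cube_sum:
  fixes G :: "('r::finite \<Rightarrow> int) \<Rightarrow> int"
  assumes supp: "\<And>w j. (\<And>i. a i \<le> w i) \<Longrightarrow> N \<le> w j \<Longrightarrow> G w = 0"
  defines "X \<equiv> {w. \<forall>i. a i \<le> w i \<and> w i < N}"
  shows "finite X" "(\<Sum>v\<in>X. cube_sum G v) = G a"
proof -
  have "X = PiE UNIV (\<lambda>i. {a i..<N})" by (auto simp: X_def PiE_UNIV_domain)
  then show fin: "finite X" by (simp add: finite_PiE)
  have out: "G w = 0" if "\<And>i. a i \<le> w i" "w \<notin> X" for w
    using that supp[of w] by (auto simp: X_def not_less)
  have inner: "(\<Sum>v\<in>X. G (cube_corner v K)) = (\<Sum>w\<in>X. if K \<subseteq> {i. a i < w i} then G w else 0)" for K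
  proof -
    have "(\<Sum>v\<in>X. G (cube_corner v K)) = (\<Sum>w\<in>(\<lambda>v. cube_corner v K) ` X. G w)"
      by (subst sum.reindex) (auto simp: inj_on_def cube_corner_def fun_eq_iff)
    also have "\<dots> = (\<Sum>w\<in>{w\<in>X. K \<subseteq> {i. a i < w i}}. G w)"
    proof (rule sum.mono_neutral_cong)
      show "finite ((\<lambda>v. cube_corner v K) ` X)" "finite {w\<in>X. K \<subseteq> {i. a i < w i}}" using fin by auto
    next
      fix w assume w: "w \<in> {w\<in>X. K \<subseteq> {i. a i < w i}} - (\<lambda>v. cube_corner v K) ` X"
      have eq: "cube_corner (\<lambda>i. w i - (if i \<in> K then 1 else 0)) K = w" by (simp add: cube_corner_def)
      have "a i \<le> w i - (if i \<in> K then 1 else 0) \<and> w i - (if i \<in> K then 1 else 0) < N" for i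
      proof -
        have "a i \<le> w i" "w i < N" "i \<in> K \<Longrightarrow> a i < w i" using w by (auto simp: X_def)
        then show ?thesis by auto
      qed
      then have "(\<lambda>i. w i - (if i \<in> K then 1 else 0)) \<in> X" by (simp add: X_def)
      from imageI[OF this, of "\<lambda>v. cube_corner v K"] have "w \<in> (\<lambda>v. cube_corner v K) ` X" by (simp only: eq)
      with w show "G w = 0" by blast
    next
      fix w assume w: "w \<in> (\<lambda>v. cube_corner v K) ` X - {w\<in>X. K \<subseteq> {i. a i < w i}}"
      then obtain v where v: "v \<in> X" "w = cube_corner v K" by blast
      have "a i \<le> w i" for i using v by (auto simp: X_def cube_corner_def intro: order_trans add_increasing2)
      moreover have "K \<subseteq> {i. a i < w i}" using v by (auto simp: X_def cube_corner_def intro: le_less_trans)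
      with w have "w \<notin> X" by blast
      ultimately show "G w = 0" by (rule out)
    qed auto
    also have "\<dots> = (\<Sum>w\<in>X. if K \<subseteq> {i. a i < w i} then G w else 0)"
      using fin by (simp add: sum.inter_filter)
    finally show ?thesis .
  qed
  have "(\<Sum>v\<in>X. cube_sum G v) = (\<Sum>K\<in>UNIV. (-1) ^ card K * (\<Sum>v\<in>X. G (cube_corner v K)))"
    unfolding cube_sum_def by (subst sum.swap) (simp add: sum_distrib_left)
  also have "\<dots> = (\<Sum>w\<in>X. \<Sum>K\<in>UNIV. if K \<in> Pow {i. a i < w i} then (-1) ^ card K * G w else 0)"
    unfolding inner sum_distrib_left by (subst sum.swap) (auto intro!: sum.cong)
  also have "\<dots> = (\<Sum>w\<in>X. (\<Sum>K\<in>Pow {i. a i < w i}. (-1) ^ card K) * G w)"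
    by (intro sum.cong) (simp_all add: sum.If_cases sum_distrib_right Pow_def)
  also have "\<dots> = (\<Sum>w\<in>X. if w = a then G w else 0)"
  proof (rule sum.cong)
    fix w assume "w \<in> X"
    then have "{i. a i < w i} = {} \<longleftrightarrow> w = a" by (auto simp: X_def fun_eq_iff not_less intro: antisym)
    then show "(\<Sum>K\<in>Pow {i. a i < w i}. (-1) ^ card K) * G w = (if w = a then G w else 0)"
      by (simp add: alternating_sum_Pow)
  qed simp
  also have "\<dots> = G a" using fin out[of a] by (simp add: sum.delta)
  finally show "(\<Sum>v\<in>X. cube_sum G v) = G a" .
qed

section \<open>The Poincare series of the divisorial filtration\<close>

lemma div_ideal_nat: "(\<And>i. nat (v i) = nat (w i)) \<Longrightarrow> div_ideal node v = div_ideal node w"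
  by (simp add: div_ideal_def)

lemma div_codim_nat: "(\<And>i. nat (v i) = nat (w i)) \<Longrightarrow> div_codim node v = div_codim node w"
  unfolding div_codim_def by (simp add: div_ideal_nat[of v w])

lemma times_prod_div_Laurent:
  "times_prod (div_Laurent node) v =
     cube_sum (div_codim node) v - cube_sum (div_codim node) (\<lambda>i. v i - 1)"
proof -
  have L: "div_Laurent node u = div_codim node (\<lambda>i. u i + 1) - div_codim node u" for u
    unfolding div_Laurent_def by (rule quot_dim_div_ideal) simp
  have "times_prod (div_Laurent node) v = (\<Sum>K\<in>UNIV. (-1) ^ card (- K) *
      (div_codim node (cube_corner v (- K)) - div_codim node (cube_corner (\<lambda>i. v i - 1) (- K))))"
    unfolding times_prod_def L
  proof (rule sum.cong)
    fix K :: "'a set"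
    have "(\<lambda>i. v i - (if i \<in> K then 1 else 0) + 1) = cube_corner v (- K)"
      "(\<lambda>i. v i - (if i \<in> K then 1 else 0)) = cube_corner (\<lambda>i. v i - 1) (- K)"
      by (auto simp: cube_corner_def)
    then show "(-1) ^ card (- K) * (div_codim node (\<lambda>i. v i - (if i \<in> K then 1 else 0) + 1) -
        div_codim node (\<lambda>i. v i - (if i \<in> K then 1 else 0))) =
      (-1) ^ card (- K) * (div_codim node (cube_corner v (- K)) - div_codim node (cube_corner (\<lambda>i. v i - 1) (- K)))"
      by simp
  qed simp
  also have "\<dots> = (\<Sum>K\<in>UNIV. (-1) ^ card K *
      (div_codim node (cube_corner v K) - div_codim node (cube_corner (\<lambda>i. v i - 1) K)))"
    by (rule sum.reindex_bij_witness[of _ "\<lambda>K. - K" "\<lambda>K. - K"]) auto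
  finally show ?thesis by (simp add: cube_sum_def right_diff_distrib sum_subtractf)
qed

text \<open>The recursion relates the values along a diagonal, and down the diagonal a power series vanishes.\<close>

lemma power_series_unique:
  fixes P P' :: "'r::finite series"
  assumes P: "power_series P" "\<And>v. P (\<lambda>i. v i - 1) - P v = c v"
    and P': "power_series P'" "\<And>v. P' (\<lambda>i. v i - 1) - P' v = c v"
  shows "P = P'"
proof
  fix v
  have "P v - P' v = P (\<lambda>i. v i - int n) - P' (\<lambda>i. v i - int n)" for n
  proof (induction n)
    case (Suc n)
    have "(\<lambda>i. v i - int n - 1) = (\<lambda>i. v i - int (Suc n))" by (simp add: fun_eq_iff)
    with Suc P(2)[of "\<lambda>i. v i - int n"] P'(2)[of "\<lambda>i. v i - int n"] show ?case by simp
  qed simp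
  note shift = this
  obtain i :: 'r where True by blast
  define u where "u = (\<lambda>j. v j - int (nat (v i) + 1))"
  have "u i < 0" by (simp add: u_def)
  then have "P u = 0" "P' u = 0" using P(1) P'(1) unfolding power_series_def by blast+
  with shift[of "nat (v i) + 1"] show "P v = P' v" by (simp add: u_def)
qed

text \<open>The right-hand side of the recursion is itself a difference of values of \<open>cube_sum\<close> at \<open>v\<close> and \<open>v - 1\<close>
  (\<open>times_prod_div_Laurent\<close>), so \<open>- cube_sum\<close> solves it.  It is a power series because \<open>d\<close> is constant in \<open>v\<^sub>i\<close> for \<open>v\<^sub>i \<le> 0\<close>.\<close>

lemma div_Poincare_eq:
  fixes node :: "'r::finite \<Rightarrow> near_point"
  shows "div_Poincare node v = - cube_sum (div_codim node) v"
proof -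
  define P where "P = (\<lambda>v. - cube_sum (div_codim node) v)"
  have ps: "power_series P"
    unfolding power_series_def P_def
  proof (intro allI impI, elim exE)
    fix v :: "'r \<Rightarrow> int" and i assume "v i < 0"
    then have "cube_sum (div_codim node) v = 0"
      by (intro cube_sum_eq_zero[where i = i] div_codim_nat) (auto simp: cube_corner_def)
    then show "- cube_sum (div_codim node) v = 0" by simp
  qed
  have eq: "P (\<lambda>i. v i - 1) - P v = times_prod (div_Laurent node) v" for v
    by (simp add: P_def times_prod_div_Laurent)
  have "div_Poincare node = P"
    unfolding div_Poincare_def
    by (rule the_equality) (use ps eq power_series_unique[of _ "times_prod (div_Laurent node)" P] in blast)+
  then show ?thesis by (simp add: P_def)
qed

text \<open>By the comparison of valuations, one sufficiently strong condition \<open>v\<^sub>j \<ge> N\<close> implies all the conditions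
  \<open>v\<^sub>i \<ge> b\<^sub>i\<close>.\<close>

lemma div_ideal_comparison:
  fixes node :: "'r::finite \<Rightarrow> near_point"
  obtains N where "\<And>w j. N \<le> w j \<Longrightarrow> div_ideal node w \<subseteq> div_ideal node (\<lambda>i. max (w i) (b i))"
proof -
  define N where "N = Max (range (\<lambda>(i, j). int (3 ^ length (node j) * nat (b i))))"
  have N: "int (3 ^ length (node j) * nat (b i)) \<le> N" for i j
    unfolding N_def by (intro Max_ge) (auto intro!: rev_image_eqI[of "(i, j)"])
  have "div_ideal node w \<subseteq> div_ideal node (\<lambda>i. max (w i) (b i))" if w: "N \<le> w j" for w j
  proof
    fix g assume g: "g \<in> div_ideal node w"
    then have h: "holo_germ g" and val: "\<And>i. enat (nat (w i)) \<le> exc_val (node i) g" by (auto simp: div_ideal_iff)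
    have "enat (nat (b i)) \<le> exc_val (node i) g" for i
    proof (rule exc_val_comparison[OF h])
      have "3 ^ length (node j) * nat (b i) \<le> nat (w j)" using N[of j i] w by linarith
      then show "enat (3 ^ length (node j) * nat (b i)) \<le> exc_val (node j) g"
        using val[of j] by (meson enat_ord_simps(1) order_trans)
    qed
    with val h show "g \<in> div_ideal node (\<lambda>i. max (w i) (b i))"
      unfolding div_ideal_iff by (auto simp: max_def)
  qed
  then show ?thesis by (rule that)
qed

text \<open>Applied to \<open>G(w) = d(max(w,b)) - d(w)\<close>, the mixed difference is \<open>P\<close> where \<open>v \<not>\<ge> b\<close> and \<open>0\<close>
  elsewhere.  By \<open>div_ideal_comparison\<close> the function \<open>G\<close> has finite support in \<open>w \<ge> a\<close>, and
  \<open>G(a) = d(b) - d(a)\<close>.\<close>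

lemma sum_div_Poincare:
  fixes node :: "'r::finite \<Rightarrow> near_point"
  assumes ab: "\<And>i. a i \<le> b i"
  defines "S \<equiv> {v. (\<forall>i. a i \<le> v i) \<and> \<not> (\<forall>i. b i \<le> v i) \<and> div_Poincare node v \<noteq> 0}"
  shows "finite S" "(\<Sum>v\<in>S. div_Poincare node v) = div_codim node b - div_codim node a"
proof -
  define G where "G = (\<lambda>w. div_codim node (\<lambda>i. max (w i) (b i)) - div_codim node w)"
  obtain N where N: "\<And>w j. N \<le> w j \<Longrightarrow> div_ideal node w \<subseteq> div_ideal node (\<lambda>i. max (w i) (b i))"
    using div_ideal_comparison[of node b] by blast
  have G0: "G w = 0" if "N \<le> w j" for w j
  proof -
    have "div_ideal node (\<lambda>i. max (w i) (b i)) = div_ideal node w"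
      using N[of w j, OF that] div_ideal_antimono[of w "\<lambda>i. max (w i) (b i)" node] by auto
    then show ?thesis by (simp add: G_def div_codim_def)
  qed
  have cube: "cube_sum G v = (if \<forall>i. b i \<le> v i then 0 else div_Poincare node v)" for v
  proof (cases "\<forall>i. b i \<le> v i")
    case True
    then have "(\<lambda>i. max (cube_corner v K i) (b i)) = cube_corner v K" for K
      by (auto simp: cube_corner_def fun_eq_iff intro: add_increasing2 max_absorb1)
    with True show ?thesis by (simp add: cube_sum_def G_def)
  next
    case False
    then obtain j where j: "v j < b j" by (auto simp: not_le)
    have "cube_sum (\<lambda>w. div_codim node (\<lambda>i. max (w i) (b i))) v = 0"
    proof (rule cube_sum_eq_zero[where i = j])
      fix K
      have "(\<lambda>i. max (cube_corner v (insert j K) i) (b i)) = (\<lambda>i. max (cube_corner v K i) (b i))"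
        using j by (auto simp: cube_corner_def fun_eq_iff)
      then show "div_codim node (\<lambda>i. max (cube_corner v (insert j K) i) (b i)) =
          div_codim node (\<lambda>i. max (cube_corner v K i) (b i))" by simp
    qed
    with False show ?thesis
      by (auto simp: div_Poincare_eq cube_sum_def G_def right_diff_distrib sum_subtractf)
  qed
  define X where "X = {w. \<forall>i. a i \<le> w i \<and> w i < N}"
  have X: "finite X" "(\<Sum>v\<in>X. cube_sum G v) = G a"
    unfolding X_def by (rule sum_cube_sum, rule G0, assumption)+
  have "cube_sum G v = 0" if v: "\<forall>i. a i \<le> v i" "v \<notin> X" for v
  proof -
    obtain j where "N \<le> v j" using v by (auto simp: X_def not_less)
    then have "N \<le> cube_corner v K j" for K by (simp add: cube_corner_def)
    then show ?thesis unfolding cube_sum_def using G0 by (intro sum.neutral) auto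
  qed
  note outside = this
  have sub: "S \<subseteq> X"
  proof (rule subsetI, rule ccontr)
    fix v assume "v \<in> S" "v \<notin> X"
    with outside[of v] cube[of v] show False by (auto simp: S_def split: if_splits)
  qed
  with X(1) show "finite S" by (rule finite_subset[rotated])
  have "(\<Sum>v\<in>X. cube_sum G v) = (\<Sum>v\<in>S. div_Poincare node v)"
    by (rule sum.mono_neutral_cong_right[OF X(1) sub]) (auto simp: cube S_def X_def)
  moreover have "(\<lambda>i. max (a i) (b i)) = b" using ab by (simp add: fun_eq_iff max_def)
  ultimately show "(\<Sum>v\<in>S. div_Poincare node v) = div_codim node b - div_codim node a"
    using X(2) by (simp add: G_def)
qed

lemma Min_range_eq_iff:
  fixes w :: "'r::finite \<Rightarrow> int"
  shows "Min (range w) = k \<longleftrightarrow> (\<forall>i. k \<le> w i) \<and> \<not> (\<forall>i. k + 1 \<le> w i)"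
proof -
  have "Min (range w) = k \<longleftrightarrow> k \<le> Min (range w) \<and> \<not> k + 1 \<le> Min (range w)" by linarith
  also have "\<dots> \<longleftrightarrow> (\<forall>i. k \<le> w i) \<and> \<not> (\<forall>i. k + 1 \<le> w i)" by (subst (1 2) Min_ge_iff) auto
  finally show ?thesis .
qed

text \<open>The monomials sent to \<open>t\<^sup>k\<close> are the \<open>w = s v + M\<close> with \<open>min w = k\<close>, that is, with \<open>v\<close> above the
  level of \<open>k\<close> but not above that of \<open>k + 1\<close>.\<close>

lemma sum_subst_powers_level:
  fixes node :: "'r::finite \<Rightarrow> near_point" and s M :: "'r \<Rightarrow> nat" and k :: nat
  assumes s: "\<And>i. 0 < s i"
  defines "R \<equiv> {w. subst_powers s (div_Poincare node) (\<lambda>i. w i - int (M i)) \<noteq> 0 \<and> Min (range w) = int k}"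
  shows "finite R"
    "(\<Sum>w\<in>R. subst_powers s (div_Poincare node) (\<lambda>i. w i - int (M i))) =
      div_codim node (ceiling_level s M (Suc k)) - div_codim node (ceiling_level s M k)"
proof -
  let ?a = "ceiling_level s M k" and ?b = "ceiling_level s M (Suc k)"
  let ?S = "{v. (\<forall>i. ?a i \<le> v i) \<and> \<not> (\<forall>i. ?b i \<le> v i) \<and> div_Poincare node v \<noteq> 0}"
  have ab: "?a i \<le> ?b i" for i
    by (simp add: ceiling_level_def ceiling_mono divide_right_mono)
  \<comment> \<open>The substitution \<open>t\<^sub>i \<mapsto> t\<^sub>i\<^bsup>s\<^sub>i\<^esup>\<close> followed by multiplication with \<open>t\<^bsup>M\<^esup>\<close>, on exponents.\<close>
  define t where "t = (\<lambda>v i. int (s i) * v i + int (M i))"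
  have val: "subst_powers s (div_Poincare node) (\<lambda>i. t v i - int (M i)) = div_Poincare node v" for v
    using s by (simp add: subst_powers_def t_def)
  have inj: "inj t"
  proof (rule injI)
    fix v v' assume eq: "t v = t v'"
    show "v = v'"
    proof
      fix i show "v i = v' i" using fun_cong[OF eq, of i] s[of i] by (simp add: t_def)
    qed
  qed
  have Min_t: "Min (range (t v)) = int k \<longleftrightarrow> (\<forall>i. ?a i \<le> v i) \<and> \<not> (\<forall>i. ?b i \<le> v i)" for v
    unfolding Min_range_eq_iff by (simp add: ceiling_level_le_iff s t_def add.commute)
  have R: "R = t ` ?S"
  proof (intro set_eqI iffI)
    fix w assume w: "w \<in> R"
    then have nz: "subst_powers s (div_Poincare node) (\<lambda>i. w i - int (M i)) \<noteq> 0" by (simp add: R_def)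
    then have dv: "\<forall>i. int (s i) dvd w i - int (M i)" by (auto simp: subst_powers_def split: if_splits)
    define v where "v = (\<lambda>i. (w i - int (M i)) div int (s i))"
    have wt: "w = t v" using dv by (auto simp: t_def v_def fun_eq_iff)
    with w nz have "v \<in> ?S" using val[of v] Min_t[of v] by (simp add: R_def)
    with wt show "w \<in> t ` ?S" by blast
  next
    fix w assume "w \<in> t ` ?S"
    then show "w \<in> R" using val Min_t by (auto simp: R_def)
  qed
  show "finite R" unfolding R by (intro finite_imageI sum_div_Poincare(1) ab)
  show "(\<Sum>w\<in>R. subst_powers s (div_Poincare node) (\<lambda>i. w i - int (M i))) =
      div_codim node ?b - div_codim node ?a"
    unfolding R using inj sum_div_Poincare(2)[of ?a ?b node, OF ab]
    by (subst sum.reindex) (auto simp: val o_def intro: inj_on_subset)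
qed

lemma reduction_support_times_one_plus_monom:
  fixes node :: "'r::finite \<Rightarrow> near_point" and s M :: "'r \<Rightarrow> nat" and k :: nat
  assumes s: "\<And>i. 0 < s i"
  defines "Q \<equiv> times_one_plus_monom M (subst_powers s (div_Poincare node))"
  shows "finite (reduction_support Q k)"
    "(\<Sum>w\<in>reduction_support Q k. Q w) =
      (div_codim node (ceiling_level s (\<lambda>i. 0) (Suc k)) - div_codim node (ceiling_level s (\<lambda>i. 0) k)) +
      (div_codim node (ceiling_level s M (Suc k)) - div_codim node (ceiling_level s M k))"
proof -
  define P where "P = subst_powers s (div_Poincare node)"
  define R where "R = (\<lambda>M :: 'r \<Rightarrow> nat. {w. P (\<lambda>i. w i - int (M i)) \<noteq> 0 \<and> Min (range w) = int k})"
  have fin: "finite (R M)" for M unfolding R_def P_def by (rule sum_subst_powers_level(1)[OF s])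
  have sums: "(\<Sum>w\<in>R M. P (\<lambda>i. w i - int (M i))) =
      div_codim node (ceiling_level s M (Suc k)) - div_codim node (ceiling_level s M k)" for M
    unfolding R_def P_def by (rule sum_subst_powers_level(2)[OF s])
  have Q: "Q w = P (\<lambda>i. w i - int 0) + P (\<lambda>i. w i - int (M i))" for w
    by (simp add: Q_def P_def times_one_plus_monom_def)
  let ?Z = "R (\<lambda>i. 0) \<union> R M"
  have finZ: "finite ?Z" using fin by blast
  have sub: "reduction_support Q k \<subseteq> ?Z" by (auto simp: reduction_support_def R_def Q)
  show "finite (reduction_support Q k)" by (rule finite_subset[OF sub finZ])
  have "(\<Sum>w\<in>reduction_support Q k. Q w) = (\<Sum>w\<in>?Z. Q w)"
    by (rule sum.mono_neutral_left[OF finZ sub]) (auto simp: reduction_support_def R_def)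
  also have "\<dots> = (\<Sum>w\<in>?Z. P (\<lambda>i. w i - int 0)) + (\<Sum>w\<in>?Z. P (\<lambda>i. w i - int (M i)))"
    unfolding Q by (rule sum.distrib)
  also have "(\<Sum>w\<in>?Z. P (\<lambda>i. w i - int 0)) = (\<Sum>w\<in>R (\<lambda>i. 0). P (\<lambda>i. w i - int 0))"
    by (rule sum.mono_neutral_right[OF finZ]) (auto simp: R_def)
  also have "(\<Sum>w\<in>?Z. P (\<lambda>i. w i - int (M i))) = (\<Sum>w\<in>R M. P (\<lambda>i. w i - int (M i)))"
    by (rule sum.mono_neutral_right[OF finZ]) (auto simp: R_def)
  finally have "(\<Sum>w\<in>reduction_support Q k. Q w) =
      (\<Sum>w\<in>R (\<lambda>i. 0). P (\<lambda>i. w i - int 0)) + (\<Sum>w\<in>R M. P (\<lambda>i. w i - int (M i)))" .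
  then show "(\<Sum>w\<in>reduction_support Q k. Q w) =
      (div_codim node (ceiling_level s (\<lambda>i. 0) (Suc k)) - div_codim node (ceiling_level s (\<lambda>i. 0) k)) +
      (div_codim node (ceiling_level s M (Suc k)) - div_codim node (ceiling_level s M k))"
    using sums[of M] sums[of "\<lambda>i. 0"] by simp
qed

lemma reduced_germ_nonzero:
  assumes "reduced_germ f" shows "\<exists>\<^sub>F x in nhds (0 :: complex ^ 2). f x \<noteq> 0"
proof (rule ccontr)
  assume "\<not> ?thesis"
  then have "\<forall>\<^sub>F x in nhds 0. f x = (0)\<^sup>2 * 0" by (simp add: frequently_def)
  moreover have "holo_germ (\<lambda>x :: complex ^ 2. 0)" by (rule holo_germ_const)
  ultimately show False using assms unfolding reduced_germ_def by blast
qed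

theorem theorem1:
  fixes f :: "complex ^ 2 \<Rightarrow> complex" and node :: "'r::finite \<Rightarrow> near_point"
  assumes "reduced_germ f"
    and "embedded_resolution node f"
    and "strict_curve_points node f \<subseteq> (\<Union>i\<in>{i. even (curve_mult node f i)}. exc_component node i)"
  shows "reducible_series (Q_series node f) \<and>
    arc_Poincare (stabilization f) = reduction (Q_series node f)"
proof -
  have f: "holo_germ f" "\<exists>\<^sub>F x in nhds 0. f x \<noteq> 0" "f 0 = 0"
    using assms(1) reduced_germ_nonzero by (auto simp: reduced_germ_def)
  have node: "blowup_centres node" using assms(2) by (simp add: embedded_resolution_def)
  have mult: "curve_mult node f i = exc_mult f (node i)" for i
    by (simp add: curve_mult_def exc_mult_def div_val_eq_exc_val)
  have strict: "strict_curve_points node f \<subseteq> (\<Union>i\<in>{i. even (exc_mult f (node i))}. exc_component node i)"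
    using assms(3) by (simp add: mult)
  define s where "s = parity_factor f \<circ> node"
  define M where "M = cover_shift f \<circ> node"
  have sigma: "sigma node f = s" by (simp add: fun_eq_iff sigma_def s_def parity_factor_def mult)
  have Q: "Q_series node f = times_one_plus_monom M (subst_powers s (div_Poincare node))"
    unfolding Q_series_def sigma by (simp add: M_def s_def cover_shift_def mult o_def)
  have s: "0 < s i" for i by (simp add: s_def)
  note red = reduction_support_times_one_plus_monom[of s M node, OF s, folded Q]
  have mono: "ceiling_level s M k i \<le> ceiling_level s M (Suc k) i" for M k i
    by (simp add: ceiling_level_def ceiling_mono divide_right_mono)
  have "arc_Poincare (stabilization f) = reduction (Q_series node f)"
  proof (rule fps_ext)
    fix k
    have "fps_nth (arc_Poincare (stabilization f)) k =
        int (quot_dim (div_ideal node (ceiling_level s (\<lambda>i. 0) k)) (div_ideal node (ceiling_level s (\<lambda>i. 0) (Suc k)))) +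
        int (quot_dim (div_ideal node (ceiling_level s M k)) (div_ideal node (ceiling_level s M (Suc k))))"
      unfolding arc_Poincare_def s_def M_def by (simp add: quot_dim_arc_filtration[OF f node strict])
    also have "\<dots> = fps_nth (reduction (Q_series node f)) k"
      unfolding quot_dim_div_ideal[OF mono] by (simp add: reduction_def red(2))
    finally show "fps_nth (arc_Poincare (stabilization f)) k = fps_nth (reduction (Q_series node f)) k" .
  qed
  moreover have "reducible_series (Q_series node f)" unfolding reducible_series_def using red(1) by blast
  ultimately show ?thesis by blast
qed

end
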